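(* Any Lie algebra $\mathfrak{g}$ (finite-dimensional, real) of constant height is isomorphic to one of the following. - An abelian Lie algebra $\mathbb{R}^n$; this has constant height $0$. - The semi-direct product $\mathbb{R}\ltimes\mathbb{R}^n$, for the representation $\lambda\mapsto\lambda\,\mathrm{id}_{\mathbb{R}^n}$ of $\mathbb{R}$ on $\mathbb{R}^n$; this has constant height $0$. - The Lie algebra $\mathfrak{so}(3)$; this has constant height $1$.
   Context: All Lie algebras are real and finite-dimensional. For a Lie algebra $\mathfrak{g}$, let $d_{\mathfrak{g}}:\wedge^\bullet\mathfrak{g}^*\to\wedge^{\bullet+1}\mathfrak{g}^*$ denote the Chevalley–Eilenberg differential (so $(d_{\mathfrak g}\xi)(X,Y)=-\xi([X,Y])$ for $\xi\in\mathfrak{g}^*$). The height of $\xi\in\mathfrak{g}^*\setminus\{0\}$ is the integer $k\in\mathbb{N}_0$ with $\xi\wedge(d_{\mathfrak g}\xi)^k\ne0$ and $\xi\wedge(d_{\mathfrak g}\xi)^{k+1}=0$. $\mathfrak{g}$ is of constant height $k$ if all $\xi\in\mathfrak{g}^*\setminus\{0\}$ have height $k$, and of constant height if it is of constant height $k$ for some $k\ge0$. *)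

theory Defs
  imports "HOL-Analysis.Analysis" "HOL-Analysis.Finite_Function_Topology"
begin

text \<open>
  A Lie algebra lives on a linear subspace of an ambient real vector space, rather than on a whole
  type, so that the dimension of the model algebras below can be an ordinary natural number.
  The values of the bracket outside the carrier are irrelevant.
\<close>

record 'a lie_alg =
  carrier :: "'a set"
  bracket :: "'a \<Rightarrow> 'a \<Rightarrow> 'a"

locale lie_algebra =
  fixes \<gg> :: "'a::real_vector lie_alg"
  assumes subspace_carrier: "subspace (carrier \<gg>)"
    and finite_dim: "\<exists>B. finite B \<and> span B = carrier \<gg>"
    and bracket_closed: "\<lbrakk>x \<in> carrier \<gg>; y \<in> carrier \<gg>\<rbrakk> \<Longrightarrow> bracket \<gg> x y \<in> carrier \<gg>"
    and bracket_add_left: "\<lbrakk>x \<in> carrier \<gg>; y \<in> carrier \<gg>; z \<in> carrier \<gg>\<rbrakk> \<Longrightarrow>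
      bracket \<gg> (x + y) z = bracket \<gg> x z + bracket \<gg> y z"
    and bracket_add_right: "\<lbrakk>x \<in> carrier \<gg>; y \<in> carrier \<gg>; z \<in> carrier \<gg>\<rbrakk> \<Longrightarrow>
      bracket \<gg> x (y + z) = bracket \<gg> x y + bracket \<gg> x z"
    and bracket_scale_left: "\<lbrakk>x \<in> carrier \<gg>; y \<in> carrier \<gg>\<rbrakk> \<Longrightarrow>
      bracket \<gg> (c *\<^sub>R x) y = c *\<^sub>R bracket \<gg> x y"
    and bracket_scale_right: "\<lbrakk>x \<in> carrier \<gg>; y \<in> carrier \<gg>\<rbrakk> \<Longrightarrow>
      bracket \<gg> x (c *\<^sub>R y) = c *\<^sub>R bracket \<gg> x y"
    and bracket_self: "x \<in> carrier \<gg> \<Longrightarrow> bracket \<gg> x x = 0"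
    and jacobi: "\<lbrakk>x \<in> carrier \<gg>; y \<in> carrier \<gg>; z \<in> carrier \<gg>\<rbrakk> \<Longrightarrow>
      bracket \<gg> x (bracket \<gg> y z) + bracket \<gg> y (bracket \<gg> z x) + bracket \<gg> z (bracket \<gg> x y) = 0"

definition lie_isomorphism ::
    "('a::real_vector \<Rightarrow> 'b::real_vector) \<Rightarrow> 'a lie_alg \<Rightarrow> 'b lie_alg \<Rightarrow> bool" where
  "lie_isomorphism \<phi> \<gg> \<hh> \<longleftrightarrow>
     bij_betw \<phi> (carrier \<gg>) (carrier \<hh>) \<and>
     (\<forall>x\<in>carrier \<gg>. \<forall>y\<in>carrier \<gg>. \<phi> (x + y) = \<phi> x + \<phi> y) \<and>
     (\<forall>c. \<forall>x\<in>carrier \<gg>. \<phi> (c *\<^sub>R x) = c *\<^sub>R \<phi> x) \<and>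
     (\<forall>x\<in>carrier \<gg>. \<forall>y\<in>carrier \<gg>. \<phi> (bracket \<gg> x y) = bracket \<hh> (\<phi> x) (\<phi> y))"

definition lie_isomorphic ::
    "'a::real_vector lie_alg \<Rightarrow> 'b::real_vector lie_alg \<Rightarrow> bool" (infix "\<cong>\<^sub>L" 50) where
  "\<gg> \<cong>\<^sub>L \<hh> \<longleftrightarrow> (\<exists>\<phi>. lie_isomorphism \<phi> \<gg> \<hh>)"

text \<open>
  Exterior forms on a Lie algebra are represented as alternating multilinear maps; a form of degree
  \<open>p\<close> takes a list of \<open>p\<close> arguments from the carrier. Its values on other lists are irrelevant, so
  the degrees are explicit parameters of the wedge product.
\<close>

type_synonym 'a form = "'a list \<Rightarrow> real"

definition form_zero_on :: "'a lie_alg \<Rightarrow> nat \<Rightarrow> 'a form \<Rightarrow> bool" where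
  "form_zero_on \<gg> p \<omega> \<longleftrightarrow> (\<forall>X. length X = p \<and> set X \<subseteq> carrier \<gg> \<longrightarrow> \<omega> X = 0)"

text \<open>
  The dual space: functions that are linear on the carrier; two of them are the same element of the
  dual if they agree on the carrier.
\<close>

definition lie_dual :: "'a::real_vector lie_alg \<Rightarrow> ('a \<Rightarrow> real) set" where
  "lie_dual \<gg> = {\<xi>. (\<forall>x\<in>carrier \<gg>. \<forall>y\<in>carrier \<gg>. \<xi> (x + y) = \<xi> x + \<xi> y) \<and>
                    (\<forall>c. \<forall>x\<in>carrier \<gg>. \<xi> (c *\<^sub>R x) = c * \<xi> x)}"

definition one_form :: "('a \<Rightarrow> real) \<Rightarrow> 'a form" where
  "one_form \<xi> = (\<lambda>X. \<xi> (X ! 0))"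

definition wedge :: "nat \<Rightarrow> nat \<Rightarrow> 'a form \<Rightarrow> 'a form \<Rightarrow> 'a form" where
  "wedge p q \<alpha> \<beta> = (\<lambda>X. (1 / (fact p * fact q)) *
     (\<Sum>\<sigma> | \<sigma> permutes {..<p + q}. of_int (sign \<sigma>) *
        \<alpha> (map (\<lambda>i. X ! \<sigma> i) [0..<p]) * \<beta> (map (\<lambda>i. X ! \<sigma> i) [p..<p + q])))"

text \<open>The \<open>k\<close>-th wedge power of a form of degree \<open>p\<close>, a form of degree \<open>k * p\<close>.\<close>

primrec wedge_power :: "nat \<Rightarrow> 'a form \<Rightarrow> nat \<Rightarrow> 'a form" where
  "wedge_power p \<omega> 0 = (\<lambda>_. 1)"
| "wedge_power p \<omega> (Suc k) = wedge p (k * p) \<omega> (wedge_power p \<omega> k)"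

text \<open>
  The Chevalley--Eilenberg differential with trivial coefficients; \<open>nths X (- {i, j})\<close> omits the
  \<open>i\<close>-th and \<open>j\<close>-th arguments. The degree is read off from the number of arguments.
\<close>

definition ce_diff :: "'a lie_alg \<Rightarrow> 'a form \<Rightarrow> 'a form" where
  "ce_diff \<gg> \<omega> = (\<lambda>X. \<Sum>j<length X. \<Sum>i<j.
     (-1) ^ (i + j) * \<omega> (bracket \<gg> (X ! i) (X ! j) # nths X (- {i, j})))"

lemma ce_diff_one_form: "ce_diff \<gg> (one_form \<xi>) [x, y] = - \<xi> (bracket \<gg> x y)"
  by (simp add: ce_diff_def one_form_def numeral_2_eq_2)

definition has_height :: "'a::real_vector lie_alg \<Rightarrow> ('a \<Rightarrow> real) \<Rightarrow> nat \<Rightarrow> bool" where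
  "has_height \<gg> \<xi> k \<longleftrightarrow>
     (let \<eta> = (\<lambda>m. wedge 1 (2 * m) (one_form \<xi>) (wedge_power 2 (ce_diff \<gg> (one_form \<xi>)) m))
      in \<not> form_zero_on \<gg> (2 * k + 1) (\<eta> k) \<and> form_zero_on \<gg> (2 * (k + 1) + 1) (\<eta> (k + 1)))"

definition constant_height :: "'a::real_vector lie_alg \<Rightarrow> nat \<Rightarrow> bool" where
  "constant_height \<gg> k \<longleftrightarrow>
     (\<forall>\<xi>\<in>lie_dual \<gg>. (\<exists>x\<in>carrier \<gg>. \<xi> x \<noteq> 0) \<longrightarrow> has_height \<gg> \<xi> k)"

definition has_constant_height :: "'a::real_vector lie_alg \<Rightarrow> bool" where
  "has_constant_height \<gg> \<longleftrightarrow> (\<exists>k. constant_height \<gg> k)"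

definition abelian_lie :: "'a::real_vector set \<Rightarrow> 'a lie_alg" where
  "abelian_lie V = \<lparr>carrier = V, bracket = (\<lambda>_ _. 0)\<rparr>"

text \<open>
  The space \<open>\<real>\<^sup>n\<close> for a natural number \<open>n\<close>: the finitely supported real sequences supported in
  \<open>{..<n}\<close>.
\<close>

definition Rn :: "nat \<Rightarrow> (nat \<Rightarrow>\<^sub>0 real) set" where
  "Rn n = {x. Poly_Mapping.keys x \<subseteq> {..<n}}"

text \<open>\<open>\<gg> \<ltimes> \<hh>\<close> for a representation \<open>\<rho>\<close> of \<open>\<gg>\<close> on \<open>\<hh>\<close> by derivations.\<close>

definition semidirect_lie ::
    "'a::real_vector lie_alg \<Rightarrow> ('a \<Rightarrow> 'b \<Rightarrow> 'b) \<Rightarrow> 'b::real_vector lie_alg \<Rightarrow> ('a \<times> 'b) lie_alg" where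
  "semidirect_lie \<gg> \<rho> \<hh> =
     \<lparr>carrier = carrier \<gg> \<times> carrier \<hh>,
      bracket = (\<lambda>(s, x) (t, y). (bracket \<gg> s t, bracket \<hh> x y + \<rho> s y - \<rho> t x))\<rparr>"

definition Rn_lie :: "nat \<Rightarrow> (nat \<Rightarrow>\<^sub>0 real) lie_alg" where
  "Rn_lie n = abelian_lie (Rn n)"

definition R_semidirect_Rn_lie :: "nat \<Rightarrow> (real \<times> (nat \<Rightarrow>\<^sub>0 real)) lie_alg" where
  "R_semidirect_Rn_lie n = semidirect_lie (abelian_lie UNIV) (\<lambda>t x. t *\<^sub>R x) (Rn_lie n)"

definition so3_lie :: "(real^3^3) lie_alg" where
  "so3_lie = \<lparr>carrier = {A. transpose A = - A}, bracket = (\<lambda>A B. A ** B - B ** A)\<rparr>"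

lemma lookup_scaleR: "Poly_Mapping.lookup (c *\<^sub>R x) i = c *\<^sub>R Poly_Mapping.lookup x i"
proof -
  have "finite {i. c *\<^sub>R Poly_Mapping.lookup x i \<noteq> 0}"
    by (rule finite_subset[OF _ finite_keys[of x]]) (auto simp: in_keys_iff)
  then show ?thesis
    by (simp add: scaleR_poly_mapping_def Abs_poly_mapping_inverse)
qed

lemma subspace_Rn: "subspace (Rn n)"
  unfolding subspace_def Rn_def
  by (auto simp: in_keys_iff lookup_add lookup_scaleR
           dest!: subsetD)

lemma span_Rn: "span ((\<lambda>i. Poly_Mapping.single i 1) ` {..<n}) = Rn n"
proof
  have "(\<lambda>i. Poly_Mapping.single i 1) ` {..<n} \<subseteq> Rn n"
    by (auto simp: Rn_def)
  then show "span ((\<lambda>i. Poly_Mapping.single i 1) ` {..<n}) \<subseteq> Rn n"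
    by (rule span_minimal[OF _ subspace_Rn])
  show "Rn n \<subseteq> span ((\<lambda>i. Poly_Mapping.single i 1) ` {..<n})"
  proof
    fix x assume x: "x \<in> Rn n"
    have "x = (\<Sum>i<n. Poly_Mapping.lookup x i *\<^sub>R Poly_Mapping.single i 1)"
    proof (rule poly_mapping_eqI)
      fix k
      show "Poly_Mapping.lookup x k =
        Poly_Mapping.lookup (\<Sum>i<n. Poly_Mapping.lookup x i *\<^sub>R Poly_Mapping.single i 1) k"
        using x
        by (auto simp: lookup_sum lookup_scaleR lookup_single when_def Rn_def in_keys_iff subset_iff if_distrib
                 sum.delta' not_less cong: if_cong)
    qed
    also have "\<dots> \<in> span ((\<lambda>i. Poly_Mapping.single i 1) ` {..<n})"
      by (intro span_sum span_scale span_base) auto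
    finally show "x \<in> span ((\<lambda>i. Poly_Mapping.single i 1) ` {..<n})" .
  qed
qed

lemma lie_algebra_Rn: "lie_algebra (Rn_lie n)"
  by standard
     (use span_Rn[of n] in \<open>auto simp: Rn_lie_def abelian_lie_def subspace_Rn subspace_0
        intro!: exI[of _ "(\<lambda>i. Poly_Mapping.single i 1) ` {..<n}"]\<close>)

lemma lie_algebra_R_semidirect_Rn: "lie_algebra (R_semidirect_Rn_lie n)"
proof
  let ?B = "Pair 1 ` {0} \<union> Pair 0 ` (\<lambda>i. Poly_Mapping.single i 1) ` {..<n}
    :: (real \<times> (nat \<Rightarrow>\<^sub>0 real)) set"
  have c: "carrier (R_semidirect_Rn_lie n) = UNIV \<times> Rn n"
    by (simp add: R_semidirect_Rn_lie_def Rn_lie_def semidirect_lie_def abelian_lie_def)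
  show s: "subspace (carrier (R_semidirect_Rn_lie n))"
    unfolding c using subspace_Rn[of n] by (auto simp: subspace_def zero_prod_def)
  have "span ?B = UNIV \<times> Rn n"
  proof
    show "span ?B \<subseteq> UNIV \<times> Rn n"
      using s unfolding c
      by (intro span_minimal) (auto simp: Rn_def zero_prod_def)
    have lin: "linear (Pair (0::real) :: (nat \<Rightarrow>\<^sub>0 real) \<Rightarrow> _)"
      by (rule linearI) auto
    show "UNIV \<times> Rn n \<subseteq> span ?B"
    proof clarify
      fix t x assume "x \<in> Rn n"
      then have "Pair (0::real) x \<in> span (Pair 0 ` (\<lambda>i. Poly_Mapping.single i 1) ` {..<n})"
        using linear_span_image[OF lin] span_Rn[of n] by blast
      then have "Pair (0::real) x \<in> span ?B"
        by (meson span_mono subsetD sup_ge2)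
      moreover have "t *\<^sub>R (1, 0) \<in> span ?B"
        by (intro span_scale span_base) auto
      ultimately have "t *\<^sub>R (1, 0) + (0, x) \<in> span ?B"
        by (rule span_add[rotated])
      then show "(t, x) \<in> span ?B"
        by simp
    qed
  qed
  moreover have "finite ?B" by auto
  ultimately show "\<exists>B. finite B \<and> span B = carrier (R_semidirect_Rn_lie n)"
    unfolding c by blast
qed (use subspace_Rn[of n] in \<open>auto simp: R_semidirect_Rn_lie_def Rn_lie_def semidirect_lie_def
       abelian_lie_def subspace_diff subspace_scale zero_prod_def algebra_simps\<close>)

lemma lie_algebra_so3: "lie_algebra so3_lie"
proof
  have tadd: "transpose (A + B) = transpose A + transpose B" for A B :: "real^3^3"
    by (simp add: transpose_def vec_eq_iff)
  have tsc: "transpose (c *\<^sub>R A) = c *\<^sub>R transpose A" for c and A :: "real^3^3"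
    by (simp add: transpose_def vec_eq_iff)
  have tdf: "transpose (A - B) = transpose A - transpose B" for A B :: "real^3^3"
    by (simp add: transpose_def vec_eq_iff)
  have neg: "(- A) ** (- B) = A ** B" for A B :: "real^3^3"
    by (simp add: matrix_matrix_mult_def vec_eq_iff)
  have assoc: "A ** (B ** C) = A ** B ** C" for A B C :: "real^3^3"
    by (rule matrix_mul_assoc)
  have dl: "(A - B) ** C = A ** C - B ** C" for A B C :: "real^3^3"
    by (simp add: matrix_matrix_mult_def vec_eq_iff sum_subtractf algebra_simps)
  have dr: "C ** (A - B) = C ** A - C ** B" for A B C :: "real^3^3"
    by (simp add: matrix_matrix_mult_def vec_eq_iff sum_subtractf algebra_simps)
  have al: "(A + B) ** C = A ** C + B ** C" for A B C :: "real^3^3"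
    by (simp add: matrix_matrix_mult_def vec_eq_iff sum.distrib algebra_simps)
  have ar: "C ** (A + B) = C ** A + C ** B" for A B C :: "real^3^3"
    by (rule matrix_add_ldistrib)
  have sl: "(c *\<^sub>R A) ** B = c *\<^sub>R (A ** B)" for c and A B :: "real^3^3"
    by (simp add: matrix_matrix_mult_def vec_eq_iff sum_distrib_left algebra_simps)
  have sr: "A ** (c *\<^sub>R B) = c *\<^sub>R (A ** B)" for c and A B :: "real^3^3"
    by (simp add: matrix_matrix_mult_def vec_eq_iff sum_distrib_left algebra_simps)
  show s: "subspace (carrier so3_lie)"
    by (auto simp: so3_lie_def subspace_def tadd tsc) (simp add: transpose_def vec_eq_iff)
  show "\<exists>B. finite B \<and> span B = carrier so3_lie"
    using s by (metis basis_exists finiteI_independent span_subspace)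
  fix x y z :: "real^3^3" and c :: real
  show "bracket so3_lie (x + y) z = bracket so3_lie x z + bracket so3_lie y z"
    "bracket so3_lie x (y + z) = bracket so3_lie x y + bracket so3_lie x z"
    "bracket so3_lie (c *\<^sub>R x) y = c *\<^sub>R bracket so3_lie x y"
    "bracket so3_lie x (c *\<^sub>R y) = c *\<^sub>R bracket so3_lie x y"
    "bracket so3_lie x x = 0"
    by (simp_all add: so3_lie_def al ar sl sr algebra_simps)
  show "bracket so3_lie x (bracket so3_lie y z) + bracket so3_lie y (bracket so3_lie z x) +
    bracket so3_lie z (bracket so3_lie x y) = 0"
    by (simp add: so3_lie_def dl dr assoc)
  assume "x \<in> carrier so3_lie" "y \<in> carrier so3_lie"
  then show "bracket so3_lie x y \<in> carrier so3_lie"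
    by (simp add: so3_lie_def tdf matrix_transpose_mul neg)
qed

end

theory Submission
  imports Defs "HOL-Computational_Algebra.Fundamental_Theorem_Algebra"
begin

text \<open>
  For a functional \<open>\<xi>\<close> let \<open>\<g>\<^sub>\<xi>\<close> be the radical of \<open>d\<xi>\<close>.

  If the height is \<open>0\<close>, every hyperplane is a subalgebra, so \<open>[x, y]\<close> always lies in the span of
  \<open>x\<close> and \<open>y\<close>, which forces the first two cases.

  If the height is \<open>k > 0\<close>, the algebra is perfect, hence unimodular. If \<open>(d\<xi>)\<^sup>k\<^sup>+\<^sup>1 \<noteq> 0\<close> for some
  \<open>\<xi>\<close>, then \<open>\<xi> = \<iota>\<^sub>v d\<xi>\<close> for some \<open>v\<close>, and varying \<open>\<xi>\<close> in \<open>\<xi> \<and> (d\<xi>)\<^sup>k\<^sup>+\<^sup>1 = 0\<close> shows that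
  \<open>y \<mapsto> [y, v]\<close> is the identity on \<open>\<g>\<^sub>\<xi>\<close>; being conformally symplectic on the quotient by \<open>\<g>\<^sub>\<xi>\<close>, this
  map has positive trace, a contradiction. So \<open>(d\<xi>)\<^sup>k\<^sup>+\<^sup>1 = 0\<close> for all \<open>\<xi>\<close>, and it follows that for
  \<open>\<xi> \<noteq> 0\<close> the algebra \<open>\<g>\<^sub>\<xi>\<close> is abelian and not contained in the kernel of \<open>\<xi>\<close>.

  Algebras with this last property are called stably contact below. In them, no \<open>ad x\<close> has a nonzero
  real eigenvalue, the whole algebra is the direct sum of the kernel and the image of \<open>ad x\<close>, and
  the property passes to centralisers. By induction on the dimension, centralisers of noncentral
  elements are abelian; comparing eigenvalues on the complexification, they are spanned by the
  element and the centre. An eigenvector \<open>y + i w\<close> of \<open>ad x\<close> for an eigenvalue of largest modulus then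
  generates a copy of \<open>so(3)\<close>, and bracket relations between weight vectors exclude further ones.
\<close>
section \<open>Wedge products through contraction\<close>

text \<open>Knowing the height of \<xi> leaves the rank of d\<xi> undecided: it may be 2k or 2k + 2,
  and in the second case \<xi> itself is a contraction of d\<xi>. The trace excludes this, because
  the radical contributes its full dimension and the quotient half of its dimension, with the same
  sign. Information about the radical comes from the lines \<xi> + t \<eta>: contracted with an
  element of the radical of d\<xi>, the height identity becomes divisible by t, and the limit t -> 0
  of the quotient serves as a derivative at \<xi>. The stably contact property does not mention k,
  so it can be handed down to centralisers without tracking how the height changes. A weight vector
  and its conjugate span, with x and modulo the centre, a three-dimensional algebra; the absence of
  real eigenvalues fixes a sign in it, which gives so(3) and not sl(2, R). Further weights are
  excluded by strings for the largest weight B. A weight B/2 is compatible with these strings, as in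
  a root system of type BC1; a second argument, with a weight vector for B/2 in the leading role,
  rules it out.\<close>

text \<open>Since \<open>\<lambda>Z. f (y # Z)\<close> is the contraction of \<open>f\<close> with \<open>y\<close>, the recursions below say that
  contraction is an antiderivation; no degrees and no alternation are needed.\<close>

primrec wedge1 :: "('a \<Rightarrow> real) \<Rightarrow> 'a form \<Rightarrow> 'a form" where
  "wedge1 \<alpha> f [] = 0"
| "wedge1 \<alpha> f (y # X) = \<alpha> y * f X - wedge1 \<alpha> (\<lambda>Z. f (y # Z)) X"

primrec wedge2 :: "('a \<Rightarrow> 'a \<Rightarrow> real) \<Rightarrow> 'a form \<Rightarrow> 'a form" where
  "wedge2 \<omega> f [] = 0"
| "wedge2 \<omega> f (y # X) = wedge1 (\<omega> y) f X + wedge2 \<omega> (\<lambda>Z. f (y # Z)) X"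

primrec pow2 :: "('a \<Rightarrow> 'a \<Rightarrow> real) \<Rightarrow> nat \<Rightarrow> 'a form" where
  "pow2 \<omega> 0 = (\<lambda>X. if X = [] then 1 else 0)"
| "pow2 \<omega> (Suc m) = wedge2 \<omega> (pow2 \<omega> m)"

lemma wedge1_add: "wedge1 \<alpha> (\<lambda>Z. f Z + g Z) X = wedge1 \<alpha> f X + wedge1 \<alpha> g X"
  by (induction X arbitrary: f g) (auto simp: algebra_simps)

lemma wedge1_scale: "wedge1 \<alpha> (\<lambda>Z. c * f Z) X = c * wedge1 \<alpha> f X"
  by (induction X arbitrary: f) (auto simp: algebra_simps)

lemma wedge1_minus: "wedge1 \<alpha> (\<lambda>Z. - f Z) X = - wedge1 \<alpha> f X"
  using wedge1_scale[of \<alpha> "-1" f X] by simp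

lemma wedge1_diff: "wedge1 \<alpha> (\<lambda>Z. f Z - g Z) X = wedge1 \<alpha> f X - wedge1 \<alpha> g X"
  using wedge1_add[of \<alpha> f "\<lambda>Z. - g Z" X] by (simp add: wedge1_minus)

lemma wedge1_scale_left: "wedge1 (\<lambda>x. c * \<alpha> x) f X = c * wedge1 \<alpha> f X"
  by (induction X arbitrary: f) (auto simp: algebra_simps)

lemma wedge1_cong:
  assumes "\<And>y. y \<in> V \<Longrightarrow> \<alpha> y = \<beta> y"
    and "\<And>Z. \<lbrakk>set Z \<subseteq> V; Suc (length Z) = length X\<rbrakk> \<Longrightarrow> f Z = g Z" "set X \<subseteq> V"
  shows "wedge1 \<alpha> f X = wedge1 \<beta> g X"
  using assms(2,3)
proof (induction X arbitrary: f g)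
  case (Cons y X)
  have "wedge1 \<alpha> (\<lambda>Z. f (y # Z)) X = wedge1 \<beta> (\<lambda>Z. g (y # Z)) X"
    using Cons.prems by (intro Cons.IH) auto
  then show ?case
    using Cons.prems assms(1) by simp
qed simp

lemma wedge1_zero: "wedge1 \<alpha> (\<lambda>_. 0) X = 0"
  using wedge1_scale[of \<alpha> 0] by simp

lemma wedge1_zero_left: "wedge1 (\<lambda>_. 0) f X = 0"
  using wedge1_scale_left[of 0] by simp

lemma wedge1_wedge1: "wedge1 \<alpha> (wedge1 \<beta> f) X = - wedge1 \<beta> (wedge1 \<alpha> f) X"
  by (induction X arbitrary: f) (auto simp: wedge1_diff wedge1_scale)

lemma wedge1_self: "wedge1 \<alpha> (wedge1 \<alpha> f) X = 0"
  using wedge1_wedge1[of \<alpha> \<alpha> f X] by simp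

lemma wedge2_add: "wedge2 \<omega> (\<lambda>Z. f Z + g Z) X = wedge2 \<omega> f X + wedge2 \<omega> g X"
  by (induction X arbitrary: f g) (auto simp: wedge1_add)

lemma wedge2_scale: "wedge2 \<omega> (\<lambda>Z. c * f Z) X = c * wedge2 \<omega> f X"
  by (induction X arbitrary: f) (auto simp: wedge1_scale algebra_simps)

lemma wedge2_minus: "wedge2 \<omega> (\<lambda>Z. - f Z) X = - wedge2 \<omega> f X"
  using wedge2_scale[of \<omega> "-1" f X] by simp

lemma wedge2_diff: "wedge2 \<omega> (\<lambda>Z. f Z - g Z) X = wedge2 \<omega> f X - wedge2 \<omega> g X"
  using wedge2_add[of \<omega> f "\<lambda>Z. - g Z" X] by (simp add: wedge2_minus)

lemma wedge2_zero: "wedge2 \<omega> (\<lambda>_. 0) X = 0"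
  using wedge2_scale[of \<omega> 0] by simp

lemma wedge2_cong:
  assumes "\<And>x y. x \<in> V \<Longrightarrow> y \<in> V \<Longrightarrow> \<omega> x y = \<omega>' x y"
    and "\<And>Z. \<lbrakk>set Z \<subseteq> V; Suc (Suc (length Z)) = length X\<rbrakk> \<Longrightarrow> f Z = g Z" "set X \<subseteq> V"
  shows "wedge2 \<omega> f X = wedge2 \<omega>' g X"
  using assms(2,3)
proof (induction X arbitrary: f g)
  case (Cons y X)
  have "wedge1 (\<omega> y) f X = wedge1 (\<omega>' y) g X"
    using Cons.prems assms(1) by (intro wedge1_cong[of V]) auto
  moreover have "wedge2 \<omega> (\<lambda>Z. f (y # Z)) X = wedge2 \<omega>' (\<lambda>Z. g (y # Z)) X"
    using Cons.prems by (intro Cons.IH) auto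
  ultimately show ?case by simp
qed simp

lemma pow2_cong:
  assumes "\<And>x y. x \<in> V \<Longrightarrow> y \<in> V \<Longrightarrow> \<omega> x y = \<omega>' x y" "set X \<subseteq> V"
  shows "pow2 \<omega> m X = pow2 \<omega>' m X"
  using assms(2)
proof (induction m arbitrary: X)
  case (Suc m)
  then show ?case
    using assms(1) by (auto intro!: wedge2_cong[of V])
qed simp

text \<open>Contracting both sides with \<open>y\<close> leaves the anticommutation of \<alpha> with
  the one-form \<open>\<omega> y\<close>, and the same claim for the contracted
  \<open>f\<close>.\<close>

lemma wedge1_wedge2: "wedge1 \<alpha> (wedge2 \<omega> f) X = wedge2 \<omega> (wedge1 \<alpha> f) X"
proof (induction X arbitrary: f)
  case (Cons y X)
  show ?case
    using wedge1_wedge1[of \<alpha> "\<omega> y" f X]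
    by (simp add: wedge1_add wedge2_diff wedge2_scale Cons)
qed simp

text \<open>Contraction is a derivation on forms of even degree, so it obeys the power rule. In the
  induction step the factor \<open>\<omega> y\<close> is moved across \<omega> by
  \<open>wedge1_wedge2\<close>.\<close>

lemma pow2_Suc_Cons: "pow2 \<omega> (Suc m) (y # X) = real (Suc m) * wedge1 (\<omega> y) (pow2 \<omega> m) X"
proof (induction m arbitrary: y X)
  case 0
  then show ?case by (simp add: wedge2_zero)
next
  case (Suc m)
  have "(\<lambda>Z. pow2 \<omega> (Suc m) (y # Z)) = (\<lambda>Z. real (Suc m) * wedge1 (\<omega> y) (pow2 \<omega> m) Z)"
    using Suc by blast
  then have "pow2 \<omega> (Suc (Suc m)) (y # X) =
      wedge1 (\<omega> y) (pow2 \<omega> (Suc m)) X + wedge2 \<omega> (\<lambda>Z. real (Suc m) * wedge1 (\<omega> y) (pow2 \<omega> m) Z) X"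
    by simp
  also have "wedge2 \<omega> (\<lambda>Z. real (Suc m) * wedge1 (\<omega> y) (pow2 \<omega> m) Z) X
      = real (Suc m) * wedge1 (\<omega> y) (pow2 \<omega> (Suc m)) X"
    by (simp only: wedge2_scale wedge1_wedge2 pow2.simps)
  finally show ?case by (simp add: algebra_simps)
qed

lemma wedge1_length:
  assumes "\<And>Z. length Z \<noteq> q \<Longrightarrow> f Z = 0" "length X \<noteq> Suc q"
  shows "wedge1 \<alpha> f X = 0"
  using assms
proof (induction X arbitrary: f q)
  case (Cons y X)
  then have "f X = 0" by simp
  moreover have "wedge1 \<alpha> (\<lambda>Z. f (y # Z)) X = 0"
  proof (cases q)
    case 0
    then have "(\<lambda>Z. f (y # Z)) = (\<lambda>_. 0)" using Cons.prems by auto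
    then show ?thesis by (simp add: wedge1_zero)
  next
    case (Suc q')
    then show ?thesis using Cons.prems by (intro Cons.IH[of q']) auto
  qed
  ultimately show ?case by simp
qed simp

lemma pow2_length: "length X \<noteq> 2 * m \<Longrightarrow> pow2 \<omega> m X = 0"
proof (induction m arbitrary: X)
  case (Suc m)
  show ?case
  proof (cases X)
    case (Cons y Y)
    have "wedge1 (\<omega> y) (pow2 \<omega> m) Y = 0"
      using Suc Cons by (intro wedge1_length[of "2 * m"]) auto
    then show ?thesis
      by (simp only: Cons pow2_Suc_Cons)
  qed simp
qed auto

section \<open>Antisymmetrisation over permutations and its Laplace expansion\<close>

definition alt_sum :: "nat \<Rightarrow> 'a form \<Rightarrow> 'a form" where
  "alt_sum n F X = (\<Sum>\<sigma> | \<sigma> permutes {..<n}. of_int (sign \<sigma>) * F (map (\<lambda>i. X ! \<sigma> i) [0..<n]))"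

definition alternating_on :: "'a set \<Rightarrow> nat \<Rightarrow> 'a form \<Rightarrow> bool" where
  "alternating_on V n f \<longleftrightarrow> (\<forall>X \<tau>. length X = n \<longrightarrow> set X \<subseteq> V \<longrightarrow> \<tau> permutes {..<n} \<longrightarrow>
     f (map (\<lambda>i. X ! \<tau> i) [0..<n]) = of_int (sign \<tau>) * f X)"

lemma alternating_alt_sum: "alternating_on V n (alt_sum n F)"
  unfolding alternating_on_def
proof (intro allI impI)
  fix X :: "'a list" and \<tau> assume \<tau>: "\<tau> permutes {..<n}"
  have perm: "permutation \<sigma>" if "\<sigma> permutes {..<n}" for \<sigma> :: "nat \<Rightarrow> nat"
    using that permutation_permutes by blast
  have "alt_sum n F X = (\<Sum>\<sigma> | \<sigma> permutes {..<n}. of_int (sign (\<tau> \<circ> \<sigma>)) * F (map (\<lambda>i. X ! (\<tau> \<circ> \<sigma>) i) [0..<n]))"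
    unfolding alt_sum_def by (rule setum_permutations_compose_left[OF \<tau>])
  also have "\<dots> = of_int (sign \<tau>) * alt_sum n F (map (\<lambda>i. X ! \<tau> i) [0..<n])"
    unfolding alt_sum_def sum_distrib_left
  proof (rule sum.cong)
    fix \<sigma> assume "\<sigma> \<in> {\<sigma>. \<sigma> permutes {..<n}}"
    then have \<sigma>: "\<sigma> permutes {..<n}" by simp
    have eq: "map (\<lambda>i. X ! (\<tau> \<circ> \<sigma>) i) [0..<n] = map (\<lambda>i. map (\<lambda>i. X ! \<tau> i) [0..<n] ! \<sigma> i) [0..<n]"
      using permutes_in_image[OF \<sigma>] by auto
    show "of_int (sign (\<tau> \<circ> \<sigma>)) * F (map (\<lambda>i. X ! (\<tau> \<circ> \<sigma>) i) [0..<n]) =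
      of_int (sign \<tau>) * (of_int (sign \<sigma>) * F (map (\<lambda>i. map (\<lambda>i. X ! \<tau> i) [0..<n] ! \<sigma> i) [0..<n]))"
      unfolding eq sign_compose[OF perm[OF \<tau>] perm[OF \<sigma>]] by simp
  qed simp
  finally show "alt_sum n F (map (\<lambda>i. X ! \<tau> i) [0..<n]) = of_int (sign \<tau>) * alt_sum n F X"
    by (metis (no_types, lifting) mult.assoc mult_1 of_int_1 of_int_mult sign_idempotent)
qed

lemma alternating_swap:
  assumes "alternating_on V n f" "length (us @ a # b # vs) = n" "set (us @ a # b # vs) \<subseteq> V"
  shows "f (us @ b # a # vs) = - f (us @ a # b # vs)"
proof -
  let ?X = "us @ a # b # vs" and ?i = "length us"
  let ?\<tau> = "Transposition.transpose ?i (Suc ?i)"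
  have \<tau>: "?\<tau> permutes {..<n}"
    using assms(2) by (intro permutes_swap_id) auto
  have "map (\<lambda>i. ?X ! ?\<tau> i) [0..<n] = us @ b # a # vs"
    using assms(2)
    by (intro nth_equalityI) (auto simp: Transposition.transpose_def nth_append nth_Cons' less_Suc_eq)
  moreover have "f (map (\<lambda>i. ?X ! ?\<tau> i) [0..<n]) = of_int (sign ?\<tau>) * f ?X"
    using assms \<tau> unfolding alternating_on_def by blast
  ultimately show ?thesis
    by (simp add: sign_swap_id)
qed

lemma alternating_move_front:
  assumes "alternating_on V n f" "length (us @ a # vs) = n" "set (us @ a # vs) \<subseteq> V"
  shows "f (us @ a # vs) = (-1) ^ length us * f (a # us @ vs)"
  using assms(2,3)
proof (induction us arbitrary: vs rule: rev_induct)
  case (snoc u us)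
  have "f ((us @ [u]) @ a # vs) = - f (us @ a # u # vs)"
    using alternating_swap[OF assms(1), of us a u vs] snoc.prems by simp
  also have "f (us @ a # u # vs) = (-1) ^ length us * f (a # us @ u # vs)"
    using snoc.prems by (intro snoc.IH) auto
  finally show ?case by simp
qed simp

text \<open>Signed expansion in which each entry in turn is moved to the front. The recursion has
  the shape of \<open>wedge1\<close>, so that the two can be compared by induction.\<close>

primrec lap :: "('a \<Rightarrow> 'a form) \<Rightarrow> 'a form" where
  "lap h [] = 0"
| "lap h (y # X) = h y X - lap (\<lambda>x Z. h x (y # Z)) X"

lemma lap_sum:
  "lap h X = (\<Sum>j<length X. (-1) ^ j * h (X ! j) (take j X @ drop (Suc j) X))"
proof (induction X arbitrary: h)
  case (Cons y X)
  show ?case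
    by (simp add: Cons sum.lessThan_Suc_shift sum_negf del: sum.lessThan_Suc)
qed simp

lemma lap_cong:
  assumes "\<And>x Z. \<lbrakk>x \<in> V; set Z \<subseteq> V; Suc (length Z) = length X\<rbrakk> \<Longrightarrow> h x Z = h' x Z" "set X \<subseteq> V"
  shows "lap h X = lap h' X"
  unfolding lap_sum
proof (rule sum.cong)
  fix j assume "j \<in> {..<length X}"
  then have "set (take j X @ drop (Suc j) X) \<subseteq> V" "X ! j \<in> V"
    using assms(2) by (auto dest: in_set_takeD in_set_dropD)
  then show "(- 1) ^ j * h (X ! j) (take j X @ drop (Suc j) X) =
         (- 1) ^ j * h' (X ! j) (take j X @ drop (Suc j) X)"
    using assms(1) \<open>j \<in> _\<close> by simp
qed simp

lemma wedge1_eq_lap: "wedge1 \<alpha> f X = lap (\<lambda>x Z. \<alpha> x * f Z) X"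
  by (induction X arbitrary: f) auto

lemma lap_add: "lap (\<lambda>x Z. h x Z + h' x Z) X = lap h X + lap h' X"
  by (simp add: lap_sum algebra_simps sum.distrib)

lemma lap_scale: "lap (\<lambda>x Z. c * h x Z) X = c * lap h X"
  by (simp add: lap_sum algebra_simps sum_distrib_left)

text \<open>Every pair of entries is pulled out twice, once in each order, and antisymmetry of
  \<omega> makes the two contributions equal. The factor 2 will cancel the 2! in the normalisation
  of \<open>wedge\<close>.\<close>

lemma lap_wedge1:
  assumes "set X \<subseteq> V" "\<And>x y. x \<in> V \<Longrightarrow> y \<in> V \<Longrightarrow> \<omega> y x = - \<omega> x y"
  shows "lap (\<lambda>x. wedge1 (\<omega> x) f) X = 2 * wedge2 \<omega> f X"
  using assms(1)
proof (induction X arbitrary: f)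
  case (Cons y X)
  have "lap (\<lambda>x Z. wedge1 (\<omega> x) f (y # Z)) X =
      lap (\<lambda>x Z. \<omega> x y * f Z + - 1 * wedge1 (\<omega> x) (\<lambda>Z. f (y # Z)) Z) X"
    by simp
  also have "\<dots> = lap (\<lambda>x Z. \<omega> x y * f Z) X - lap (\<lambda>x. wedge1 (\<omega> x) (\<lambda>Z. f (y # Z))) X"
    unfolding lap_add lap_scale by simp
  also have "lap (\<lambda>x Z. \<omega> x y * f Z) X = lap (\<lambda>x Z. - 1 * (\<omega> y x * f Z)) X"
    by (rule lap_cong[of V]) (use Cons.prems assms(2)[of y] in auto)
  also have "\<dots> = - wedge1 (\<omega> y) f X"
    unfolding lap_scale wedge1_eq_lap by simp
  finally show ?case
    using Cons by simp
qed simp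

text \<open>A permutation of n + 1 indices is a permutation fixing 0 followed by the transposition
  of 0 with its value b at 0. Grouping by b gives the expansion along the first argument.\<close>

lemma alt_sum_Suc:
  assumes "length X = Suc n"
  shows "alt_sum (Suc n) F X = lap (\<lambda>x. alt_sum n (\<lambda>Z. F (x # Z))) X"
proof -
  let ?S = "{1..<Suc n}" and ?t = "Transposition.transpose (0::nat)"
  let ?A = "\<lambda>x. alt_sum n (\<lambda>Z. F (x # Z))"
  obtain x0 X' where X: "X = x0 # X'" "length X' = n"
    using assms by (cases X) auto
  have bij: "bij_betw Suc {..<n} ?S"
    by (auto simp: bij_betw_def image_Suc_lessThan)
  have perm: "permutation \<sigma>" if "\<sigma> permutes ?S" for \<sigma> :: "nat \<Rightarrow> nat"
    using that permutation_permutes by blast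
  have inner: "(\<Sum>q | q permutes ?S. of_int (sign (?t b \<circ> q)) * F (map (\<lambda>i. X ! (?t b \<circ> q) i) [0..<Suc n]))
      = (-1) ^ b * ?A (X ! b) (take b X @ drop (Suc b) X)" if b: "b < Suc n" for b
  proof -
    \<comment> \<open>In \<open>Y\<close> the entry 0 of \<open>X\<close> stands in the place
      vacated by the entry b. Moving it back to the front costs b - 1 sign changes, and the sign of
      the transposition supplies the last one.\<close>
    define Y where "Y = map (\<lambda>i. X ! ?t b (Suc i)) [0..<n]"
    define s :: int where "s = sign (?t b)"
    have "(\<Sum>q | q permutes ?S. of_int (sign (?t b \<circ> q)) * F (map (\<lambda>i. X ! (?t b \<circ> q) i) [0..<Suc n]))
      = (\<Sum>\<tau> | \<tau> permutes {..<n}. of_int s * (of_int (sign \<tau>) * F (X ! b # map (\<lambda>i. Y ! \<tau> i) [0..<n])))"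
    proof (rule sum.reindex_bij_witness[where i = "map_permutation {..<n} Suc" and j = "map_permutation ?S (\<lambda>i. i - 1)"])
      fix \<tau> assume "\<tau> \<in> {\<tau>. \<tau> permutes {..<n}}"
      then have \<tau>: "\<tau> permutes {..<n}" by simp
      show "map_permutation ?S (\<lambda>i. i - 1) (map_permutation {..<n} Suc \<tau>) = \<tau>"
        by (rule map_permutation_compose_inv[OF bij \<tau>]) simp
      show "map_permutation {..<n} Suc \<tau> \<in> {q. q permutes ?S}"
        using map_permutation_permutes[OF bij \<tau>] by simp
    next
      fix q assume "q \<in> {q. q permutes ?S}"
      then have q: "q permutes ?S" by simp
      have bij': "bij_betw (\<lambda>i. i - 1) ?S {..<n}"
        by (rule bij_betwI[of _ _ _ Suc]) auto
      let ?\<tau> = "map_permutation ?S (\<lambda>i. i - 1) q"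
      show \<tau>: "?\<tau> \<in> {q. q permutes {..<n}}"
        using map_permutation_permutes[OF bij' q] by simp
      show "map_permutation {..<n} Suc ?\<tau> = q"
        by (rule map_permutation_compose_inv[OF bij' q]) auto
      have s: "sign ?\<tau> = sign q"
        using bij' q by (intro sign_map_permutation) (auto simp: bij_betw_def)
      have ap: "?\<tau> i = q (Suc i) - 1" if "i < n" for i
        using map_permutation_apply[of "\<lambda>i. i - 1" ?S "Suc i" q] bij' that by (auto simp: bij_betw_def)
      have q0: "q 0 = 0"
        using q by (simp add: permutes_def)
      have qS: "q (Suc i) \<in> ?S" if "i < n" for i
        using permutes_in_image[OF q] that by simp
      have "map (\<lambda>i. X ! (?t b \<circ> q) i) [0..<Suc n] = X ! b # map (\<lambda>i. Y ! ?\<tau> i) [0..<n]"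
      proof (rule nth_equalityI)
        fix i assume "i < length (map (\<lambda>i. X ! (?t b \<circ> q) i) [0..<Suc n])"
        then have i: "i < Suc n" by simp
        show "map (\<lambda>i. X ! (?t b \<circ> q) i) [0..<Suc n] ! i = (X ! b # map (\<lambda>i. Y ! ?\<tau> i) [0..<n]) ! i"
        proof (cases i)
          case 0
          then show ?thesis using q0 by (simp del: upt_Suc)
        next
          case (Suc m)
          then have m: "m < n" using i by simp
          then have "?\<tau> m < n" "Suc (?\<tau> m) = q (Suc m)"
            using qS[OF m] ap[OF m] by auto
          then show ?thesis
            using Suc m unfolding Y_def by (simp del: upt_Suc)
        qed
      qed simp
      then show "of_int s * (of_int (sign ?\<tau>) * F (X ! b # map (\<lambda>i. Y ! ?\<tau> i) [0..<n])) =
         of_int (sign (?t b \<circ> q)) * F (map (\<lambda>i. X ! (?t b \<circ> q) i) [0..<Suc n])"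
        unfolding s s_def using perm[OF q] by (simp add: sign_compose permutation_swap_id)
    qed
    also have "\<dots> = of_int s * ?A (X ! b) Y"
      by (simp add: alt_sum_def sum_distrib_left)
    also have "\<dots> = (-1) ^ b * ?A (X ! b) (take b X @ drop (Suc b) X)"
    proof (cases b)
      case 0
      then have "Y = X'"
        unfolding Y_def X using X(2) by (intro nth_equalityI) auto
      then show ?thesis using 0 X by (simp add: s_def)
    next
      case (Suc c)
      have lc: "c < n" using Suc b by simp
      have "Y = take c X' @ x0 # drop (Suc c) X'"
        unfolding Y_def X using X(2) Suc lc
        by (intro nth_equalityI) (auto simp: Transposition.transpose_def nth_append nth_Cons' less_Suc_eq)
      then have "?A (X ! b) Y = (-1) ^ c * ?A (X ! b) (x0 # take c X' @ drop (Suc c) X')"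
        using alternating_move_front[OF alternating_alt_sum[of UNIV], of "take c X'" x0 "drop (Suc c) X'" n] X(2) lc
        by simp
      then show ?thesis
        using Suc by (simp add: s_def X sign_swap_id)
    qed
    finally show ?thesis .
  qed
  have ins: "{..<Suc n} = insert 0 ?S" by auto
  have "alt_sum (Suc n) F X = (\<Sum>b\<in>{..<Suc n}. \<Sum>q | q permutes ?S.
      of_int (sign (?t b \<circ> q)) * F (map (\<lambda>i. X ! (?t b \<circ> q) i) [0..<Suc n]))"
    unfolding alt_sum_def ins by (subst sum_over_permutations_insert) simp_all
  also have "\<dots> = (\<Sum>b<Suc n. (-1) ^ b * ?A (X ! b) (take b X @ drop (Suc b) X))"
    using inner by (intro sum.cong) auto
  finally show ?thesis
    unfolding lap_sum assms .
qed

lemma alt_sum_alternating: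
  assumes "alternating_on V n f" "length X = n" "set X \<subseteq> V"
  shows "alt_sum n f X = fact n * f X"
proof -
  have "alt_sum n f X = (\<Sum>\<sigma> | \<sigma> permutes {..<n}. f X)"
    unfolding alt_sum_def
  proof (rule sum.cong)
    fix \<sigma> assume "\<sigma> \<in> {\<sigma>. \<sigma> permutes {..<n}}"
    then have "of_int (sign \<sigma>) * f (map (\<lambda>i. X ! \<sigma> i) [0..<n]) = of_int (sign \<sigma> * sign \<sigma>) * f X"
      using assms unfolding alternating_on_def by (simp del: sign_idempotent)
    then show "of_int (sign \<sigma>) * f (map (\<lambda>i. X ! \<sigma> i) [0..<n]) = f X" by simp
  qed simp
  then show ?thesis by (simp add: card_permutations)
qed

lemma wedge_eq_alt_sum:
  "wedge p q \<alpha> \<beta> X = alt_sum (p + q) (\<lambda>Z. \<alpha> (take p Z) * \<beta> (drop p Z)) X / (fact p * fact q)"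
proof -
  have "drop p [0..<p + q] = [p..<p + q]"
    by simp
  then show ?thesis
    by (simp add: wedge_def alt_sum_def take_map drop_map mult.assoc take_upt)
qed

lemma alternating_wedge: "alternating_on V (p + q) (wedge p q \<alpha> \<beta>)"
  using alternating_alt_sum[of V "p + q" "\<lambda>Z. \<alpha> (take p Z) * \<beta> (drop p Z)"]
  unfolding alternating_on_def wedge_eq_alt_sum by simp

lemma alt_sum_scale: "alt_sum n (\<lambda>Z. c * F Z) X = c * alt_sum n F X"
  by (simp add: alt_sum_def sum_distrib_left algebra_simps)

lemma alt_sum_wedge1:
  assumes "alternating_on V q f" "length X = Suc q" "set X \<subseteq> V"
  shows "alt_sum (Suc q) (\<lambda>Z. \<xi> (Z ! 0) * f (drop 1 Z)) X = fact q * wedge1 \<xi> f X"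
proof -
  have "alt_sum q (\<lambda>Z. \<xi> x * f Z) = (\<lambda>Z. \<xi> x * alt_sum q f Z)" for x
    by (simp add: fun_eq_iff alt_sum_scale)
  then have "alt_sum (Suc q) (\<lambda>Z. \<xi> (Z ! 0) * f (drop 1 Z)) X = lap (\<lambda>x Z. \<xi> x * alt_sum q f Z) X"
    by (simp add: alt_sum_Suc[OF assms(2)])
  also have "\<dots> = lap (\<lambda>x Z. fact q * (\<xi> x * f Z)) X"
    using assms by (intro lap_cong[of V]) (auto simp: alt_sum_alternating)
  finally show ?thesis by (simp only: lap_scale wedge1_eq_lap)
qed

lemma wedge_one_form:
  assumes "alternating_on V q f" "length X = Suc q" "set X \<subseteq> V"
  shows "wedge 1 q (one_form \<xi>) f X = wedge1 \<xi> f X"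
proof -
  have "alt_sum (1 + q) (\<lambda>Z. one_form \<xi> (take 1 Z) * f (drop 1 Z)) X =
      alt_sum (Suc q) (\<lambda>Z. \<xi> (Z ! 0) * f (drop 1 Z)) X"
    unfolding alt_sum_def one_form_def
    by (intro sum.cong) (simp_all del: upt_Suc)
  then show ?thesis
    unfolding wedge_eq_alt_sum using alt_sum_wedge1[OF assms] by simp
qed

lemma wedge_two_form:
  assumes "alternating_on V q f" "length X = Suc (Suc q)" "set X \<subseteq> V"
    and anti: "\<And>x y. x \<in> V \<Longrightarrow> y \<in> V \<Longrightarrow> \<omega> [y, x] = - \<omega> [x, y]"
  shows "wedge 2 q \<omega> f X = wedge2 (\<lambda>x y. \<omega> [x, y]) f X"
proof -
  have "alt_sum (2 + q) (\<lambda>Z. \<omega> (take 2 Z) * f (drop 2 Z)) X =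
      lap (\<lambda>x. alt_sum (Suc q) (\<lambda>Z. \<omega> (take 2 (x # Z)) * f (drop 2 (x # Z)))) X"
    using alt_sum_Suc[of X "Suc q"] assms(2) by simp
  also have "\<dots> = lap (\<lambda>x. alt_sum (Suc q) (\<lambda>Z. (\<lambda>y. \<omega> [x, y]) (Z ! 0) * f (drop 1 Z))) X"
  proof -
    have "alt_sum (Suc q) (\<lambda>Z. \<omega> (take 2 (x # Z)) * f (drop 2 (x # Z))) Y =
        alt_sum (Suc q) (\<lambda>Z. (\<lambda>y. \<omega> [x, y]) (Z ! 0) * f (drop 1 Z)) Y" for x Y
      unfolding alt_sum_def
      by (intro sum.cong) (simp_all add: numeral_2_eq_2 take_Suc_conv_app_nth del: upt_Suc)
    then show ?thesis by presburger
  qed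
  also have "\<dots> = lap (\<lambda>x Z. fact q * wedge1 (\<lambda>y. \<omega> [x, y]) f Z) X"
    using assms(2,3) by (intro lap_cong[of V] alt_sum_wedge1[OF assms(1)]) auto
  also have "\<dots> = fact q * (2 * wedge2 (\<lambda>x y. \<omega> [x, y]) f X)"
    by (simp add: lap_scale lap_wedge1[OF assms(3) anti])
  finally show ?thesis
    unfolding wedge_eq_alt_sum by (simp add: fact_2)
qed

lemma alternating_wedge_power: "alternating_on V (k * p) (wedge_power p \<omega> k)"
proof (cases k)
  case 0
  then show ?thesis by (simp add: alternating_on_def)
next
  case (Suc m)
  then show ?thesis using alternating_wedge[of V p "m * p"] by simp
qed

lemma wedge_power_two:
  assumes "length X = 2 * m" "set X \<subseteq> V"
    and anti: "\<And>x y. x \<in> V \<Longrightarrow> y \<in> V \<Longrightarrow> \<omega> [y, x] = - \<omega> [x, y]"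
  shows "wedge_power 2 \<omega> m X = pow2 (\<lambda>x y. \<omega> [x, y]) m X"
  using assms(1,2)
proof (induction m arbitrary: X)
  case (Suc m)
  have "wedge_power 2 \<omega> (Suc m) X = wedge2 (\<lambda>x y. \<omega> [x, y]) (wedge_power 2 \<omega> m) X"
    using wedge_two_form[of V "m * 2" "wedge_power 2 \<omega> m" X \<omega>, OF alternating_wedge_power _ Suc.prems(2) anti] Suc.prems(1)
    by (simp add: mult.commute)
  also have "\<dots> = wedge2 (\<lambda>x y. \<omega> [x, y]) (pow2 (\<lambda>x y. \<omega> [x, y]) m) X"
    by (rule wedge2_cong[of V]) (use Suc in auto)
  finally show ?case by simp
qed simp

text \<open>The recursive forms vanish off their degree, so the quantifiers may run over lists of
  any length. Only the values of \<omega> on the carrier are prescribed, which admits a bracket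
  extended to the whole type.\<close>

lemma has_height_iff:
  fixes \<gg> :: "'a::real_vector lie_alg"
  assumes "\<And>x y. \<lbrakk>x \<in> carrier \<gg>; y \<in> carrier \<gg>\<rbrakk> \<Longrightarrow> \<xi> (bracket \<gg> y x) = - \<xi> (bracket \<gg> x y)"
    and \<omega>: "\<And>x y. \<lbrakk>x \<in> carrier \<gg>; y \<in> carrier \<gg>\<rbrakk> \<Longrightarrow> \<omega> x y = - \<xi> (bracket \<gg> x y)"
  shows "has_height \<gg> \<xi> k \<longleftrightarrow>
    (\<exists>X. set X \<subseteq> carrier \<gg> \<and> wedge1 \<xi> (pow2 \<omega> k) X \<noteq> 0) \<and>
    (\<forall>X. set X \<subseteq> carrier \<gg> \<longrightarrow> wedge1 \<xi> (pow2 \<omega> (Suc k)) X = 0)"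
proof -
  let ?V = "carrier \<gg>" and ?d = "ce_diff \<gg> (one_form \<xi>)"
  have anti: "?d [y, x] = - ?d [x, y]" if "x \<in> ?V" "y \<in> ?V" for x y
    unfolding ce_diff_one_form using assms(1)[OF that] by simp
  have *: "wedge 1 (2 * m) (one_form \<xi>) (wedge_power 2 ?d m) X = wedge1 \<xi> (pow2 \<omega> m) X"
    if X: "length X = 2 * m + 1" "set X \<subseteq> ?V" for m X
  proof -
    have "wedge 1 (2 * m) (one_form \<xi>) (wedge_power 2 ?d m) X = wedge1 \<xi> (wedge_power 2 ?d m) X"
      using X alternating_wedge_power[of ?V m 2] by (intro wedge_one_form[of ?V]) (auto simp: mult.commute)
    also have "\<dots> = wedge1 \<xi> (pow2 (\<lambda>x y. ?d [x, y]) m) X"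
    proof (rule wedge1_cong[of ?V])
      fix Z assume "set Z \<subseteq> ?V" "Suc (length Z) = length X"
      then show "wedge_power 2 ?d m Z = pow2 (\<lambda>x y. ?d [x, y]) m Z"
        using X(1) by (intro wedge_power_two[of Z m ?V ?d, OF _ _ anti]) simp_all
    qed (use X in auto)
    also have "\<dots> = wedge1 \<xi> (pow2 \<omega> m) X"
      using X by (intro wedge1_cong[of ?V] pow2_cong[of ?V]) (auto simp: ce_diff_one_form \<omega>)
    finally show ?thesis .
  qed
  have len: "wedge1 \<xi> (pow2 \<omega> m) X = 0" if "length X \<noteq> 2 * m + 1" for m X
    using that pow2_length by (intro wedge1_length[of "2 * m"]) auto
  have "form_zero_on \<gg> (2 * m + 1) (wedge 1 (2 * m) (one_form \<xi>) (wedge_power 2 ?d m)) \<longleftrightarrow>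
      (\<forall>X. set X \<subseteq> ?V \<longrightarrow> wedge1 \<xi> (pow2 \<omega> m) X = 0)" for m
    unfolding form_zero_on_def using * len by metis
  from this[of k] this[of "k + 1"] show ?thesis
    unfolding has_height_def Let_def by simp
qed

section \<open>Subalgebras and stabilisers of linear functionals\<close>

text \<open>Containment in a finite span, rather than equality with one, makes the notion pass to
  arbitrary subsets at once.\<close>

definition fin_dim :: "'a::real_vector set \<Rightarrow> bool" where
  "fin_dim V \<longleftrightarrow> (\<exists>B. finite B \<and> V \<subseteq> span B)"

lemma fin_dim_subset: "fin_dim V \<Longrightarrow> W \<subseteq> V \<Longrightarrow> fin_dim W"
  unfolding fin_dim_def by blast

lemma fin_dim_basis:
  assumes "fin_dim V" "subspace V" "independent C" "C \<subseteq> V"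
  obtains B where "C \<subseteq> B" "finite B" "independent B" "span B = V" "card B = dim V"
proof -
  obtain B where B: "C \<subseteq> B" "B \<subseteq> V" "independent B" "V \<subseteq> span B"
    using maximal_independent_subset_extend[OF assms(4,3)] by blast
  obtain T where T: "finite T" "V \<subseteq> span T"
    using assms(1) unfolding fin_dim_def by blast
  have "finite B"
    using independent_span_bound[OF T(1) B(3)] B(2) T(2) by blast
  moreover have "span B = V"
    using B assms(2) by (simp add: span_subspace)
  moreover have "card B = dim V"
    using B dim_unique by metis
  ultimately show ?thesis using that B by blast
qed

lemma dim_psubspace:
  assumes "fin_dim V" "subspace V" "subspace W" "W \<subseteq> V" "W \<noteq> V"
  shows "dim W < dim V"
proof -
  obtain C where C: "finite C" "independent C" "span C = W" "card C = dim W"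
    using fin_dim_basis[OF fin_dim_subset[OF assms(1,4)] assms(3) independent_empty empty_subsetI] by blast
  obtain x where x: "x \<in> V" "x \<notin> W" using assms(4,5) by blast
  have ind: "independent (insert x C)"
    using C x by (simp add: independent_insertI)
  have "C \<subseteq> V" using C(3) span_superset assms(4) by blast
  then obtain B where B: "insert x C \<subseteq> B" "finite B" "card B = dim V"
    using fin_dim_basis[OF assms(1,2) ind] x by blast
  have "card (insert x C) \<le> card B"
    using B by (intro card_mono) auto
  moreover have "x \<notin> C" using x C(3) span_base by blast
  ultimately show ?thesis using B C by simp
qed

lemma linear_image_eq_iff_inj:
  fixes f :: "'a::real_vector \<Rightarrow> 'a"
  assumes V: "fin_dim V" "subspace V" and f: "linear f" "f ` V \<subseteq> V"
  shows "f ` V = V \<longleftrightarrow> (\<forall>x\<in>V. f x = 0 \<longrightarrow> x = 0)"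
proof
  assume im: "f ` V = V"
  show "\<forall>x\<in>V. f x = 0 \<longrightarrow> x = 0"
  proof (intro ballI impI, rule ccontr)
    fix x assume x: "x \<in> V" "f x = 0" "x \<noteq> 0"
    have "independent {x}" using x by simp
    then obtain B where B: "{x} \<subseteq> B" "finite B" "span B = V" "card B = dim V"
      using fin_dim_basis[OF V, of "{x}"] x by blast
    have "V = span (f ` B)"
      using im linear_span_image[OF f(1), of B] B by simp
    also have "f ` B = insert 0 (f ` (B - {x}))"
      using B x by auto
    finally have "V = span (f ` (B - {x}))" by simp
    then have "dim V \<le> card (f ` (B - {x}))"
      using B by (intro dim_le_card) auto
    also have "\<dots> \<le> card (B - {x})"
      using B by (intro card_image_le) auto
    also have "\<dots> < card B"
      using B by (intro psubset_card_mono) auto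
    finally show False using B by simp
  qed
next
  assume inj: "\<forall>x\<in>V. f x = 0 \<longrightarrow> x = 0"
  obtain B where B: "finite B" "independent B" "span B = V" "card B = dim V"
    using fin_dim_basis[OF V independent_empty empty_subsetI] by blast
  have inj': "inj_on f V"
  proof (rule inj_onI)
    fix x y assume xy: "x \<in> V" "y \<in> V" "f x = f y"
    then have "x - y \<in> V" "f (x - y) = 0"
      using V(2) f(1) by (simp_all add: subspace_diff linear_diff)
    then show "x = y" using inj by force
  qed
  have ind: "independent (f ` B)"
    using B inj' f(1) by (simp add: linear_independent_injective_image)
  have "B \<subseteq> V" using B(3) span_superset by blast
  then have "card (f ` B) = card B"
    using inj' by (intro card_image) (rule inj_on_subset)
  moreover have "span (f ` B) = f ` V"
    using linear_span_image[OF f(1), of B] B by simp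
  ultimately have "dim (f ` V) = dim V"
    using B(4) dim_eq_card[OF refl ind] dim_span[of "f ` B"] by simp
  then show "f ` V = V"
    using dim_psubspace[OF V linear_subspace_image[OF f(1) V(2)] f(2)] by auto
qed

lemma separating_functional:
  assumes "subspace W" "x \<notin> W"
  obtains f :: "'a::real_vector \<Rightarrow> real" where "linear f" "\<And>w. w \<in> W \<Longrightarrow> f w = 0" "f x = 1"
proof -
  obtain C where C: "C \<subseteq> W" "independent C" "W \<subseteq> span C"
    using maximal_independent_subset by blast
  have sp: "span C = W" using C assms(1) by (simp add: span_subspace)
  have "independent (insert x C)"
    using C assms sp by (simp add: independent_insertI)
  then obtain f :: "'a \<Rightarrow> real" where f: "linear f" "\<forall>y\<in>insert x C. f y = (if y = x then 1 else 0)"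
    using linear_independent_extend[of "insert x C" "\<lambda>y. if y = x then 1 else 0"] by blast
  have "f w = 0" if "w \<in> W" for w
  proof -
    have "f c = 0" if "c \<in> C" for c
      using that f(2) assms(2) C(1) by auto
    then show ?thesis
      using linear_eq_0_on_span[OF f(1), of C w] that sp by blast
  qed
  then show ?thesis using that f by auto
qed

text \<open>On the kernel of \<open>s j\<close> the other functionals suffice by induction; a vector
  of \<open>U\<close> on which \<open>s j\<close> does not vanish then determines the missing
  coefficient.\<close>

lemma functional_combination:
  fixes s :: "'i \<Rightarrow> 'a::real_vector \<Rightarrow> real"
  assumes "finite I" "subspace U" "\<And>i. i \<in> I \<Longrightarrow> linear (s i)" "linear f"
    and "\<And>x. \<lbrakk>x \<in> U; \<forall>i\<in>I. s i x = 0\<rbrakk> \<Longrightarrow> f x = 0"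
  shows "\<exists>c. \<forall>x\<in>U. f x = (\<Sum>i\<in>I. c i * s i x)"
  using assms
proof (induction I arbitrary: f U rule: finite_induct)
  case (insert j I)
  let ?K = "{x \<in> U. s j x = 0}"
  have lj: "linear (s j)" using insert.prems by auto
  have "subspace ?K"
    using insert.prems(1) lj by (auto simp: subspace_def linear_0 linear_add linear_cmul)
  then have "\<exists>c. \<forall>x\<in>?K. f x = (\<Sum>i\<in>I. c i * s i x)"
    using insert.prems by (intro insert.IH) auto
  then obtain c where c: "\<And>x. x \<in> ?K \<Longrightarrow> f x = (\<Sum>i\<in>I. c i * s i x)" by blast
  have lin: "linear (\<lambda>x. \<Sum>i\<in>I. c i * s i x)"
    using insert.prems(2) by (intro linear_compose_sum ballI linear_compose_scale_right[where 'b = real, simplified]) auto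
  show ?case
  proof (cases "?K = U")
    case True
    have "f x = (\<Sum>i\<in>insert j I. (c(j := 0)) i * s i x)" if "x \<in> U" for x
      using c[of x] that True insert.hyps by (auto intro!: sum.cong)
    then show ?thesis by blast
  next
    case False
    then obtain u where u: "u \<in> U" "s j u \<noteq> 0" by blast
    define d where "d = (f u - (\<Sum>i\<in>I. c i * s i u)) / s j u"
    have "f x = (\<Sum>i\<in>insert j I. (c(j := d)) i * s i x)" if x: "x \<in> U" for x
    proof -
      let ?x = "x - (s j x / s j u) *\<^sub>R u"
      have "?x \<in> ?K"
        using x u insert.prems(1) lj by (auto simp: linear_diff linear_cmul intro!: subspace_diff subspace_scale)
      then have "f ?x = (\<Sum>i\<in>I. c i * s i ?x)" by (rule c)
      then have "f x - (s j x / s j u) * f u = (\<Sum>i\<in>I. c i * s i x) - (s j x / s j u) * (\<Sum>i\<in>I. c i * s i u)"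
        using insert.prems(3) linear_diff[OF lin, of x "(s j x / s j u) *\<^sub>R u"] linear_cmul[OF lin, of "s j x / s j u" u]
        by (simp add: linear_diff linear_cmul)
      then have "f x = (\<Sum>i\<in>I. c i * s i x) + d * s j x"
        using u(2) by (simp add: d_def field_simps)
      moreover have "(\<Sum>i\<in>I. (c(j := d)) i * s i x) = (\<Sum>i\<in>I. c i * s i x)"
        using insert.hyps by (intro sum.cong) auto
      ultimately show ?thesis
        using insert.hyps by simp
    qed
    then show ?thesis by blast
  qed
qed simp

lemma coordinate_functionals:
  fixes B :: "'a::real_vector set"
  assumes "finite B" "independent B"
  obtains f :: "'a \<Rightarrow> 'a \<Rightarrow> real" where "\<And>b. linear (f b)"
    "\<And>b c. \<lbrakk>b \<in> B; c \<in> B\<rbrakk> \<Longrightarrow> f b c = (if b = c then 1 else 0)"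
    "\<And>x. x \<in> span B \<Longrightarrow> (\<Sum>b\<in>B. f b x *\<^sub>R b) = x"
proof -
  have "\<exists>g :: 'a \<Rightarrow> real. linear g \<and> (\<forall>c\<in>B. g c = (if b = c then 1 else 0))" for b
    using linear_independent_extend[OF assms(2), of "\<lambda>c. if b = c then 1 else 0"] .
  then have "\<forall>b. \<exists>g :: 'a \<Rightarrow> real. linear g \<and> (\<forall>c\<in>B. g c = (if b = c then 1 else 0))"
    by blast
  then have "\<exists>f :: 'a \<Rightarrow> 'a \<Rightarrow> real. \<forall>b. linear (f b) \<and> (\<forall>c\<in>B. f b c = (if b = c then 1 else 0))"
    by (rule choice)
  then obtain f :: "'a \<Rightarrow> 'a \<Rightarrow> real" where f: "\<And>b. linear (f b)"
    "\<And>b c. c \<in> B \<Longrightarrow> f b c = (if b = c then 1 else 0)"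
    by blast
  have "(\<Sum>b\<in>B. f b x *\<^sub>R b) = x" if "x \<in> span B" for x
  proof (rule linear_eq_on_span[OF _ _ _ that])
    show "linear (\<lambda>x. \<Sum>b\<in>B. f b x *\<^sub>R b)"
      using f(1) by (intro linear_compose_sum ballI) (auto intro!: linearI simp: linear_add linear_cmul scaleR_add_left)
    show "linear (\<lambda>x::'a. x)" by (rule linear_ident)
    fix c assume "c \<in> B"
    then have "(\<Sum>b\<in>B. f b c *\<^sub>R b) = (\<Sum>b\<in>B. if b = c then c else 0)"
      using f(2) by (intro sum.cong) auto
    then show "(\<Sum>b\<in>B. f b c *\<^sub>R b) = c"
      using assms(1) \<open>c \<in> B\<close> by simp
  qed
  then show ?thesis using that f by blast
qed

text \<open>A bracket on the whole type: every Lie algebra bracket extends to one, by composition with a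
  projection onto the carrier.\<close>

locale lie_bracket =
  fixes br :: "'a::real_vector \<Rightarrow> 'a \<Rightarrow> 'a"
  assumes linear_left: "linear (\<lambda>x. br x y)"
    and linear_right: "linear (br x)"
    and br_self [simp]: "br x x = 0"
    and br_jacobi: "br x (br y z) + br y (br z x) + br z (br x y) = 0"
begin

lemma br_simps [simp]:
  "br (x + y) z = br x z + br y z" "br z (x + y) = br z x + br z y"
  "br (x - y) z = br x z - br y z" "br z (x - y) = br z x - br z y"
  "br (c *\<^sub>R x) z = c *\<^sub>R br x z" "br z (c *\<^sub>R x) = c *\<^sub>R br z x"
  "br (- x) z = - br x z" "br z (- x) = - br z x"
  "br 0 z = 0" "br z 0 = 0"
  using linear_add[OF linear_left, of x y z] linear_diff[OF linear_left, of x y z]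
    linear_cmul[OF linear_left, of c x z] linear_neg[OF linear_left, of x z] linear_0[OF linear_left, of z]
    linear_add[OF linear_right, of z x y] linear_diff[OF linear_right, of z x y]
    linear_cmul[OF linear_right, of z c x] linear_neg[OF linear_right, of z x] linear_0[OF linear_right, of z]
  by - assumption+

lemma br_skew: "br y x = - br x y"
proof -
  have "br (x + y) (x + y) = 0" by (rule br_self)
  then have "br y x + br x y = 0" by (simp del: br_self add: br_self[of x] br_self[of y])
  then show ?thesis by (simp add: eq_neg_iff_add_eq_0)
qed

lemma br_leibniz: "br x (br y z) = br (br x y) z + br y (br x z)"
proof -
  have "br z x = - br x z" "br z (br x y) = - br (br x y) z" by (rule br_skew)+
  with br_jacobi[of x y z] have "br x (br y z) + - br y (br x z) + - br (br x y) z = 0" by (simp only: br_simps)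
  then show ?thesis by (simp add: algebra_simps)
qed

section \<open>Radicals, centralisers and the stably contact property\<close>

definition subalgebra :: "'a set \<Rightarrow> bool" where
  "subalgebra V \<longleftrightarrow> subspace V \<and> fin_dim V \<and> (\<forall>x\<in>V. \<forall>y\<in>V. br x y \<in> V)"

definition abelian :: "'a set \<Rightarrow> bool" where
  "abelian V \<longleftrightarrow> (\<forall>x\<in>V. \<forall>y\<in>V. br x y = 0)"

text \<open>Under the coadjoint action this is the stabiliser of \<xi>; as a subspace it is the
  radical of d\<xi> on \<open>V\<close>.\<close>

definition stabiliser :: "'a set \<Rightarrow> ('a \<Rightarrow> real) \<Rightarrow> 'a set" where
  "stabiliser V \<xi> = {x \<in> V. \<forall>y\<in>V. \<xi> (br x y) = 0}"

definition stably_contact :: "'a set \<Rightarrow> bool" where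
  "stably_contact V \<longleftrightarrow> (\<forall>\<xi>. linear \<xi> \<longrightarrow> (\<exists>x\<in>V. \<xi> x \<noteq> 0) \<longrightarrow>
     abelian (stabiliser V \<xi>) \<and> (\<exists>x\<in>stabiliser V \<xi>. \<xi> x \<noteq> 0))"

lemma stably_contactD:
  assumes "stably_contact V" "linear \<xi>" "v \<in> V" "\<xi> v \<noteq> 0"
  shows "abelian (stabiliser V \<xi>)" "\<exists>x\<in>stabiliser V \<xi>. \<xi> x \<noteq> 0"
proof -
  have "\<exists>x\<in>V. \<xi> x \<noteq> 0" using assms(3,4) by blast
  then show "abelian (stabiliser V \<xi>)" "\<exists>x\<in>stabiliser V \<xi>. \<xi> x \<noteq> 0"
    using assms(1,2) unfolding stably_contact_def by simp_all
qed

definition centraliser :: "'a set \<Rightarrow> 'a \<Rightarrow> 'a set" where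
  "centraliser V x = {y \<in> V. br x y = 0}"

lemma subalgebraD:
  assumes "subalgebra V"
  shows "subspace V" "fin_dim V" "\<And>x y. x \<in> V \<Longrightarrow> y \<in> V \<Longrightarrow> br x y \<in> V"
  using assms unfolding subalgebra_def by auto

lemma subalgebra_centraliser:
  assumes "subalgebra V" "x \<in> V"
  shows "subalgebra (centraliser V x)"
  unfolding subalgebra_def
proof (intro conjI ballI)
  show "subspace (centraliser V x)"
    using assms by (auto simp: centraliser_def subspace_def subalgebra_def)
  show "fin_dim (centraliser V x)"
    by (rule fin_dim_subset[OF subalgebraD(2)[OF assms(1)]]) (auto simp: centraliser_def)
  fix y z assume "y \<in> centraliser V x" "z \<in> centraliser V x"
  then show "br y z \<in> centraliser V x"
    using subalgebraD(3)[OF assms(1)] br_leibniz[of x y z] by (auto simp: centraliser_def)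
qed

context
  fixes V :: "'a set"
  assumes V: "subalgebra V" and H: "stably_contact V"
begin

private lemmas VS = subalgebraD[OF V]

text \<open>An eigenvalue c of ad x is also one of its transpose: some nonzero \<xi> satisfies
  \<xi>([x, y]) = c \<xi>(y) for all y. If y is in the radical of d\<xi>, the left side is 0, so
  \<xi> vanishes on the radical, which is excluded.\<close>

lemma no_real_eigenvalue:
  assumes "x \<in> V" "u \<in> V" "br x u = c *\<^sub>R u" "c \<noteq> 0"
  shows "u = 0"
proof (rule ccontr)
  assume "u \<noteq> 0"
  define f where "f = (\<lambda>y. br x y - c *\<^sub>R y)"
  have f: "linear f"
    by (auto intro!: linearI simp: f_def algebra_simps)
  have fV: "f ` V \<subseteq> V"
    using assms(1) VS by (auto simp: f_def intro!: subspace_diff subspace_scale)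
  have "f ` V \<noteq> V"
    using linear_image_eq_iff_inj[OF VS(2,1) f fV] assms \<open>u \<noteq> 0\<close> by (auto simp: f_def)
  then obtain y where y: "y \<in> V" "y \<notin> f ` V" using fV by blast
  obtain \<xi> :: "'a \<Rightarrow> real" where \<xi>: "linear \<xi>" "\<And>w. w \<in> f ` V \<Longrightarrow> \<xi> w = 0" "\<xi> y = 1"
    using separating_functional[OF linear_subspace_image[OF f VS(1)] y(2)] by blast
  obtain z where z: "z \<in> stabiliser V \<xi>" "\<xi> z \<noteq> 0"
    using stably_contactD(2)[OF H \<xi>(1) y(1)] \<xi>(3) by auto
  have "\<xi> (br z x) = 0" using z assms(1) by (simp add: stabiliser_def)
  moreover have "\<xi> (f z) = 0" using z \<xi>(2) by (auto simp: stabiliser_def)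
  ultimately have "c * \<xi> z = 0"
    using br_skew[of x z] \<xi>(1) by (simp add: f_def linear_diff linear_cmul linear_neg)
  then show False using z assms(4) by simp
qed

text \<open>A Jordan block of ad x at 0 yields \<xi> vanishing on the image of (ad x)^2 but not on
  that of ad x. Then x is in the radical belonging to the functional \<xi> o ad x. This radical is
  abelian, so ad x kills it, and \<xi> o ad x vanishes on its own radical, which is
  excluded.\<close>

lemma bracket_bracket_eq_0:
  assumes "x \<in> V" "w \<in> V" "br x (br x w) = 0"
  shows "br x w = 0"
proof (rule ccontr)
  assume nz: "br x w \<noteq> 0"
  define f where "f = br x"
  have f: "linear f" unfolding f_def by (rule linear_right)
  have fV: "f ` V \<subseteq> V" using VS assms(1) by (auto simp: f_def)
  have s: "subspace (f ` V)" by (rule linear_subspace_image[OF f VS(1)])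
  have ffV: "f ` (f ` V) \<subseteq> f ` V" using fV by blast
  have "f ` (f ` V) \<noteq> f ` V"
    using linear_image_eq_iff_inj[OF fin_dim_subset[OF VS(2) fV] s f ffV] nz assms by (auto simp: f_def)
  then obtain y where y: "y \<in> V" "f y \<notin> f ` f ` V" using ffV by blast
  obtain \<xi> :: "'a \<Rightarrow> real" where \<xi>: "linear \<xi>" "\<And>w. w \<in> f ` f ` V \<Longrightarrow> \<xi> w = 0" "\<xi> (f y) = 1"
    using separating_functional[OF linear_subspace_image[OF f s] y(2)] by blast
  have lin: "linear (\<lambda>v. \<xi> (f v))"
    using linear_compose[OF f \<xi>(1)] by (simp add: o_def)
  have ab: "abelian (stabiliser V (\<lambda>v. \<xi> (f v)))" and "\<exists>x\<in>stabiliser V (\<lambda>v. \<xi> (f v)). \<xi> (f x) \<noteq> 0"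
    using stably_contactD[OF H lin y(1)] \<xi>(3) by auto
  then obtain z where z: "z \<in> stabiliser V (\<lambda>v. \<xi> (f v))" "\<xi> (f z) \<noteq> 0" by blast
  have "x \<in> stabiliser V (\<lambda>v. \<xi> (f v))"
    using assms(1) \<xi>(2) by (auto simp: stabiliser_def f_def)
  then have "f z = 0" using ab z(1) unfolding abelian_def f_def by blast
  then show False using z(2) linear_0[OF \<xi>(1)] by simp
qed

text \<open>By the preceding lemma ad x is injective on its image, hence maps the image onto itself;
  this is the Fitting decomposition.\<close>

lemma centraliser_plus_image:
  assumes "x \<in> V" "v \<in> V"
  obtains y w where "y \<in> centraliser V x" "w \<in> V" "v = y + br x w"
proof -
  define f where "f = br x"
  have f: "linear f" unfolding f_def by (rule linear_right)
  have fV: "f ` V \<subseteq> V" using VS assms(1) by (auto simp: f_def)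
  have s: "subspace (f ` V)" by (rule linear_subspace_image[OF f VS(1)])
  have ffV: "f ` (f ` V) \<subseteq> f ` V" using fV by blast
  have "f ` (f ` V) = f ` V"
    using linear_image_eq_iff_inj[OF fin_dim_subset[OF VS(2) fV] s f ffV] bracket_bracket_eq_0 assms
    by (auto simp: f_def)
  then obtain w where w: "w \<in> V" "f v = f (f w)" using assms(2) by blast
  have "v - br x w \<in> centraliser V x"
    using w assms VS unfolding centraliser_def f_def by (auto intro!: subspace_diff)
  then show ?thesis using that[of "v - br x w" w] w by simp
qed

lemma centraliser_Int_image:
  assumes "x \<in> V" "y \<in> centraliser V x" "w \<in> V" "y = br x w"
  shows "y = 0"
  using bracket_bracket_eq_0[of x w] assms unfolding centraliser_def by blast

text \<open>A functional on the centraliser is extended by 0 on the image of ad x. Then x lies in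
  the radical of the extension. Since this radical is abelian, it is contained in the centraliser,
  where it coincides with the radical of the given functional.\<close>

lemma stably_contact_centraliser:
  assumes x: "x \<in> V"
  shows "stably_contact (centraliser V x)"
  unfolding stably_contact_def
proof (intro allI impI)
  fix \<eta> :: "'a \<Rightarrow> real" assume \<eta>: "linear \<eta>" and "\<exists>y\<in>centraliser V x. \<eta> y \<noteq> 0"
  let ?c = "centraliser V x"
  note c = subalgebraD[OF subalgebra_centraliser[OF V x]]
  obtain y0 where "y0 \<in> ?c" "\<eta> y0 \<noteq> 0" using \<open>\<exists>y\<in>_. _\<close> by blast
  then obtain y1 where y1: "y1 \<in> ?c" "\<eta> y1 = 1"
    using \<eta> c(1) that[of "(1 / \<eta> y0) *\<^sub>R y0"] by (auto simp: subspace_scale linear_cmul)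
  define W where "W = {k + m | k m. (k \<in> ?c \<and> \<eta> k = 0) \<and> m \<in> br x ` V}"
  have K: "subspace {k. k \<in> ?c \<and> \<eta> k = 0}"
    using c(1) \<eta> by (auto simp: subspace_def linear_0 linear_add linear_cmul)
  have sW: "subspace W"
    unfolding W_def using subspace_sums[OF K linear_subspace_image[OF linear_right VS(1)], of x] by simp
  have nW: "y1 \<notin> W"
  proof
    assume "y1 \<in> W"
    then obtain k w where kw: "k \<in> ?c" "\<eta> k = 0" "w \<in> V" "y1 = k + br x w"
      unfolding W_def by blast
    then have "y1 - k = br x w" "y1 - k \<in> ?c" using subspace_diff[OF c(1) y1(1) kw(1)] by simp_all
    then have "y1 - k = 0" using centraliser_Int_image[OF x] kw(3) by blast
    then show False using y1 kw by simp
  qed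
  obtain \<xi> :: "'a \<Rightarrow> real" where \<xi>: "linear \<xi>" "\<And>w. w \<in> W \<Longrightarrow> \<xi> w = 0" "\<xi> y1 = 1"
    using separating_functional[OF sW nW] by blast
  have im: "\<xi> (br x w) = 0" if "w \<in> V" for w
  proof -
    have "0 \<in> {k. k \<in> ?c \<and> \<eta> k = 0}" using K by (rule subspace_0)
    then have "0 + br x w \<in> W"
      unfolding W_def using that by blast
    then show ?thesis using \<xi>(2) by simp
  qed
  have eq: "\<xi> y = \<eta> y" if y: "y \<in> ?c" for y
  proof -
    have "y - \<eta> y *\<^sub>R y1 \<in> ?c" "\<eta> (y - \<eta> y *\<^sub>R y1) = 0"
      using y y1 c(1) \<eta> by (auto intro!: subspace_diff subspace_scale simp: linear_diff linear_cmul)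
    moreover have "br x 0 \<in> br x ` V" using subspace_0[OF VS(1)] by blast
    ultimately have "(y - \<eta> y *\<^sub>R y1) + br x 0 \<in> W"
      unfolding W_def by blast
    then have "\<xi> (y - \<eta> y *\<^sub>R y1) = 0" using \<xi>(2) by simp
    then show ?thesis using \<xi>(1,3) by (simp add: linear_diff linear_cmul)
  qed
  have st: "abelian (stabiliser V \<xi>)" "\<exists>y\<in>stabiliser V \<xi>. \<xi> y \<noteq> 0"
    using stably_contactD[OF H \<xi>(1), of y1] \<xi>(3) y1(1) by (auto simp: centraliser_def)
  have sub: "y \<in> ?c" if "y \<in> stabiliser V \<xi>" for y
  proof -
    have "x \<in> stabiliser V \<xi>" using x im by (simp add: stabiliser_def)
    then show ?thesis using st(1) that by (auto simp: abelian_def stabiliser_def centraliser_def)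
  qed
  have "stabiliser V \<xi> = stabiliser ?c \<eta>"
  proof (intro set_eqI iffI)
    fix y assume y: "y \<in> stabiliser V \<xi>"
    show "y \<in> stabiliser ?c \<eta>"
      unfolding stabiliser_def
    proof (intro CollectI conjI ballI)
      show yc: "y \<in> ?c" by (rule sub[OF y])
      fix z assume z: "z \<in> ?c"
      then show "\<eta> (br y z) = 0"
        using y eq[OF c(3)[OF yc z]] by (simp add: stabiliser_def centraliser_def)
    qed
  next
    fix y assume y: "y \<in> stabiliser ?c \<eta>"
    then have yc: "y \<in> ?c" by (simp add: stabiliser_def)
    have "\<xi> (br y v) = 0" if v: "v \<in> V" for v
    proof -
      obtain z w where zw: "z \<in> ?c" "w \<in> V" "v = z + br x w"
        using centraliser_plus_image[OF x v] by blast
      have "br y (br x w) = br x (br y w)"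
        using br_leibniz[of x y w] yc by (simp add: centraliser_def)
      then have "\<xi> (br y (br x w)) = 0"
        using im VS(3) yc zw(2) by (simp add: centraliser_def)
      moreover have "\<xi> (br y z) = 0"
        using eq c(3) yc zw(1) y by (simp add: stabiliser_def)
      ultimately show ?thesis using \<xi>(1) zw(3) by (simp add: linear_add)
    qed
    then show "y \<in> stabiliser V \<xi>" using yc by (simp add: stabiliser_def centraliser_def)
  qed
  moreover have "\<exists>y\<in>stabiliser V \<xi>. \<eta> y \<noteq> 0"
    using st(2) sub eq by force
  ultimately show "abelian (stabiliser ?c \<eta>) \<and> (\<exists>y\<in>stabiliser ?c \<eta>. \<eta> y \<noteq> 0)"
    using st(1) by simp
qed

text \<open>A functional vanishing on all brackets has the whole of \<open>V\<close> as its radical,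
  and the radical of a nonzero functional is abelian.\<close>

lemma perfect_if_not_abelian:
  assumes "\<not> abelian V"
  shows "span {br x y | x y. x \<in> V \<and> y \<in> V} = V"
proof (rule ccontr)
  let ?D = "{br x y | x y. x \<in> V \<and> y \<in> V}"
  assume "span ?D \<noteq> V"
  moreover have "span ?D \<subseteq> V" using VS by (intro span_minimal) auto
  ultimately obtain v where v: "v \<in> V" "v \<notin> span ?D" by blast
  obtain \<xi> :: "'a \<Rightarrow> real" where \<xi>: "linear \<xi>" "\<And>w. w \<in> span ?D \<Longrightarrow> \<xi> w = 0" "\<xi> v = 1"
    using separating_functional[OF subspace_span v(2)] by blast
  have "stabiliser V \<xi> = V"
    using \<xi>(2) span_base[of _ ?D] by (auto simp: stabiliser_def)
  then show False
    using stably_contactD(1)[OF H \<xi>(1) v(1)] \<xi>(3) assms by simp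
qed

end

end

section \<open>From constant height to stably contact algebras\<close>

lemma tendsto_wedge1:
  assumes "\<And>y. ((\<lambda>t. \<alpha> t y) \<longlongrightarrow> \<alpha>' y) F" "\<And>Z. ((\<lambda>t. f t Z) \<longlongrightarrow> f' Z) F"
  shows "((\<lambda>t. wedge1 (\<alpha> t) (f t) X) \<longlongrightarrow> wedge1 \<alpha>' f' X) F"
  using assms(2)
proof (induction X arbitrary: f f')
  case (Cons y X)
  have "((\<lambda>t. wedge1 (\<alpha> t) (\<lambda>Z. f t (y # Z)) X) \<longlongrightarrow> wedge1 \<alpha>' (\<lambda>Z. f' (y # Z)) X) F"
    using Cons.prems by (rule Cons.IH)
  then show ?case
    using assms(1)[of y] Cons.prems[of X] by (auto intro!: tendsto_diff tendsto_mult)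
qed simp

lemma tendsto_wedge2:
  assumes "\<And>x y. ((\<lambda>t. \<omega> t x y) \<longlongrightarrow> \<omega>' x y) F" "\<And>Z. ((\<lambda>t. f t Z) \<longlongrightarrow> f' Z) F"
  shows "((\<lambda>t. wedge2 (\<omega> t) (f t) X) \<longlongrightarrow> wedge2 \<omega>' f' X) F"
  using assms(2)
proof (induction X arbitrary: f f')
  case (Cons y X)
  have "((\<lambda>t. wedge2 (\<omega> t) (\<lambda>Z. f t (y # Z)) X) \<longlongrightarrow> wedge2 \<omega>' (\<lambda>Z. f' (y # Z)) X) F"
    using Cons.prems by (rule Cons.IH)
  moreover have "((\<lambda>t. wedge1 (\<omega> t y) (f t) X) \<longlongrightarrow> wedge1 (\<omega>' y) f' X) F"
    using assms(1) Cons.prems by (rule tendsto_wedge1)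
  ultimately show ?case
    by (auto intro!: tendsto_add)
qed simp

lemma tendsto_pow2:
  assumes "\<And>x y. ((\<lambda>t. \<omega> t x y) \<longlongrightarrow> \<omega>' x y) F"
  shows "((\<lambda>t. pow2 (\<omega> t) m X) \<longlongrightarrow> pow2 \<omega>' m X) F"
  by (induction m arbitrary: X) (auto intro!: tendsto_wedge2 assms)

lemma wedge1_zero_on:
  assumes "\<And>Z. set Z \<subseteq> V \<Longrightarrow> f Z = 0" "set X \<subseteq> V"
  shows "wedge1 \<alpha> f X = 0"
  using wedge1_cong[of V \<alpha> \<alpha> X f "\<lambda>_. 0"] assms by (simp add: wedge1_zero)

lemma wedge1_zero_left_on:
  assumes "\<And>y. y \<in> V \<Longrightarrow> \<alpha> y = 0" "set X \<subseteq> V"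
  shows "wedge1 \<alpha> f X = 0"
  using wedge1_cong[of V \<alpha> "\<lambda>_. 0" X f f] assms by (simp add: wedge1_zero_left)

lemma pow2_Cons_zero_on:
  assumes "\<And>z. z \<in> V \<Longrightarrow> \<omega> y z = 0" "set X \<subseteq> V"
  shows "pow2 \<omega> m (y # X) = 0"
  by (cases m) (simp, simp only: pow2_Suc_Cons wedge1_zero_left_on[of V, OF assms] mult_zero_right)

lemma pow2_Suc_zero_on:
  assumes "\<And>y z. y \<in> V \<Longrightarrow> z \<in> V \<Longrightarrow> \<omega> y z = 0" "set X \<subseteq> V"
  shows "pow2 \<omega> (Suc m) X = 0"
proof (cases X)
  case (Cons y Y)
  then have "set Y \<subseteq> V" "\<And>z. z \<in> V \<Longrightarrow> \<omega> y z = 0" using assms by auto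
  then show ?thesis unfolding Cons by (intro pow2_Cons_zero_on[of V])
qed simp

lemma tendsto_zero_at_0:
  fixes g :: "real \<Rightarrow> real"
  assumes "(g \<longlongrightarrow> l) (at 0)" "\<And>t. t \<noteq> 0 \<Longrightarrow> g t = 0"
  shows "l = 0"
proof -
  have "((\<lambda>_. 0) \<longlongrightarrow> l) (at (0::real))"
    by (rule Lim_transform_eventually[OF assms(1)]) (use assms(2) in \<open>auto simp: eventually_at_filter\<close>)
  then show ?thesis by (simp add: tendsto_const_iff)
qed

context lie_bracket
begin

definition dform :: "('a \<Rightarrow> real) \<Rightarrow> 'a \<Rightarrow> 'a \<Rightarrow> real" where
  "dform \<xi> x y = - \<xi> (br x y)"

lemma dform_skew: "linear \<xi> \<Longrightarrow> dform \<xi> y x = - dform \<xi> x y"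
  using linear_neg[of \<xi> "br x y"] unfolding dform_def br_skew[of y x] by simp

lemma stabiliser_iff: "x \<in> stabiliser V \<xi> \<longleftrightarrow> x \<in> V \<and> (\<forall>y\<in>V. dform \<xi> x y = 0)"
  by (auto simp: stabiliser_def dform_def)

lemma linear_dform: "linear \<xi> \<Longrightarrow> linear (dform \<xi> x)"
  unfolding dform_def by (intro linearI) (simp_all add: linear_add linear_cmul)

lemma subspace_stabiliser:
  assumes "subspace V" "linear \<xi>"
  shows "subspace (stabiliser V \<xi>)"
  using assms by (auto simp: stabiliser_def subspace_def linear_0 linear_add linear_cmul)

text \<open>On the quotient of \<open>V\<close> by the radical, d\<xi> is nondegenerate, so it
  identifies the quotient with its dual.\<close>

lemma functional_vanishing_on_stabiliser:
  assumes V: "subalgebra V" and "linear \<xi>" "linear f" and f: "\<And>x. x \<in> stabiliser V \<xi> \<Longrightarrow> f x = 0"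
  obtains v where "v \<in> V" "\<And>x. x \<in> V \<Longrightarrow> f x = dform \<xi> v x"
proof -
  note VD = subalgebraD[OF V]
  obtain B where B: "finite B" "span B = V"
    using fin_dim_basis[OF VD(2,1) independent_empty empty_subsetI] by blast
  have "f x = 0" if "x \<in> V" "\<forall>b\<in>B. dform \<xi> b x = 0" for x
  proof (rule f)
    have "dform \<xi> x y = 0" if "y \<in> V" for y
    proof (rule linear_eq_0_on_span[OF linear_dform[OF assms(2)]])
      show "y \<in> span B" using that B by simp
      show "dform \<xi> x b = 0" if "b \<in> B" for b
        using \<open>\<forall>b\<in>B. _\<close> that dform_skew[OF assms(2), of x b] by simp
    qed
    then show "x \<in> stabiliser V \<xi>" using \<open>x \<in> V\<close> by (simp add: stabiliser_iff)
  qed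
  then obtain c where c: "\<And>x. x \<in> V \<Longrightarrow> f x = (\<Sum>b\<in>B. c b * dform \<xi> b x)"
    using functional_combination[OF B(1) VD(1), of "dform \<xi>" f] linear_dform[OF assms(2)] assms(3) by blast
  have "(\<Sum>b\<in>B. c b * dform \<xi> b x) = dform \<xi> (\<Sum>b\<in>B. c b *\<^sub>R b) x" for x
    using assms(2) linear_sum[OF linear_left, of "\<lambda>b. c b *\<^sub>R b" B x]
    by (simp add: dform_def linear_sum linear_cmul sum_negf)
  moreover have "(\<Sum>b\<in>B. c b *\<^sub>R b) \<in> V"
    unfolding B(2)[symmetric] by (intro span_sum span_scale span_base)
  ultimately show ?thesis using that c by metis
qed

text \<open>The trace of \<open>x \<mapsto> [x, u]\<close> with respect to a basis is a Lie algebra homomorphism, hence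
  vanishes on commutators.\<close>

lemma trace_perfect_eq_0:
  assumes "subalgebra V" and B: "finite B" "span B = V" "\<And>b. linear (f b)"
    "\<And>x. x \<in> V \<Longrightarrow> (\<Sum>b\<in>B. f b x *\<^sub>R b) = x"
    and perfect: "span {br x y | x y. x \<in> V \<and> y \<in> V} = V" and "v \<in> V"
  shows "(\<Sum>b\<in>B. f b (br b v)) = (0::real)"
proof (rule linear_eq_0_on_span[where f = "\<lambda>v. \<Sum>b\<in>B. f b (br b v)"])
  note VD = subalgebraD[OF assms(1)]
  have BV: "B \<subseteq> V" using B(2) span_superset by blast
  show "linear (\<lambda>v. \<Sum>b\<in>B. f b (br b v))"
    using B(3) by (intro linearI) (simp_all add: linear_add linear_cmul sum.distrib sum_distrib_left)
  show "v \<in> span {br x y | x y. x \<in> V \<and> y \<in> V}" using perfect assms(7) by simp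
  fix u assume "u \<in> {br x y | x y. x \<in> V \<and> y \<in> V}"
  then obtain x y where xy: "x \<in> V" "y \<in> V" "u = br x y" by blast
  \<comment> \<open>The trace of [-, x] followed by [-, y]; as the trace of a product of two
    matrices it is symmetric in \<open>x\<close> and \<open>y\<close>.\<close>
  define t where "t x y = (\<Sum>b\<in>B. f b (br (br b x) y))" for x y
  have t: "t x y = (\<Sum>b\<in>B. \<Sum>c\<in>B. f c (br b x) * f b (br c y))" if "x \<in> V" for x y
    unfolding t_def
  proof (rule sum.cong)
    fix b assume "b \<in> B"
    then have "br b x \<in> V" using BV VD(3) that by blast
    then have "br (br b x) y = br (\<Sum>c\<in>B. f c (br b x) *\<^sub>R c) y" using B(4) by simp
    also have "\<dots> = (\<Sum>c\<in>B. f c (br b x) *\<^sub>R br c y)"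
      using linear_sum[OF linear_left, of "\<lambda>c. f c (br b x) *\<^sub>R c" B y] by simp
    finally show "f b (br (br b x) y) = (\<Sum>c\<in>B. f c (br b x) * f b (br c y))"
      using B(3) by (simp add: linear_sum linear_cmul)
  qed simp
  have "t x y = t y x"
    unfolding t[OF xy(1)] t[OF xy(2)] by (subst sum.swap) (simp add: mult.commute)
  moreover have "f b (br b u) = f b (br (br b x) y) - f b (br (br b y) x)" for b
    using br_leibniz[of b x y] br_skew[of x "br b y"] linear_diff[OF B(3), of b "br (br b x) y" "br (br b y) x"]
    by (simp add: xy(3))
  then have "(\<Sum>b\<in>B. f b (br b u)) = t x y - t y x"
    unfolding t_def by (simp only: sum_subtractf)
  ultimately show "(\<Sum>b\<in>B. f b (br b u)) = 0" by simp
qed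


text \<open>If \<xi> vanished on the radical, it would be \<iota>_v d\<xi>, and \<xi> \<and>
  (d\<xi>)^k would be a multiple of \<iota>_v (d\<xi>)^(k+1) = 0. Commutators in the radical are
  detected by the first-order term of (d\<xi> + t d\<eta>)^(k+1) = 0.\<close>

lemma stably_contactI:
  assumes V: "subalgebra V"
    and nz: "\<And>\<xi>. linear \<xi> \<Longrightarrow> \<exists>x\<in>V. \<xi> x \<noteq> 0 \<Longrightarrow> \<exists>X. set X \<subseteq> V \<and> wedge1 \<xi> (pow2 (dform \<xi>) k) X \<noteq> 0"
    and zero: "\<And>\<xi> X. linear \<xi> \<Longrightarrow> set X \<subseteq> V \<Longrightarrow> pow2 (dform \<xi>) (Suc k) X = 0"
  shows "stably_contact V"
  unfolding stably_contact_def
proof (intro allI impI conjI)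
  fix \<xi> :: "'a \<Rightarrow> real" assume \<xi>: "linear \<xi>" "\<exists>x\<in>V. \<xi> x \<noteq> 0"
  note VD = subalgebraD[OF V]
  obtain X where X: "set X \<subseteq> V" "wedge1 \<xi> (pow2 (dform \<xi>) k) X \<noteq> 0"
    using nz[OF \<xi>] by blast
  show "\<exists>x\<in>stabiliser V \<xi>. \<xi> x \<noteq> 0"
  proof (rule ccontr)
    assume "\<not> (\<exists>x\<in>stabiliser V \<xi>. \<xi> x \<noteq> 0)"
    then obtain v where v: "v \<in> V" "\<And>x. x \<in> V \<Longrightarrow> \<xi> x = dform \<xi> v x"
      using functional_vanishing_on_stabiliser[OF V \<xi>(1) \<xi>(1)] by blast
    have "wedge1 (dform \<xi> v) (pow2 (dform \<xi>) k) X = wedge1 \<xi> (pow2 (dform \<xi>) k) X"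
      using v X(1) by (intro wedge1_cong[of V]) auto
    moreover have "pow2 (dform \<xi>) (Suc k) (v # X) = 0"
      using zero[OF \<xi>(1), of "v # X"] v(1) X(1) by simp
    ultimately show False
      using X(2) unfolding pow2_Suc_Cons by simp
  qed
  show "abelian (stabiliser V \<xi>)"
    unfolding abelian_def
  proof (intro ballI, rule ccontr)
    fix x y assume x: "x \<in> stabiliser V \<xi>" and y: "y \<in> stabiliser V \<xi>" and ne: "br x y \<noteq> 0"
    have xV: "x \<in> V" "y \<in> V" using x y by (auto simp: stabiliser_def)
    obtain \<eta> :: "'a \<Rightarrow> real" where \<eta>: "linear \<eta>" "\<eta> (br x y) = 1"
      using separating_functional[OF subspace_single_0, of "br x y"] ne by blast
    define \<omega> where "\<omega> t = dform (\<lambda>z. \<xi> z + t * \<eta> z)" for t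
    have lin: "linear (\<lambda>z. \<xi> z + t * \<eta> z)" for t
      using \<xi>(1) \<eta>(1) by (intro linearI) (simp_all add: linear_add linear_cmul algebra_simps)
    have \<omega>x: "\<omega> t x z = t * dform \<eta> x z" if "z \<in> V" for t z
      using x that by (simp add: \<omega>_def dform_def stabiliser_def algebra_simps)
    have lim: "((\<lambda>t. \<omega> t u z) \<longlongrightarrow> dform \<xi> u z) (at 0)" for u z
      unfolding \<omega>_def dform_def by (auto intro!: tendsto_eq_intros)
    \<comment> \<open>Contracting (d\<xi> + t d\<eta>)^(k+1) = 0 with \<open>x\<close>, an element
      of the radical of d\<xi>, produces a factor t, which is divided out before t tends to
      0.\<close>
    have *: "wedge1 (dform \<eta> x) (pow2 (dform \<xi>) k) Z = 0" if Z: "set Z \<subseteq> V" for Z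
    proof (rule tendsto_zero_at_0)
      show "((\<lambda>t. wedge1 (dform \<eta> x) (pow2 (\<omega> t) k) Z) \<longlongrightarrow> wedge1 (dform \<eta> x) (pow2 (dform \<xi>) k) Z) (at 0)"
        by (intro tendsto_wedge1 tendsto_pow2 lim tendsto_const)
      fix t :: real assume "t \<noteq> 0"
      have "pow2 (\<omega> t) (Suc k) (x # Z) = 0"
        unfolding \<omega>_def using zero[OF lin, of "x # Z"] Z xV by simp
      then have "wedge1 (\<omega> t x) (pow2 (\<omega> t) k) Z = 0"
        unfolding pow2_Suc_Cons by simp
      also have "wedge1 (\<omega> t x) (pow2 (\<omega> t) k) Z = wedge1 (\<lambda>z. t * dform \<eta> x z) (pow2 (\<omega> t) k) Z"
        using Z \<omega>x by (intro wedge1_cong[of V]) auto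
      finally show "wedge1 (dform \<eta> x) (pow2 (\<omega> t) k) Z = 0"
        using \<open>t \<noteq> 0\<close> by (simp add: wedge1_scale_left)
    qed
    \<comment> \<open>Contraction with \<open>y\<close> kills (d\<xi>)^k, so only the term
      d\<eta>(x, y) (d\<xi>)^k survives, and d\<eta>(x, y) = -1.\<close>
    have "pow2 (dform \<xi>) k Z = 0" if Z: "set Z \<subseteq> V" for Z
    proof -
      have "wedge1 (dform \<eta> x) (\<lambda>Z. pow2 (dform \<xi>) k (y # Z)) Z = 0"
        using y Z by (intro wedge1_zero_on[of V] pow2_Cons_zero_on[of V]) (auto simp: stabiliser_iff)
      then show ?thesis
        using *[of "y # Z"] xV Z \<eta>(2) by (simp add: dform_def)
    qed
    then show False
      using wedge1_zero_on[OF _ X(1)] X(2) by blast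
  qed
qed

text \<open>A nonzero functional vanishing on all brackets has d\<xi> = 0, so its height would be 0
  and not k.\<close>

lemma exists_nonzero_form_imp_perfect:
  assumes V: "subalgebra V" and "k \<noteq> 0"
    and nz: "\<And>\<xi>. linear \<xi> \<Longrightarrow> \<exists>x\<in>V. \<xi> x \<noteq> 0 \<Longrightarrow> \<exists>X. set X \<subseteq> V \<and> wedge1 \<xi> (pow2 (dform \<xi>) k) X \<noteq> 0"
  shows "span {br x y | x y. x \<in> V \<and> y \<in> V} = V"
proof (rule ccontr)
  note VD = subalgebraD[OF V]
  let ?D = "{br x y | x y. x \<in> V \<and> y \<in> V}"
  assume "span ?D \<noteq> V"
  moreover have "span ?D \<subseteq> V" using VD by (intro span_minimal) auto
  ultimately obtain v where v: "v \<in> V" "v \<notin> span ?D" by blast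
  obtain \<xi> :: "'a \<Rightarrow> real" where \<xi>: "linear \<xi>" "\<And>w. w \<in> span ?D \<Longrightarrow> \<xi> w = 0" "\<xi> v = 1"
    using separating_functional[OF subspace_span v(2)] by blast
  have zero: "dform \<xi> x y = 0" if "x \<in> V" "y \<in> V" for x y
    using \<xi>(2)[OF span_base, of "br x y"] that by (auto simp: dform_def)
  have "\<exists>x\<in>V. \<xi> x \<noteq> 0" using v \<xi>(3) by (intro bexI[of _ v]) auto
  then obtain X where X: "set X \<subseteq> V" "wedge1 \<xi> (pow2 (dform \<xi>) k) X \<noteq> 0"
    using nz[OF \<xi>(1)] by blast
  obtain m where k: "k = Suc m" using assms(2) by (cases k) auto
  have "pow2 (dform \<xi>) k Z = 0" if "set Z \<subseteq> V" for Z
    unfolding k using zero that by (rule pow2_Suc_zero_on)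
  then show False using wedge1_zero_on[OF _ X(1)] X(2) by blast
qed

text \<open>If \<open>\<xi> = \<iota>\<^sub>v d\<xi>\<close>, then \<open>x \<mapsto> [x, v]\<close> acts conformally on the symplectic space
  \<open>V / stabiliser V \<xi>\<close>, so its trace there is half the dimension.\<close>

lemma trace_Liouville:
  assumes V: "subalgebra V" and \<xi>: "linear \<xi>" "\<exists>x\<in>V. \<xi> x \<noteq> 0"
    and v: "v \<in> V" "\<And>x. x \<in> V \<Longrightarrow> \<xi> x = dform \<xi> v x"
    and stab: "\<And>y. y \<in> stabiliser V \<xi> \<Longrightarrow> br y v = y"
    and perfect: "span {br x y | x y. x \<in> V \<and> y \<in> V} = V"
  shows False
proof -
  note VD = subalgebraD[OF V]
  let ?\<omega> = "dform \<xi>" and ?S = "stabiliser V \<xi>"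
  have S: "?S \<subseteq> V" "subspace ?S"
    using subspace_stabiliser[OF VD(1) \<xi>(1)] unfolding stabiliser_def by blast+
  obtain B1 where B1: "finite B1" "independent B1" "span B1 = ?S"
    by (rule fin_dim_basis[OF fin_dim_subset[OF VD(2) S(1)] S(2) independent_empty empty_subsetI])
  have "B1 \<subseteq> V" using B1(3) S(1) span_superset by blast
  then obtain B where B: "B1 \<subseteq> B" "finite B" "independent B" "span B = V"
    using fin_dim_basis[OF VD(2,1) B1(2)] by blast
  have BV: "B \<subseteq> V" using B(4) span_superset by blast
  obtain f where f: "\<And>b::'a. linear (f b)"
    "\<And>b c. \<lbrakk>b \<in> B; c \<in> B\<rbrakk> \<Longrightarrow> f b c = (if b = c then 1 else (0::real))"
    "\<And>x. x \<in> span B \<Longrightarrow> (\<Sum>b\<in>B. f b x *\<^sub>R b) = x"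
    using coordinate_functionals[OF B(2,3)] by blast
  define B2 where "B2 = B - B1"
  have B2: "finite B2" "B2 \<subseteq> V" "B = B1 \<union> B2" "B1 \<inter> B2 = {}"
    using B BV by (auto simp: B2_def)
  \<comment> \<open>For b outside \<open>B1\<close> the b-coordinate vanishes on the radical, so it
    is the contraction of d\<xi> with a vector. These vectors, named \<open>d b\<close> below, are
    the symplectic duals of the basis of the quotient.\<close>
  have "\<exists>b'. b' \<in> V \<and> (\<forall>x\<in>V. f b x = ?\<omega> b' x)" if b: "b \<in> B2" for b
  proof -
    have "f b x = 0" if "x \<in> ?S" for x
    proof (rule linear_eq_0_on_span[OF f(1)])
      show "x \<in> span B1" using that B1 by simp
      show "f b c = 0" if "c \<in> B1" for c
        using f(2)[of b c] b that B by (auto simp: B2_def)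
    qed
    then obtain b' where "b' \<in> V" "\<And>x. x \<in> V \<Longrightarrow> f b x = ?\<omega> b' x"
      using functional_vanishing_on_stabiliser[OF V \<xi>(1) f(1)] by metis
    then show ?thesis by blast
  qed
  then have "\<forall>b\<in>B2. \<exists>b'. b' \<in> V \<and> (\<forall>x\<in>V. f b x = ?\<omega> b' x)" by blast
  then obtain d where d: "\<And>b. b \<in> B2 \<Longrightarrow> d b \<in> V" "\<And>b x. b \<in> B2 \<Longrightarrow> x \<in> V \<Longrightarrow> f b x = ?\<omega> (d b) x"
    using bchoice[of B2 "\<lambda>b b'. b' \<in> V \<and> (\<forall>x\<in>V. f b x = ?\<omega> b' x)"] by blast
  have S0: "?\<omega> x b = 0" if "b \<in> B1" "x \<in> V" for b x
  proof -
    have "b \<in> ?S" using that B1(3) span_base by blast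
    then show ?thesis using that(2) dform_skew[OF \<xi>(1), of b x] by (simp add: stabiliser_iff)
  qed
  have expand: "g x = (\<Sum>b\<in>B1. f b x * g b) + (\<Sum>b\<in>B2. f b x * g b)" if "linear g" "x \<in> V"
    for g :: "'a \<Rightarrow> real" and x
  proof -
    have "g x = g (\<Sum>b\<in>B. f b x *\<^sub>R b)" using f(3) that(2) B(4) by simp
    also have "\<dots> = (\<Sum>b\<in>B. f b x * g b)" using that(1) by (simp add: linear_sum linear_cmul)
    also have "\<dots> = (\<Sum>b\<in>B1. f b x * g b) + (\<Sum>b\<in>B2. f b x * g b)"
      unfolding B2(3) using B1(1) B2 by (intro sum.union_disjoint)
    finally show ?thesis .
  qed
  define D where "D x = br x v" for x
  have DV: "D x \<in> V" if "x \<in> V" for x using VD(3) that v(1) by (simp add: D_def)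
  \<comment> \<open>Since D = - ad v, this is the Cartan formula: the Lie derivative of d\<xi> along
    v is d \<iota>_v d\<xi> = d\<xi>.\<close>
  have conf: "?\<omega> (D x) w + ?\<omega> x (D w) = ?\<omega> x w" if "x \<in> V" "w \<in> V" for x w
  proof -
    have a: "br v (br x w) = - br (D x) w - br x (D w)"
      using br_leibniz[of v x w] br_skew[of v x] br_skew[of v w] by (simp add: D_def)
    have b: "\<xi> (br x w) = - \<xi> (br v (br x w))"
      using v(2)[OF VD(3)[OF that]] by (simp add: dform_def)
    have "\<xi> (- br (D x) w - br x (D w)) = - \<xi> (br (D x) w) - \<xi> (br x (D w))"
      using linear_diff[OF \<xi>(1)] linear_neg[OF \<xi>(1)] by simp
    then show ?thesis
      using b unfolding dform_def a by linarith
  qed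
  have linD: "linear (\<lambda>x. ?\<omega> b (D x))" for b
    using \<xi>(1) unfolding dform_def D_def by (intro linearI) (simp_all add: linear_add linear_cmul)
  \<comment> \<open>\<open>c1\<close> and \<open>c2\<close> evaluate one double sum by rows and by
    columns. The result relates the trace of D on the quotient to the corresponding sum with D
    applied to the dual vectors, and \<open>conf\<close> compares the two once more.\<close>
  have c1: "?\<omega> b (D (d b)) = (\<Sum>c\<in>B2. ?\<omega> (d c) (d b) * ?\<omega> b (D c))" if b: "b \<in> B2" for b
  proof -
    have "?\<omega> b (D c) = 0" if "c \<in> B1" for c
    proof -
      have "c \<in> ?S" using that B1(3) span_base by blast
      then have "D c = c" using stab by (simp add: D_def)
      then show ?thesis using S0[OF that] b B2(2) by auto
    qed
    then show ?thesis
      using expand[OF linD d(1)[OF b], of b] d b by simp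
  qed
  have c2: "(\<Sum>b\<in>B2. ?\<omega> (d c) (d b) * ?\<omega> b (D c)) = - ?\<omega> (d c) (D c)" if c: "c \<in> B2" for c
  proof -
    let ?g = "\<lambda>x. ?\<omega> x (D c)"
    have "linear ?g"
      using \<xi>(1) unfolding dform_def by (intro linearI) (simp_all add: linear_add linear_cmul)
    moreover have "?g b = 0" if "b \<in> B1" for b
      using S0[OF that DV] c B2(2) dform_skew[OF \<xi>(1), of b "D c"] by auto
    ultimately have "?g (d c) = (\<Sum>b\<in>B2. f b (d c) * ?g b)"
      using expand[of ?g "d c"] d(1)[OF c] by simp
    also have "\<dots> = (\<Sum>b\<in>B2. - (?\<omega> (d c) (d b) * ?\<omega> b (D c)))"
    proof (rule sum.cong)
      fix b assume "b \<in> B2"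
      then show "f b (d c) * ?g b = - (?\<omega> (d c) (d b) * ?\<omega> b (D c))"
        using d c dform_skew[OF \<xi>(1), of "d b" "d c"] by simp
    qed simp
    finally show ?thesis by (simp add: sum_negf)
  qed
  have "(\<Sum>b\<in>B2. ?\<omega> b (D (d b))) = (\<Sum>c\<in>B2. \<Sum>b\<in>B2. ?\<omega> (d c) (d b) * ?\<omega> b (D c))"
    by (subst sum.swap) (rule sum.cong[OF refl c1])
  also have "\<dots> = - (\<Sum>c\<in>B2. ?\<omega> (d c) (D c))"
    using c2 by (simp add: sum_negf)
  finally have swap: "(\<Sum>b\<in>B2. ?\<omega> b (D (d b))) = - (\<Sum>c\<in>B2. ?\<omega> (d c) (D c))" .
  have "?\<omega> (d b) (D b) = 1 + ?\<omega> b (D (d b))" if b: "b \<in> B2" for b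
  proof -
    have "?\<omega> (d b) b = 1" using d(2)[OF b, of b] f(2)[of b b] b B2 by auto
    then show ?thesis
      using conf[of "d b" b] dform_skew[OF \<xi>(1), of "D (d b)" b] d(1)[OF b] b B2(2) by auto
  qed
  then have "(\<Sum>b\<in>B2. ?\<omega> (d b) (D b)) = card B2 + (\<Sum>b\<in>B2. ?\<omega> b (D (d b)))"
    by (simp add: sum.distrib)
  then have half: "2 * (\<Sum>b\<in>B2. f b (D b)) = card B2"
    using swap d(2) DV B2(2) by (simp add: subset_iff)
  have "(\<Sum>b\<in>B1. f b (D b)) = (\<Sum>b\<in>B1. 1)"
  proof (rule sum.cong)
    fix b assume b: "b \<in> B1"
    then have "b \<in> ?S" using B1(3) span_base by blast
    then show "f b (D b) = 1" using stab f(2)[of b b] b B(1) by (auto simp: D_def)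
  qed simp
  moreover have "(\<Sum>b\<in>B. f b (D b)) = 0"
    unfolding D_def using f(3) B(4) by (intro trace_perfect_eq_0[OF V B(2,4) f(1) _ perfect v(1)]) simp
  moreover have "(\<Sum>b\<in>B. f b (D b)) = (\<Sum>b\<in>B1. f b (D b)) + (\<Sum>b\<in>B2. f b (D b))"
    unfolding B2(3) using B1(1) B2 by (intro sum.union_disjoint)
  ultimately have "2 * real (card B1) + real (card B2) = 0"
    using half by simp
  then have "card B1 = 0" "card B2 = 0" by linarith+
  then have "B = {}" using B1(1) B2 by simp
  then show False
    using B(4) \<xi> linear_0[OF \<xi>(1)] by auto
qed

text \<open>Suppose (d\<xi>)^(k+1) is nonzero. Contracting \<xi> \<and> (d\<xi>)^(k+1) = 0 with the
  radical shows that \<xi> vanishes there, so \<xi> = \<iota>_v d\<xi>. The first-order height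
  identity in a direction \<eta>, contracted with y in the radical and then with v, gives
  \<eta>([y, v]) = \<eta>(y).\<close>

lemma pow2_Suc_eq_0:
  assumes V: "subalgebra V"
    and perfect: "span {br x y | x y. x \<in> V \<and> y \<in> V} = V"
    and nz: "\<And>\<xi>. linear \<xi> \<Longrightarrow> \<exists>x\<in>V. \<xi> x \<noteq> 0 \<Longrightarrow> \<exists>X. set X \<subseteq> V \<and> wedge1 \<xi> (pow2 (dform \<xi>) k) X \<noteq> 0"
    and zero: "\<And>\<xi> X. linear \<xi> \<Longrightarrow> set X \<subseteq> V \<Longrightarrow> wedge1 \<xi> (pow2 (dform \<xi>) (Suc k)) X = 0"
    and \<xi>: "linear \<xi>" and X0: "set X0 \<subseteq> V"
  shows "pow2 (dform \<xi>) (Suc k) X0 = 0"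
proof (rule ccontr)
  assume ne: "pow2 (dform \<xi>) (Suc k) X0 \<noteq> 0"
  note VD = subalgebraD[OF V]
  let ?\<omega> = "dform \<xi>"
  have \<xi>nz: "\<exists>x\<in>V. \<xi> x \<noteq> 0"
  proof (rule ccontr)
    assume "\<not> (\<exists>x\<in>V. \<xi> x \<noteq> 0)"
    then have "?\<omega> x y = 0" if "x \<in> V" "y \<in> V" for x y
      using VD(3) that by (simp add: dform_def)
    then show False using pow2_Suc_zero_on[of V ?\<omega> X0 k] X0 ne by blast
  qed
  have kill: "pow2 ?\<omega> m (y # Z) = 0" if "y \<in> stabiliser V \<xi>" "set Z \<subseteq> V" for m y Z
    using that by (intro pow2_Cons_zero_on[of V]) (auto simp: stabiliser_iff)
  have \<xi>S: "\<xi> y = 0" if y: "y \<in> stabiliser V \<xi>" for y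
  proof -
    have "wedge1 \<xi> (\<lambda>Z. pow2 ?\<omega> (Suc k) (y # Z)) X0 = 0"
      using kill[OF y] X0 by (rule wedge1_zero_on)
    then show ?thesis
      using zero[OF \<xi>, of "y # X0"] y X0 ne by (simp add: stabiliser_def del: pow2.simps)
  qed
  obtain v where v: "v \<in> V" "\<And>x. x \<in> V \<Longrightarrow> \<xi> x = ?\<omega> v x"
    using functional_vanishing_on_stabiliser[OF V \<xi> \<xi> \<xi>S] by metis
  have "\<xi> v = 0" using v(2)[OF v(1)] \<xi> by (simp add: dform_def linear_0)
  obtain X where X: "set X \<subseteq> V" "wedge1 \<xi> (pow2 ?\<omega> k) X \<noteq> 0"
    using nz[OF \<xi> \<xi>nz] by blast
  have "br y v = y" if y: "y \<in> stabiliser V \<xi>" for y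
  proof (rule ccontr)
    assume "br y v \<noteq> y"
    then have "br y v - y \<notin> {0}" by simp
    then obtain \<eta> :: "'a \<Rightarrow> real" where \<eta>: "linear \<eta>" "\<eta> (br y v - y) = 1"
      using separating_functional[OF subspace_single_0] by blast
    have yV: "y \<in> V" using y by (simp add: stabiliser_def)
    define \<zeta> where "\<zeta> t z = \<xi> z + t * \<eta> z" for t z
    define \<beta> where "\<beta> = dform \<eta> y"
    have lin: "linear (\<zeta> t)" for t
      unfolding \<zeta>_def using \<xi> \<eta>(1) by (intro linearI) (simp_all add: linear_add linear_cmul algebra_simps)
    have \<zeta>y: "dform (\<zeta> t) y z = t * \<beta> z" if "z \<in> V" for t z
      using y that by (simp add: \<zeta>_def \<beta>_def dform_def stabiliser_def algebra_simps)
    have lim1: "((\<lambda>t. \<zeta> t z) \<longlongrightarrow> \<xi> z) (at 0)" for z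
      unfolding \<zeta>_def by (auto intro!: tendsto_eq_intros)
    have lim2: "((\<lambda>t. dform (\<zeta> t) u z) \<longlongrightarrow> ?\<omega> u z) (at 0)" for u z
      unfolding dform_def by (intro tendsto_minus lim1)
    \<comment> \<open>The part of first order in t of the height identity for \<xi> + t \<eta>,
      contracted with \<open>y\<close>. There is no part of order zero, because \<xi>(y) = 0 and
      \<iota>_y d\<xi> = 0.\<close>
    have *: "\<eta> y * pow2 ?\<omega> (Suc k) Z - real (Suc k) * wedge1 \<xi> (wedge1 \<beta> (pow2 ?\<omega> k)) Z = 0"
      if Z: "set Z \<subseteq> V" for Z
    proof (rule tendsto_zero_at_0)
      let ?p = "\<lambda>t. pow2 (dform (\<zeta> t))"
      show "((\<lambda>t. \<eta> y * ?p t (Suc k) Z - real (Suc k) * wedge1 (\<zeta> t) (wedge1 \<beta> (?p t k)) Z) \<longlongrightarrow>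
        \<eta> y * pow2 ?\<omega> (Suc k) Z - real (Suc k) * wedge1 \<xi> (wedge1 \<beta> (pow2 ?\<omega> k)) Z) (at 0)"
        by (intro tendsto_diff tendsto_mult tendsto_wedge1 tendsto_pow2 lim1 lim2 tendsto_const)
      fix t :: real assume t: "t \<noteq> 0"
      have "wedge1 (\<zeta> t) (\<lambda>Z. ?p t (Suc k) (y # Z)) Z =
          wedge1 (\<zeta> t) (\<lambda>Z. (real (Suc k) * t) * wedge1 \<beta> (?p t k) Z) Z"
      proof (rule wedge1_cong[of V])
        fix Y assume "set Y \<subseteq> V"
        then have "wedge1 (dform (\<zeta> t) y) (?p t k) Y = wedge1 (\<lambda>z. t * \<beta> z) (?p t k) Y"
          using \<zeta>y by (intro wedge1_cong[of V]) auto
        then show "?p t (Suc k) (y # Y) = (real (Suc k) * t) * wedge1 \<beta> (?p t k) Y"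
          unfolding pow2_Suc_Cons by (simp add: wedge1_scale_left)
      qed (use Z in auto)
      also have "\<dots> = (real (Suc k) * t) * wedge1 (\<zeta> t) (wedge1 \<beta> (?p t k)) Z"
        by (rule wedge1_scale)
      finally have "\<zeta> t y * ?p t (Suc k) Z - (real (Suc k) * t) * wedge1 (\<zeta> t) (wedge1 \<beta> (?p t k)) Z = 0"
        using zero[OF lin, of "y # Z" t] yV Z by (simp del: pow2.simps)
      moreover have "\<zeta> t y = t * \<eta> y" using \<xi>S[OF y] by (simp add: \<zeta>_def)
      ultimately have "t * (\<eta> y * ?p t (Suc k) Z - real (Suc k) * wedge1 (\<zeta> t) (wedge1 \<beta> (?p t k)) Z) = 0"
        by (simp add: algebra_simps del: pow2.simps of_nat_Suc)
      then show "\<eta> y * ?p t (Suc k) Z - real (Suc k) * wedge1 (\<zeta> t) (wedge1 \<beta> (?p t k)) Z = 0"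
        using t by (simp del: pow2.simps)
    qed
    have \<omega>v: "wedge1 (?\<omega> v) (pow2 ?\<omega> m) Z = wedge1 \<xi> (pow2 ?\<omega> m) Z" if "set Z \<subseteq> V" for m Z
      using v that by (intro wedge1_cong[of V]) auto
    \<comment> \<open>Contracting (d\<xi>)^k with \<open>v\<close> creates a second factor \<xi>, so
      the product vanishes.\<close>
    have twice: "wedge1 \<xi> (wedge1 \<beta> (\<lambda>Z. pow2 ?\<omega> k (v # Z))) X = 0"
    proof (cases k)
      case 0
      have "wedge1 \<beta> (\<lambda>Z. 0) = (\<lambda>Z. 0 :: real)" by (rule ext) (rule wedge1_zero)
      then show ?thesis by (simp add: 0 wedge1_zero)
    next
      case (Suc m)
      have "wedge1 \<xi> (wedge1 \<beta> (\<lambda>Z. pow2 ?\<omega> k (v # Z))) X =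
          - wedge1 \<beta> (wedge1 \<xi> (\<lambda>Z. pow2 ?\<omega> (Suc m) (v # Z))) X"
        unfolding Suc by (rule wedge1_wedge1)
      also have "wedge1 \<beta> (wedge1 \<xi> (\<lambda>Z. pow2 ?\<omega> (Suc m) (v # Z))) X = 0"
      proof (rule wedge1_zero_on[of V])
        fix Z assume Z: "set Z \<subseteq> V"
        have "wedge1 \<xi> (\<lambda>Z. pow2 ?\<omega> (Suc m) (v # Z)) Z =
            wedge1 \<xi> (\<lambda>Z. real (Suc m) * wedge1 \<xi> (pow2 ?\<omega> m) Z) Z"
          using Z by (intro wedge1_cong[of V]) (simp_all add: pow2_Suc_Cons \<omega>v del: pow2.simps)
        then show "wedge1 \<xi> (\<lambda>Z. pow2 ?\<omega> (Suc m) (v # Z)) Z = 0"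
          by (simp add: wedge1_scale wedge1_self del: pow2.simps)
      qed (rule X)
      finally show ?thesis by simp
    qed
    have "wedge1 \<xi> (wedge1 \<beta> (pow2 ?\<omega> k)) (v # X) = - \<beta> v * wedge1 \<xi> (pow2 ?\<omega> k) X"
      using \<open>\<xi> v = 0\<close> twice by (simp add: wedge1_diff wedge1_scale)
    moreover have "pow2 ?\<omega> (Suc k) (v # X) = real (Suc k) * wedge1 \<xi> (pow2 ?\<omega> k) X"
      unfolding pow2_Suc_Cons \<omega>v[OF X(1)] ..
    ultimately have "\<eta> y * (real (Suc k) * wedge1 \<xi> (pow2 ?\<omega> k) X) -
        real (Suc k) * (- \<beta> v * wedge1 \<xi> (pow2 ?\<omega> k) X) = 0"
      using *[of "v # X"] v(1) X(1) by (simp del: pow2.simps wedge1.simps of_nat_Suc)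
    then have "(real (Suc k) * wedge1 \<xi> (pow2 ?\<omega> k) X) * (\<eta> y + \<beta> v) = 0"
      by (simp add: algebra_simps del: of_nat_Suc)
    then have "\<eta> y + \<beta> v = 0" using X(2) by simp
    then show False
      using \<eta> by (simp add: \<beta>_def dform_def linear_diff)
  qed
  then show False
    using trace_Liouville[OF V \<xi> \<xi>nz v _ perfect] by blast
qed

end

section \<open>Eigenvectors in the complexification\<close>

text \<open>The pair \<open>(x, y)\<close> represents \<open>x + \<i> y\<close> in the complexification.\<close>

definition csc :: "complex \<Rightarrow> 'a::real_vector \<times> 'a \<Rightarrow> 'a \<times> 'a" where
  "csc z v = (Re z *\<^sub>R fst v - Im z *\<^sub>R snd v, Re z *\<^sub>R snd v + Im z *\<^sub>R fst v)"

interpretation cplx: vector_space csc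
  by standard (auto simp: csc_def prod_eq_iff algebra_simps)

lemma csc_of_real: "csc (of_real r) v = r *\<^sub>R v"
  by (simp add: csc_def prod_eq_iff)

lemma csc_mem: "subspace M \<Longrightarrow> v \<in> M \<times> M \<Longrightarrow> csc z v \<in> M \<times> M"
  by (auto simp: csc_def intro!: subspace_diff subspace_add subspace_scale)

lemma linear_map_prod_csc:
  assumes "linear f"
  shows "map_prod f f (csc z v) = csc z (map_prod f f v)"
  using linear_add[OF assms] linear_diff[OF assms] linear_cmul[OF assms]
  by (cases v) (simp add: csc_def)

lemma linear_map_prod_add:
  assumes "linear f"
  shows "map_prod f f (v + w) = map_prod f f v + map_prod f f w"
  using linear_add[OF assms] by (cases v, cases w) simp

lemma linear_map_prod_diff:
  assumes "linear f"
  shows "map_prod f f (v - w) = map_prod f f v - map_prod f f w"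
  using linear_diff[OF assms] by (cases v, cases w) simp

lemma linear_map_prod_0: "linear f \<Longrightarrow> map_prod f f 0 = 0"
  using linear_0[of f] by (simp add: zero_prod_def)

section \<open>Polynomials in a complexified operator\<close>

text \<open>The vector p(f) v, computed by Horner's scheme.\<close>

definition papply :: "('a \<Rightarrow> 'a::real_vector) \<Rightarrow> complex poly \<Rightarrow> 'a \<times> 'a \<Rightarrow> 'a \<times> 'a" where
  "papply f p v = fold_coeffs (\<lambda>a w. csc a v + map_prod f f w) p 0"

definition char_op :: "('a \<Rightarrow> 'a::real_vector) \<Rightarrow> complex \<Rightarrow> 'a \<times> 'a \<Rightarrow> 'a \<times> 'a" where
  "char_op f z v = map_prod f f v - csc z v"

context
  fixes f :: "'a::real_vector \<Rightarrow> 'a"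
  assumes f: "linear f"
begin

lemmas f_simps = linear_map_prod_csc[OF f] linear_map_prod_add[OF f] linear_map_prod_diff[OF f] linear_map_prod_0[OF f]

lemma papply_0 [simp]: "papply f 0 v = 0"
  by (simp add: papply_def)

lemma papply_pCons: "papply f (pCons a p) v = csc a v + map_prod f f (papply f p v)"
  by (cases "p = 0 \<and> a = 0")
    (auto simp: papply_def f_simps fold_coeffs_pCons_not_0_0_eq fold_coeffs_pCons_coeff_not_0_eq)

lemma papply_add: "papply f (p + q) v = papply f p v + papply f q v"
  by (induction p q rule: poly_induct2) (simp_all add: papply_pCons f_simps cplx.scale_left_distrib)

lemma papply_smult: "papply f (smult c p) v = csc c (papply f p v)"
  by (induction p) (simp_all add: papply_pCons f_simps cplx.scale_right_distrib)

lemma papply_char_op: "papply f ([:- z, 1:] * q) v = papply f q (char_op f z v)"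
proof -
  have *: "papply f q (char_op f z v) = map_prod f f (papply f q v) - csc z (papply f q v)"
  proof (induction q)
    case (pCons a q)
    then show ?case
      by (simp add: papply_pCons f_simps char_op_def cplx.scale_right_distrib cplx.scale_right_diff_distrib
          mult.commute)
  qed (simp add: f_simps)
  have "papply f ([:- z, 1:] * q) v = papply f (smult (- z) q + pCons 0 q) v"
    by simp
  also have "\<dots> = map_prod f f (papply f q v) - csc z (papply f q v)"
    unfolding papply_add papply_smult papply_pCons by simp
  finally show ?thesis using * by simp
qed

text \<open>Over the complex numbers p splits, so p(f) is, up to a nonzero scalar, a composite of
  operators f - z. Each root found lets one factor act on \<open>v\<close> and lowers the
  degree.\<close>

lemma papply_eq_0_imp_char_ops:
  assumes "p \<noteq> 0" "papply f p v = 0"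
  shows "\<exists>zs. foldr (char_op f) zs v = 0"
  using assms
proof (induction "degree p" arbitrary: p v)
  case 0
  then obtain a where "p = [:a:]" "a \<noteq> 0"
    by (metis degree_eq_zeroE pCons_0_0)
  then have "v = 0" using 0 by (simp add: papply_pCons f_simps)
  then show ?case by (intro exI[of _ "[]"]) simp
next
  case (Suc n)
  have "\<not> constant (poly p)"
    using Suc.hyps(2) by (simp add: constant_degree)
  then obtain z where "poly p z = 0"
    using fundamental_theorem_of_algebra by blast
  then obtain q where q: "p = [:- z, 1:] * q"
    by (metis dvdE poly_eq_0_iff_dvd)
  then have "q \<noteq> 0" using Suc.prems by auto
  moreover have "n = degree q"
    using Suc.hyps(2) q degree_mult_eq[of "[:- z, 1:]" q] \<open>q \<noteq> 0\<close> by simp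
  moreover have "papply f q (char_op f z v) = 0"
    using Suc.prems(2) unfolding q papply_char_op .
  ultimately obtain zs where "foldr (char_op f) zs (char_op f z v) = 0"
    using Suc.hyps(1) by blast
  then show ?case by (intro exI[of _ "zs @ [z]"]) simp
qed

lemma char_op_add: "char_op f z (v + w) = char_op f z v + char_op f z w"
  by (simp add: char_op_def f_simps cplx.scale_right_distrib)

lemma char_op_csc: "char_op f z (csc a v) = csc a (char_op f z v)"
  by (simp add: char_op_def f_simps cplx.scale_right_diff_distrib mult.commute)

lemma char_op_0: "char_op f z 0 = 0"
  by (simp add: char_op_def f_simps)

lemma char_op_commute: "char_op f z (char_op f y v) = char_op f y (char_op f z v)"
  by (simp add: char_op_def f_simps cplx.scale_right_diff_distrib mult.commute)

lemma char_ops_add: "foldr (char_op f) zs (v + w) = foldr (char_op f) zs v + foldr (char_op f) zs w"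
  by (induction zs) (simp_all add: char_op_add)

lemma char_ops_csc: "foldr (char_op f) zs (csc a v) = csc a (foldr (char_op f) zs v)"
  by (induction zs) (simp_all add: char_op_csc)

lemma char_ops_0: "foldr (char_op f) zs 0 = 0"
  by (induction zs) (simp_all add: char_op_0)

lemma char_ops_commute1: "foldr (char_op f) zs (char_op f y v) = char_op f y (foldr (char_op f) zs v)"
proof (induction zs)
  case (Cons z zs)
  then show ?case using char_op_commute by simp
qed simp

lemma char_ops_commute:
  "foldr (char_op f) zs (foldr (char_op f) ys v) = foldr (char_op f) ys (foldr (char_op f) zs v)"
  by (induction ys) (simp_all add: char_ops_commute1)

lemma papply_monom_real: "papply f (monom 1 n) (x, 0) = ((f ^^ n) x, 0)"
proof (induction n)
  case 0
  then show ?case by (simp add: monom_0 papply_pCons f_simps csc_def linear_0[OF f])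
next
  case (Suc n)
  then show ?case by (simp add: monom_Suc papply_pCons linear_0[OF f])
qed

lemma span_orbit_papply:
  assumes "y \<in> span ((\<lambda>i. (f ^^ i) x) ` {..<n})"
  shows "\<exists>p. (\<forall>i\<ge>n. coeff p i = 0) \<and> papply f p (x, 0) = (y, 0)"
  using assms
proof (induction rule: span_induct_alt)
  case base
  show ?case by (intro exI[of _ 0]) (simp add: zero_prod_def)
next
  case (step c b y)
  then obtain i p where i: "i < n" "b = (f ^^ i) x" and p: "\<forall>i\<ge>n. coeff p i = 0" "papply f p (x, 0) = (y, 0)"
    by blast
  have "papply f (smult (of_real c) (monom 1 i) + p) (x, 0) = (c *\<^sub>R b + y, 0)"
    unfolding papply_add papply_smult papply_monom_real p csc_of_real i by simp
  moreover have "\<forall>j\<ge>n. coeff (smult (of_real c) (monom 1 i) + p) j = 0"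
    using p i(1) by simp
  ultimately show ?case by blast
qed

text \<open>The orbit of \<open>x\<close> under f is linearly dependent. The relation has the form
  f^n x = p(f) x with p of degree below n, so the resulting polynomial has n-th coefficient 1 and is
  nonzero.\<close>

lemma exists_papply_eq_0:
  assumes "fin_dim M" "f ` M \<subseteq> M" "x \<in> M"
  shows "\<exists>p. p \<noteq> 0 \<and> papply f p (x, 0) = 0"
proof -
  let ?S = "\<lambda>n. (\<lambda>i. (f ^^ i) x) ` {..<n}"
  obtain T where T: "finite T" "M \<subseteq> span T"
    using assms(1) unfolding fin_dim_def by blast
  have M: "(f ^^ i) x \<in> M" for i
    using assms(2,3) by (induction i) auto
  have "\<exists>n. (f ^^ n) x \<in> span (?S n)"
  proof (rule ccontr)
    assume "\<not> (\<exists>n. (f ^^ n) x \<in> span (?S n))"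
    then have nin: "(f ^^ n) x \<notin> span (?S n)" for n by blast
    have "independent (?S n) \<and> card (?S n) = n" for n
    proof (induction n)
      case (Suc n)
      have "(f ^^ n) x \<notin> ?S n"
        by (rule contra_subsetD[OF span_superset nin])
      then show ?case
        using Suc nin[of n] by (simp add: lessThan_Suc independent_insertI)
    qed (simp add: independent_empty)
    then have "independent (?S (Suc (card T)))" "card (?S (Suc (card T))) = Suc (card T)" by simp_all
    moreover have "?S (Suc (card T)) \<subseteq> span T" using M T(2) by blast
    ultimately show False using independent_span_bound[OF T(1), of "?S (Suc (card T))"] by simp
  qed
  then obtain n where "(f ^^ n) x \<in> span (?S n)" by blast
  then obtain p where p: "\<forall>i\<ge>n. coeff p i = 0" "papply f p (x, 0) = ((f ^^ n) x, 0)"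
    using span_orbit_papply by blast
  have "papply f (monom 1 n + smult (- 1) p) (x, 0) = 0"
    unfolding papply_add papply_smult p papply_monom_real by (simp add: csc_def prod_eq_iff)
  moreover have "coeff (monom 1 n + smult (- 1) p) n = 1" using p(1) by simp
  then have "monom 1 n + smult (- 1) p \<noteq> 0" by (metis coeff_0 zero_neq_one)
  ultimately show ?thesis by blast
qed

text \<open>A stand-in for the characteristic polynomial: the operators f - z commute, so the lists
  annihilating the single basis vectors can be concatenated.\<close>

lemma exists_char_ops_eq_0:
  assumes "fin_dim M" "f ` M \<subseteq> M"
  obtains zs where "\<And>v. v \<in> M \<times> M \<Longrightarrow> foldr (char_op f) zs v = 0"
proof -
  obtain B where B: "B \<subseteq> M" "independent B" "M \<subseteq> span B"
    using maximal_independent_subset by blast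
  obtain T where T: "finite T" "M \<subseteq> span T"
    using assms(1) unfolding fin_dim_def by blast
  have "finite B" using independent_span_bound[OF T(1) B(2)] B(1) T(2) by blast
  then have "\<exists>zs. \<forall>b\<in>B. foldr (char_op f) zs (b, 0) = 0"
    using B(1)
  proof (induction B rule: finite_induct)
    case (insert b B)
    then obtain zs where zs: "\<forall>b\<in>B. foldr (char_op f) zs (b, 0) = 0" by blast
    have "b \<in> M" using insert.prems by simp
    then obtain p where p: "p \<noteq> 0" "papply f p (b, 0) = 0"
      using exists_papply_eq_0[OF assms] by blast
    obtain ys where ys: "foldr (char_op f) ys (b, 0) = 0"
      using papply_eq_0_imp_char_ops[OF p] ..
    have "foldr (char_op f) (zs @ ys) (c, 0) = 0" if "c \<in> insert b B" for c
    proof (cases "c = b")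
      case True
      then show ?thesis using ys by (simp add: char_ops_0)
    next
      case False
      then have "foldr (char_op f) zs (c, 0) = 0" using that zs by blast
      then show ?thesis
        unfolding foldr_append o_apply char_ops_commute[of zs] by (simp add: char_ops_0)
    qed
    then show ?case by blast
  qed simp
  then obtain zs where zs: "\<And>b. b \<in> B \<Longrightarrow> foldr (char_op f) zs (b, 0) = 0" by blast
  have *: "foldr (char_op f) zs (x, 0) = 0" if "x \<in> M" for x
  proof -
    have "x \<in> span B" using B(3) that by blast
    then show ?thesis
    proof (induction rule: span_induct_alt)
      case base
      show ?case using char_ops_0 by (simp add: zero_prod_def)
    next
      case (step c b y)
      have "(c *\<^sub>R b + y, 0) = csc (of_real c) (b, 0) + (y, 0)" by (simp add: csc_of_real)
      then show ?case using step zs by (simp only: char_ops_add char_ops_csc) simp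
    qed
  qed
  have "foldr (char_op f) zs v = 0" if v: "v \<in> M \<times> M" for v
  proof -
    have "v = (fst v, 0) + csc \<i> (snd v, 0)" by (simp add: csc_def prod_eq_iff)
    moreover have "foldr (char_op f) zs ((fst v, 0) + csc \<i> (snd v, 0)) = 0"
      unfolding char_ops_add char_ops_csc using v by (auto simp: *)
    ultimately show ?thesis by simp
  qed
  then show ?thesis using that by blast
qed

text \<open>The factors f - z, applied one after another, bring \<open>v\<close> into
  \<open>S\<close>; the last vector still outside \<open>S\<close> is an eigenvector modulo
  \<open>S\<close>. For \<open>S = {0}\<close> it is an eigenvector, and with larger
  \<open>S\<close> the lemma will show that the image of ad x is small.\<close>

lemma exists_eigenvector_mod:
  assumes "v \<in> P" "v \<notin> S" "foldr (char_op f) zs v \<in> S"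
    and "\<And>z w. w \<in> P \<Longrightarrow> char_op f z w \<in> P"
  shows "\<exists>z w. w \<in> P \<and> w \<notin> S \<and> char_op f z w \<in> S"
  using assms(3)
proof (induction zs)
  case Nil
  then show ?case using assms(2) by simp
next
  case (Cons z zs)
  have "foldr (char_op f) zs v \<in> P"
    using assms(1,4) by (induction zs) auto
  moreover have "char_op f z (foldr (char_op f) zs v) \<in> S" using Cons.prems by simp
  ultimately show ?case using Cons.IH by blast
qed

text \<open>On an eigenvector for \<open>z\<close> the factor f - y acts as the scalar z - y, so a
  product of such factors can vanish only if z is among the y. Hence there are finitely many
  eigenvalues.\<close>

lemma eigenvalue_in_roots:
  assumes "map_prod f f w = csc z w" "w \<noteq> 0" "foldr (char_op f) zs w = 0"
  shows "z \<in> set zs"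
proof (rule ccontr)
  assume "z \<notin> set zs"
  then have "\<exists>c. c \<noteq> 0 \<and> foldr (char_op f) zs w = csc c w"
  proof (induction zs)
    case Nil
    show ?case by (intro exI[of _ 1]) simp
  next
    case (Cons y zs)
    then obtain c where c: "c \<noteq> 0" "foldr (char_op f) zs w = csc c w" by auto
    have "foldr (char_op f) (y # zs) w = csc (c * (z - y)) w"
      using c by (simp add: char_op_def f_simps assms(1) cplx.scale_left_diff_distrib algebra_simps)
    then show ?case using Cons.prems c by (intro exI[of _ "c * (z - y)"]) auto
  qed
  then show False using assms(2,3) by auto
qed

end

section \<open>Stably contact algebras\<close>

definition ccnj :: "'a::real_vector \<times> 'a \<Rightarrow> 'a \<times> 'a" where
  "ccnj v = (fst v, - snd v)"

lemma ccnj_csc: "ccnj (csc z v) = csc (cnj z) (ccnj v)"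
  by (simp add: ccnj_def csc_def prod_eq_iff)

lemma ccnj_add: "ccnj (v + w) = ccnj v + ccnj w"
  by (simp add: ccnj_def prod_eq_iff)

lemma ccnj_ccnj [simp]: "ccnj (ccnj v) = v"
  by (simp add: ccnj_def)

lemma ccnj_eq_0_iff [simp]: "ccnj v = 0 \<longleftrightarrow> v = 0"
  by (simp add: ccnj_def prod_eq_iff)

lemma ccnj_mem: "subspace M \<Longrightarrow> v \<in> M \<times> M \<Longrightarrow> ccnj v \<in> M \<times> M"
  by (auto simp: ccnj_def subspace_neg)

lemma char_op_mem:
  assumes "subspace M" "f ` M \<subseteq> M" "v \<in> M \<times> M"
  shows "char_op f z v \<in> M \<times> M"
  using assms unfolding char_op_def csc_def
  by (cases v) (auto intro!: subspace_diff subspace_add subspace_scale)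

lemma csc_imaginary: "csc (- 2 * \<i> * a) (csc (\<i> * b) v) = csc (2 * a * b) v"
proof -
  have "(- 2 * \<i> * a) * (\<i> * b) = 2 * a * b"
    by (simp add: complex_eq_iff algebra_simps)
  then show ?thesis by (simp only: cplx.scale_scale)
qed

context lie_bracket
begin

definition cbr :: "'a \<times> 'a \<Rightarrow> 'a \<times> 'a \<Rightarrow> 'a \<times> 'a" where
  "cbr v w = (br (fst v) (fst w) - br (snd v) (snd w), br (fst v) (snd w) + br (snd v) (fst w))"

lemma cbr_add: "cbr (u + v) w = cbr u w + cbr v w" "cbr w (u + v) = cbr w u + cbr w v"
  by (simp_all add: cbr_def prod_eq_iff)

lemma cbr_diff: "cbr (u - v) w = cbr u w - cbr v w" "cbr w (u - v) = cbr w u - cbr w v"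
  by (simp_all add: cbr_def prod_eq_iff)

lemma cbr_minus [simp]: "cbr (- v) w = - cbr v w" "cbr w (- v) = - cbr w v"
  by (simp_all add: cbr_def prod_eq_iff)

lemma cbr_csc: "cbr (csc z v) w = csc z (cbr v w)" "cbr v (csc z w) = csc z (cbr v w)"
  by (simp_all add: cbr_def csc_def prod_eq_iff algebra_simps)

lemma cbr_0 [simp]: "cbr 0 w = 0" "cbr w 0 = 0"
  by (simp_all add: cbr_def prod_eq_iff)

lemma cbr_real: "cbr (x, 0) v = map_prod (br x) (br x) v"
  by (cases v) (simp add: cbr_def)

lemma cbr_skew: "cbr w v = - cbr v w"
  using br_skew[of "fst v" "fst w"] br_skew[of "snd v" "snd w"] br_skew[of "fst v" "snd w"] br_skew[of "snd v" "fst w"]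
  by (simp add: cbr_def prod_eq_iff)

lemma cbr_self [simp]: "cbr v v = 0"
  using br_skew[of "fst v" "snd v"] by (simp add: cbr_def prod_eq_iff)

lemma cbr_leibniz: "cbr u (cbr v w) = cbr (cbr u v) w + cbr v (cbr u w)"
proof -
  obtain u1 u2 v1 v2 w1 w2 where "u = (u1, u2)" "v = (v1, v2)" "w = (w1, w2)"
    by (metis surj_pair)
  then show ?thesis
    using br_leibniz[of u1 v1 w1] br_leibniz[of u1 v1 w2] br_leibniz[of u1 v2 w1] br_leibniz[of u1 v2 w2]
      br_leibniz[of u2 v1 w1] br_leibniz[of u2 v1 w2] br_leibniz[of u2 v2 w1] br_leibniz[of u2 v2 w2]
    by (simp add: cbr_def)
qed

lemma ccnj_cbr: "ccnj (cbr v w) = cbr (ccnj v) (ccnj w)"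
  by (simp add: cbr_def ccnj_def prod_eq_iff)

lemma char_op_eq_0_iff: "char_op (br x) z v = 0 \<longleftrightarrow> cbr (x, 0) v = csc z v"
  by (simp add: char_op_def cbr_real)

lemma weight_add:
  assumes "cbr (x, 0) u = csc a u" "cbr (x, 0) v = csc b v"
  shows "cbr (x, 0) (cbr u v) = csc (a + b) (cbr u v)"
  by (simp add: cbr_leibniz[of "(x, 0)"] assms cbr_csc cplx.scale_left_distrib)

lemma weight_cnj:
  assumes "cbr (x, 0) u = csc a u"
  shows "cbr (x, 0) (ccnj u) = csc (cnj a) (ccnj u)"
  using arg_cong[OF assms, of ccnj] by (simp add: ccnj_cbr ccnj_csc) (simp add: ccnj_def)

section \<open>Algebras in which noncentral centralisers are abelian\<close>

definition centre :: "'a set \<Rightarrow> 'a set" where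
  "centre V = {z \<in> V. \<forall>y\<in>V. br z y = 0}"

definition so3_triple :: "'a \<Rightarrow> 'a \<Rightarrow> 'a \<Rightarrow> bool" where
  "so3_triple e1 e2 e3 \<longleftrightarrow> e1 \<noteq> 0 \<and> br e1 e2 = e3 \<and> br e2 e3 = e1 \<and> br e3 e1 = e2"

context
  fixes V :: "'a set"
  assumes V: "subalgebra V" and H: "stably_contact V"
    and ab: "\<And>x. x \<in> V \<Longrightarrow> x \<notin> centre V \<Longrightarrow> abelian (centraliser V x)"
begin

private lemmas VD = subalgebraD[OF V]

lemma subspace_centre: "subspace (centre V)"
  using VD(1) by (auto simp: centre_def subspace_def)

lemma centre_subset_centraliser: "x \<in> V \<Longrightarrow> centre V \<subseteq> centraliser V x"
proof
  fix z assume "x \<in> V" "z \<in> centre V"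
  then show "z \<in> centraliser V x"
    using br_skew[of x z] by (simp add: centre_def centraliser_def)
qed

lemma subspace_image: "subspace (br x ` V)"
  by (rule linear_subspace_image[OF linear_right VD(1)])

lemma image_subset: "x \<in> V \<Longrightarrow> br x ` V \<subseteq> V"
  using VD(3) by blast

lemma ad_image: "x \<in> V \<Longrightarrow> br x ` br x ` V \<subseteq> br x ` V"
  using VD(3) by blast

lemma ad_commuting_image:
  assumes "x \<in> V" "w \<in> centraliser V x"
  shows "br w ` br x ` V \<subseteq> br x ` V"
proof clarify
  fix u assume u: "u \<in> V"
  have "br x w = 0" "w \<in> V" using assms(2) by (auto simp: centraliser_def)
  then have "br w (br x u) = br x (br w u)"
    using br_leibniz[of x w u] by simp
  then show "br w (br x u) \<in> br x ` V"
    using VD(3)[OF \<open>w \<in> V\<close> u] by blast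
qed

lemma image_kernel:
  assumes "x \<in> V" "y \<in> br x ` V" "y \<in> centraliser V x"
  shows "y = 0"
  using centraliser_Int_image[OF V H assms(1)] assms by blast

lemma image_inter_centre:
  assumes "x \<in> V" "y \<in> br x ` V" "y \<in> centre V"
  shows "y = 0"
  using image_kernel assms centre_subset_centraliser by blast

text \<open>For c = 0 both \<open>x\<close> and \<open>y\<close> commute with the noncentral element
  \<open>u\<close>, hence with each other, and \<open>y\<close> lies in the kernel and the image of
  ad x. Other c are not eigenvalues at all.\<close>

lemma image_real_eigenvector:
  assumes "x \<in> V" "x \<notin> centre V" "u \<in> centraliser V x" "u \<notin> centre V" "y \<in> br x ` V" "br u y = c *\<^sub>R y"
  shows "y = 0"
proof (cases "c = 0")
  case True
  have uV: "u \<in> V" and ux: "br x u = 0" using assms(3) by (auto simp: centraliser_def)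
  have yV: "y \<in> V" using assms(1,5) VD(3) by blast
  have "y \<in> centraliser V u" "x \<in> centraliser V u"
    using True assms(1,6) yV br_skew[of u x] ux by (auto simp: centraliser_def)
  then have "br x y = 0" using ab[OF uV assms(4)] unfolding abelian_def by blast
  then have "y \<in> centraliser V x" using yV by (simp add: centraliser_def)
  then show ?thesis using image_kernel assms(1,5) by blast
next
  case False
  have "u \<in> V" using assms(3) by (auto simp: centraliser_def)
  moreover have "y \<in> V" using assms(1,5) VD(3) by blast
  ultimately show ?thesis using no_real_eigenvalue[OF V H _ _ assms(6) False] by blast
qed

lemma exists_eigenvector:
  assumes "x \<in> V" "x \<notin> centre V"
  obtains z v where "v \<in> br x ` V \<times> br x ` V" "v \<noteq> 0" "cbr (x, 0) v = csc z v"
proof -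
  let ?m = "br x ` V"
  obtain u where u: "u \<in> V" "br x u \<noteq> 0" using assms by (auto simp: centre_def)
  obtain zs where zs: "\<And>v. v \<in> ?m \<times> ?m \<Longrightarrow> foldr (char_op (br x)) zs v = 0"
    using exists_char_ops_eq_0[OF linear_right fin_dim_subset[OF VD(2) image_subset[OF assms(1)]]
        ad_image[OF assms(1)]] by blast
  have closed: "char_op (br x) z w \<in> ?m \<times> ?m" if "w \<in> ?m \<times> ?m" for z w
    by (rule char_op_mem[OF subspace_image ad_image[OF assms(1)] that])
  have v0: "(br x u, 0) \<in> ?m \<times> ?m" "(br x u, 0) \<notin> {0}"
    using u subspace_0[OF subspace_image] by (auto simp: zero_prod_def)
  then have "foldr (char_op (br x)) zs (br x u, 0) \<in> {0}" using zs by blast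
  then have "\<exists>z w. w \<in> ?m \<times> ?m \<and> w \<notin> {0} \<and> char_op (br x) z w \<in> {0}"
    using closed by (rule exists_eigenvector_mod[OF linear_right v0])
  then obtain z w where "w \<in> ?m \<times> ?m" "w \<noteq> 0" "char_op (br x) z w = 0" by blast
  then show ?thesis using that[of w z] by (simp add: char_op_eq_0_iff)
qed

text \<open>Since ad w commutes with ad x, it preserves the eigenspace \<open>P\<close> of ad x in
  the complexified image and has an eigenvector there.\<close>

lemma exists_joint_eigenvector:
  assumes "x \<in> V" "x \<notin> centre V" "w \<in> centraliser V x"
  obtains y z v where "v \<in> br x ` V \<times> br x ` V" "v \<noteq> 0" "cbr (x, 0) v = csc y v" "cbr (w, 0) v = csc z v"
proof -
  let ?m = "br x ` V"
  obtain y v0 where v0: "v0 \<in> ?m \<times> ?m" "v0 \<noteq> 0" "cbr (x, 0) v0 = csc y v0"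
    by (rule exists_eigenvector[OF assms(1,2)])
  define P where "P = {v \<in> ?m \<times> ?m. cbr (x, 0) v = csc y v}"
  obtain zs where zs: "\<And>v. v \<in> ?m \<times> ?m \<Longrightarrow> foldr (char_op (br w)) zs v = 0"
    using exists_char_ops_eq_0[OF linear_right fin_dim_subset[OF VD(2) image_subset[OF assms(1)]]
        ad_commuting_image[OF assms(1,3)]] by blast
  have wx: "cbr (x, 0) (w, 0) = 0"
    using assms(3) by (simp add: cbr_def centraliser_def zero_prod_def)
  have closed: "char_op (br w) z v \<in> P" if "v \<in> P" for z v
  proof -
    have v: "v \<in> ?m \<times> ?m" "cbr (x, 0) v = csc y v" using that by (auto simp: P_def)
    have "char_op (br w) z v \<in> ?m \<times> ?m"
      by (rule char_op_mem[OF subspace_image ad_commuting_image[OF assms(1,3)] v(1)])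
    moreover have "cbr (x, 0) (cbr (w, 0) v) = csc y (cbr (w, 0) v)"
      using cbr_leibniz[of "(x, 0)" "(w, 0)" v] by (simp add: wx v(2) cbr_csc)
    then have "cbr (x, 0) (char_op (br w) z v) = csc y (char_op (br w) z v)"
      unfolding char_op_def cbr_real[of w, symmetric]
      by (simp add: cbr_diff cbr_csc v(2) cplx.scale_right_diff_distrib mult.commute)
    ultimately show ?thesis by (simp add: P_def)
  qed
  have "v0 \<in> P" "v0 \<notin> {0}" using v0 by (auto simp: P_def)
  moreover have "foldr (char_op (br w)) zs v0 \<in> {0}" using zs v0(1) by blast
  ultimately have "\<exists>z v. v \<in> P \<and> v \<notin> {0} \<and> char_op (br w) z v \<in> {0}"
    by (rule exists_eigenvector_mod[OF linear_right _ _ _ closed])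
  then obtain z v where "v \<in> P" "v \<noteq> 0" "char_op (br w) z v = 0" by blast
  then show ?thesis using that[of v y z] by (simp add: char_op_eq_0_iff P_def)
qed

text \<open>If the centraliser were larger, some element of it would have a real eigenvalue: two complex
  numbers always have a real linear combination, with nontrivial coefficients, that is real.\<close>

lemma centraliser_eq:
  assumes x: "x \<in> V" "x \<notin> centre V" and w: "w \<in> centraliser V x"
  obtains r z where "z \<in> centre V" "w = r *\<^sub>R x + z"
proof (rule ccontr)
  assume "\<not> thesis"
  then have nin: "w \<noteq> r *\<^sub>R x + z" if "z \<in> centre V" for r z
    using that \<open>\<And>z r. z \<in> centre V \<Longrightarrow> w = r *\<^sub>R x + z \<Longrightarrow> thesis\<close> by blast
  let ?m = "br x ` V"
  obtain y z v where v: "v \<in> ?m \<times> ?m" "v \<noteq> 0" "cbr (x, 0) v = csc y v" "cbr (w, 0) v = csc z v"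
    by (rule exists_joint_eigenvector[OF x w])
  obtain s t where st: "s * Im y + t * Im z = 0" "s \<noteq> 0 \<or> t \<noteq> 0"
  proof (cases "Im y = 0")
    case True
    then show ?thesis using that[of 1 0] by simp
  next
    case False
    then show ?thesis using that[of "- Im z" "Im y"] by simp
  qed
  define u where "u = s *\<^sub>R x + t *\<^sub>R w"
  have wV: "w \<in> V" using w by (simp add: centraliser_def)
  have uc: "u \<in> centraliser V x"
    using x w VD(1) by (auto simp: u_def centraliser_def intro!: subspace_add subspace_scale)
  have unc: "u \<notin> centre V"
  proof
    assume u: "u \<in> centre V"
    show False
    proof (cases "t = 0")
      case True
      then have "(1 / s) *\<^sub>R u = x" using st by (simp add: u_def)
      then show False using u x subspace_scale[OF subspace_centre, of u "1 / s"] by simp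
    next
      case False
      then have "w = (- s / t) *\<^sub>R x + (1 / t) *\<^sub>R u"
        by (simp add: u_def scaleR_add_right)
      then show False using nin[of "(1 / t) *\<^sub>R u"] subspace_scale[OF subspace_centre u] by blast
    qed
  qed
  define c where "c = s * Re y + t * Re z"
  have "cbr (u, 0) v = csc (of_real s * y + of_real t * z) v"
  proof -
    have "(u, 0) = csc (of_real s) (x, 0) + csc (of_real t) (w, 0)"
      by (simp add: u_def csc_of_real)
    then show ?thesis by (simp add: cbr_add cbr_csc v cplx.scale_left_distrib)
  qed
  also have "of_real s * y + of_real t * z = of_real c"
    using st(1) by (simp add: complex_eq_iff c_def)
  finally have "br u (fst v) = c *\<^sub>R fst v" "br u (snd v) = c *\<^sub>R snd v"
    unfolding csc_of_real cbr_real by (auto simp: prod_eq_iff)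
  then have "fst v = 0" "snd v = 0"
    using image_real_eigenvector[OF x uc unc] v(1) by (auto simp: mem_Times_iff)
  then show False using v(2) by (simp add: prod_eq_iff)
qed

text \<open>For v = y + i w the bracket [y, w] satisfies [x, [y, w]] = 2 Re z [y, w], so Re z = 0
  and [y, w] commutes with x; being in the centraliser, it is a multiple of x modulo the centre. The
  other sign of the multiple would be that of sl(2, R), where ad y has a real eigenvalue. Inside the
  proof \<open>a\<close> is Re z and the multiple is \<open>r\<close>.\<close>

lemma eigenvector_bracket:
  assumes x: "x \<in> V" "x \<notin> centre V"
    and v: "v \<in> br x ` V \<times> br x ` V" "v \<noteq> 0" "cbr (x, 0) v = csc z v"
  obtains a c where "Re z = 0" "Im z \<noteq> 0" "c \<in> centre V" "br (fst v) (snd v) = a *\<^sub>R x + c" "a * Im z < 0"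
proof -
  let ?m = "br x ` V"
  define y w a b where "y = fst v" and "w = snd v" and "a = Re z" and "b = Im z"
  have m: "y \<in> ?m" "w \<in> ?m" using v(1) by (auto simp: y_def w_def)
  then have mV: "y \<in> V" "w \<in> V" using image_subset[OF x(1)] by auto
  have xc: "x \<in> centraliser V x" using x by (simp add: centraliser_def)
  have bx: "br x y = a *\<^sub>R y - b *\<^sub>R w" "br x w = a *\<^sub>R w + b *\<^sub>R y"
    using v(3) unfolding cbr_real by (auto simp: csc_def prod_eq_iff y_def w_def a_def b_def)
  note real = image_real_eigenvector[OF x xc x(2)]
  have nz: "y \<noteq> 0 \<or> w \<noteq> 0" using v(2) by (simp add: y_def w_def prod_eq_iff)
  have b: "b \<noteq> 0"
  proof
    assume "b = 0"
    then have "y = 0" "w = 0" using bx real[OF m(1), of a] real[OF m(2), of a] by auto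
    then show False using nz by simp
  qed
  have y: "y \<noteq> 0"
  proof
    assume "y = 0"
    then show False using bx(1) b nz by simp
  qed
  have yc: "y \<notin> centre V" using image_inter_centre[OF x(1) m(1)] y by blast
  \<comment> \<open>If \<open>y\<close> and \<open>w\<close> commuted, w would be a multiple of y
    modulo the centre. The image of ad x meets the centre in 0, so w would be a multiple of y, and y
    a real eigenvector of ad x.\<close>
  have ne: "br y w \<noteq> 0"
  proof
    assume "br y w = 0"
    then have "w \<in> centraliser V y" using mV by (simp add: centraliser_def)
    then obtain r c where rc: "c \<in> centre V" "w = r *\<^sub>R y + c"
      using centraliser_eq[OF mV(1) yc] by blast
    then have "c = w - r *\<^sub>R y" by simp
    then have "c \<in> ?m" using m subspace_image by (simp add: subspace_diff subspace_scale)
    then have "c = 0" using image_inter_centre[OF x(1)] rc(1) by blast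
    then have "br x y = (a - b * r) *\<^sub>R y" using bx(1) rc(2) by (simp add: algebra_simps)
    then show False using real[OF m(1)] y by blast
  qed
  have "br x (br y w) = a *\<^sub>R br y w + a *\<^sub>R br y w"
    using br_leibniz[of x y w] by (simp add: bx)
  then have e: "br x (br y w) = (2 * a) *\<^sub>R br y w"
    by (simp flip: scaleR_add_left)
  have a: "a = 0"
    using no_real_eigenvalue[OF V H x(1) VD(3)[OF mV] e] ne by auto
  then have "br y w \<in> centraliser V x" using e VD(3)[OF mV] by (simp add: centraliser_def)
  then obtain r c where rc: "c \<in> centre V" "br y w = r *\<^sub>R x + c"
    using centraliser_eq[OF x] by blast
  have cc: "br c u = 0" "br u c = 0" if "u \<in> V" for u
    using rc(1) that br_skew[of u c] by (auto simp: centre_def)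
  have yx: "br y x = b *\<^sub>R w" using bx(1) br_skew[of y x] a by simp
  have yyw: "br y (br y w) = (r * b) *\<^sub>R w"
    using cc(2)[OF mV(1)] by (simp add: rc(2) yx)
  have r: "r \<noteq> 0"
  proof
    assume "r = 0"
    then have "br y (br y w) = 0" using yyw by simp
    then show False using bracket_bracket_eq_0[OF V H mV] ne by blast
  qed
  have "r * b < 0"
  proof (rule ccontr)
    assume "\<not> r * b < 0"
    then have pos: "r * b > 0" using r b by (simp add: less_le not_less)
    \<comment> \<open>From (ad y)^2 w = r b w, the vector [y, w] + q w is an eigenvector of ad y for
      the real number q, unless it is zero.\<close>
    define q where "q = sqrt (r * b)"
    have q: "q * q = r * b" "q \<noteq> 0" using pos by (auto simp: q_def)
    define u where "u = br y w + q *\<^sub>R w"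
    have "br y u = q *\<^sub>R u"
      by (simp add: u_def yyw scaleR_add_right q(1))
    moreover have "u \<in> V" using mV VD by (simp add: u_def subspace_add subspace_scale)
    ultimately have "u = 0" using no_real_eigenvalue[OF V H mV(1) _ _ q(2)] by blast
    then have "br y w = (- q) *\<^sub>R w" by (simp add: u_def eq_neg_iff_add_eq_0)
    then have "br y w \<in> ?m" using m(2) subspace_image by (metis subspace_scale)
    then have "br y w = 0"
      using image_kernel[OF x(1)] \<open>br y w \<in> centraliser V x\<close> by blast
    then show False using ne by simp
  qed
  then show ?thesis
    using that[of c r] a b rc unfolding y_def w_def a_def b_def by blast
qed

text \<open>For v = y + i w the bracket of v with its conjugate is -2 i [y, w], and the central part
  of [y, w] acts as zero. So v, its conjugate and x behave like an sl(2)-triple in brackets with any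
  \<open>u\<close>.\<close>

lemma eigenvector_bracket_cnj:
  assumes x: "x \<in> V" "x \<notin> centre V"
    and v: "v \<in> br x ` V \<times> br x ` V" "v \<noteq> 0" "cbr (x, 0) v = csc z v"
  obtains a where "a * Im z < 0"
    "\<And>u. u \<in> V \<times> V \<Longrightarrow> cbr (cbr v (ccnj v)) u = csc (- 2 * \<i> * of_real a) (cbr (x, 0) u)"
proof -
  obtain a c where a: "c \<in> centre V" "br (fst v) (snd v) = a *\<^sub>R x + c" "a * Im z < 0"
    by (rule eigenvector_bracket[OF x v])
  have "cbr (cbr v (ccnj v)) u = csc (- 2 * \<i> * of_real a) (cbr (x, 0) u)" if u: "u \<in> V \<times> V" for u
  proof -
    have c0: "cbr (c, 0) u = 0"
      using a(1) u unfolding cbr_real by (cases u) (auto simp: centre_def zero_prod_def)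
    have "cbr v (ccnj v) = csc (- 2 * \<i>) (br (fst v) (snd v), 0)"
      using br_skew[of "snd v" "fst v"] scaleR_2[of "br (fst v) (snd v)"]
      by (simp add: cbr_def ccnj_def csc_def prod_eq_iff)
    also have "(br (fst v) (snd v), 0) = csc (of_real a) (x, 0) + (c, 0)"
      by (simp add: a(2) csc_of_real)
    finally show ?thesis
      by (simp add: cbr_csc cbr_add cbr_minus c0)
  qed
  then show ?thesis using that a(3) by blast
qed

text \<open>Real and imaginary part lie in the centraliser of \<open>x\<close>: modulo the centre,
  the weight space for 0 is the complex line through \<open>x\<close>.\<close>

lemma kernel_acts_as_multiple:
  assumes x: "x \<in> V" "x \<notin> centre V" and v: "v \<in> V \<times> V" "cbr (x, 0) v = 0"
  obtains g where "\<And>u. u \<in> V \<times> V \<Longrightarrow> cbr v u = csc g (cbr (x, 0) u)"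
proof -
  have "fst v \<in> centraliser V x" "snd v \<in> centraliser V x"
    using v unfolding cbr_real by (auto simp: centraliser_def prod_eq_iff)
  then obtain r c s d where rc: "c \<in> centre V" "fst v = r *\<^sub>R x + c" and sd: "d \<in> centre V" "snd v = s *\<^sub>R x + d"
    using centraliser_eq[OF x] by metis
  have "cbr v u = csc (Complex r s) (cbr (x, 0) u)" if u: "u \<in> V \<times> V" for u
  proof -
    have c0: "cbr (e, 0) u = 0" if "e \<in> centre V" for e
      using that u unfolding cbr_real by (cases u) (auto simp: centre_def zero_prod_def)
    have "v = csc (Complex r s) (x, 0) + (c, 0) + csc \<i> (d, 0)"
      by (simp add: csc_def prod_eq_iff rc sd)
    then show ?thesis
      by (simp add: cbr_add cbr_csc c0 rc(1) sd(1))
  qed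
  then show ?thesis using that by blast
qed

lemma cbr_mem: "u \<in> V \<times> V \<Longrightarrow> v \<in> V \<times> V \<Longrightarrow> cbr u v \<in> V \<times> V"
  using VD(3) by (simp add: cbr_def mem_Times_iff subspace_diff[OF VD(1)] subspace_add[OF VD(1)])

lemma cbr_cbr_eq_0:
  assumes "x \<in> V" "v \<in> V \<times> V" "cbr (x, 0) (cbr (x, 0) v) = 0"
  shows "cbr (x, 0) v = 0"
proof -
  have "fst v \<in> V" "snd v \<in> V" "br x (br x (fst v)) = 0" "br x (br x (snd v)) = 0"
    using assms(2,3) unfolding cbr_real by (auto simp: prod_eq_iff)
  then have "br x (fst v) = 0" "br x (snd v) = 0"
    using bracket_bracket_eq_0[OF V H assms(1)] by blast+
  then show ?thesis unfolding cbr_real by (simp add: prod_eq_iff)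
qed

section \<open>Weight strings for the largest weight\<close>

context
  fixes x :: 'a and B :: real and E :: "'a \<times> 'a"
  assumes x: "x \<in> V" "x \<notin> centre V" and B: "B > 0"
    and E: "E \<in> br x ` V \<times> br x ` V" "E \<noteq> 0" "cbr (x, 0) E = csc (\<i> * of_real B) E"
    and max: "\<And>v z. \<lbrakk>v \<in> V \<times> V; v \<noteq> 0; cbr (x, 0) v = csc z v; z \<noteq> 0\<rbrakk> \<Longrightarrow> Re z = 0 \<and> \<bar>Im z\<bar> \<le> B"
begin

lemma image_Times: "v \<in> br x ` V \<times> br x ` V \<Longrightarrow> v \<in> V \<times> V"
  using image_subset[OF x(1)] by blast

lemma weight_cnj_E: "cbr (x, 0) (ccnj E) = csc (- (\<i> * of_real B)) (ccnj E)"
  using weight_cnj[OF E(3)] by simp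

lemma E_bracket:
  obtains a where "a \<noteq> 0"
    "\<And>u. u \<in> V \<times> V \<Longrightarrow> cbr (cbr E (ccnj E)) u = csc (- 2 * \<i> * of_real a) (cbr (x, 0) u)"
proof -
  obtain a where a: "a * Im (\<i> * of_real B) < 0"
    "\<And>u. u \<in> V \<times> V \<Longrightarrow> cbr (cbr E (ccnj E)) u = csc (- 2 * \<i> * of_real a) (cbr (x, 0) u)"
    using eigenvector_bracket_cnj[OF x E] by blast
  have "a \<noteq> 0" using a(1) by auto
  then show ?thesis using that a(2) by blast
qed

text \<open>[E, F] = 0, since its weight would be 2 i B. The bracket G of the conjugate of E with F
  satisfies (ad x)^2 G = 0, hence commutes with x and acts as a multiple of ad x; so [E, G] is a
  multiple of E. By Leibniz it is also a nonzero multiple of F plus a multiple of E.\<close>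

lemma no_Jordan_vector:
  assumes F: "F \<in> br x ` V \<times> br x ` V" "cbr (x, 0) F = csc (\<i> * of_real B) F + csc p E"
  obtains k where "F = csc k E"
proof -
  note EV = image_Times[OF E(1)] and FV = image_Times[OF F(1)]
  note E'V = ccnj_mem[OF VD(1) EV]
  obtain a where a: "a \<noteq> 0"
    "\<And>u. u \<in> V \<times> V \<Longrightarrow> cbr (cbr E (ccnj E)) u = csc (- 2 * \<i> * of_real a) (cbr (x, 0) u)"
    using E_bracket by blast
  have "cbr (x, 0) (cbr E F) = csc (2 * \<i> * of_real B) (cbr E F)"
    by (simp add: cbr_leibniz[of "(x, 0)"] E(3) F(2) cbr_csc cbr_add flip: cplx.scale_left_distrib)
  then have EF: "cbr E F = 0"
    using max[of "cbr E F" "2 * \<i> * of_real B"] cbr_mem[OF EV FV] B by fastforce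
  define G where "G = cbr (ccnj E) F"
  have GV: "G \<in> V \<times> V" unfolding G_def by (rule cbr_mem[OF E'V FV])
  have "cbr (x, 0) (cbr (ccnj E) E) = 0"
    using weight_add[OF weight_cnj_E E(3)] by simp
  moreover have "cbr (x, 0) G = csc p (cbr (ccnj E) E)"
    unfolding G_def
    by (simp add: cbr_leibniz[of "(x, 0)"] weight_cnj_E F(2) cbr_csc cbr_add)
  ultimately have "cbr (x, 0) (cbr (x, 0) G) = 0" by (simp add: cbr_csc)
  then have "cbr (x, 0) G = 0" by (rule cbr_cbr_eq_0[OF x(1) GV])
  then obtain g where g: "\<And>u. u \<in> V \<times> V \<Longrightarrow> cbr G u = csc g (cbr (x, 0) u)"
    using kernel_acts_as_multiple[OF x GV] by blast
  have "cbr E G = cbr (cbr E (ccnj E)) F"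
    unfolding G_def by (simp add: cbr_leibniz[of E] EF)
  also have "\<dots> = csc (2 * of_real a * of_real B) F + csc (- 2 * \<i> * of_real a * p) E"
    unfolding a(2)[OF FV] F(2) cplx.scale_right_distrib csc_imaginary by simp
  also have "cbr E G = csc (- g * \<i> * of_real B) E"
    using g[OF EV] cbr_skew[of E G] by (simp add: E(3))
  finally have "csc (2 * of_real a * of_real B) F = csc (- g * \<i> * of_real B - - 2 * \<i> * of_real a * p) E"
    unfolding cplx.scale_left_diff_distrib by simp
  then have "csc (inverse (2 * of_real a * of_real B)) (csc (2 * of_real a * of_real B) F) =
      csc (inverse (2 * of_real a * of_real B) * (- g * \<i> * of_real B - - 2 * \<i> * of_real a * p)) E"
    by simp
  moreover have "inverse (2 * of_real a * of_real B) * (2 * of_real a * of_real B) = (1 :: complex)"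
    using a(1) B by (intro left_inverse) simp
  ultimately show ?thesis using that by (metis cplx.scale_one cplx.scale_scale)
qed

text \<open>Bracketing F with E, or twice with the conjugate of E, leads to weights of modulus B + b
  and 2 B - b, both above B, so the results vanish. Computing the bracket of the conjugate of E with
  [E, G] in two ways then forces B = 2 b.\<close>

lemma no_intermediate_weight:
  assumes F: "F \<in> br x ` V \<times> br x ` V" "F \<noteq> 0" "cbr (x, 0) F = csc (\<i> * of_real b) F" and b: "0 < b" "b < B"
  shows False
proof -
  note EV = image_Times[OF E(1)] and FV = image_Times[OF F(1)]
  note E'V = ccnj_mem[OF VD(1) EV] and F'V = ccnj_mem[OF VD(1) FV]
  have F': "cbr (x, 0) (ccnj F) = csc (- (\<i> * of_real b)) (ccnj F)"
    using weight_cnj[OF F(3)] by simp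
  obtain a where a: "a \<noteq> 0"
    "\<And>u. u \<in> V \<times> V \<Longrightarrow> cbr (cbr E (ccnj E)) u = csc (- 2 * \<i> * of_real a) (cbr (x, 0) u)"
    using E_bracket by blast
  obtain d where d: "d * Im (\<i> * of_real b) < 0"
    "\<And>u. u \<in> V \<times> V \<Longrightarrow> cbr (cbr F (ccnj F)) u = csc (- 2 * \<i> * of_real d) (cbr (x, 0) u)"
    using eigenvector_bracket_cnj[OF x F] by blast
  have d0: "d \<noteq> 0" using d(1) by auto
  have EF: "cbr E F = 0"
    using max[OF cbr_mem[OF EV FV] _ weight_add[OF E(3) F(3)]] B b by (auto simp: complex_eq_iff)
  have FE: "cbr F E = 0" using cbr_skew[of F E] EF by simp
  define G where "G = cbr (ccnj E) F"
  have GV: "G \<in> V \<times> V" unfolding G_def by (rule cbr_mem[OF E'V FV])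
  have Gw: "cbr (x, 0) G = csc (\<i> * of_real (b - B)) G"
    using weight_add[OF weight_cnj_E F(3)] by (simp add: G_def algebra_simps)
  have EG: "cbr E G = csc (2 * of_real a * of_real b) F"
    unfolding G_def cbr_leibniz[of E] EF a(2)[OF FV] F(3) csc_imaginary by simp
  then have G0: "G \<noteq> 0" using a(1) b F(2) by auto
  have E'G: "cbr (ccnj E) G = 0"
    using max[OF cbr_mem[OF E'V GV] _ weight_add[OF weight_cnj_E Gw]] B b by (auto simp: complex_eq_iff)
  have "cbr (ccnj E) (cbr E G) = csc (2 * of_real a * of_real (B - b)) G"
  proof -
    have "cbr (cbr (ccnj E) E) G = - csc (2 * of_real a * of_real (b - B)) G"
      unfolding cbr_skew[of "ccnj E" E] cbr_minus a(2)[OF GV] Gw csc_imaginary ..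
    then show ?thesis
      unfolding cbr_leibniz[of "ccnj E" E] E'G
      by (simp add: algebra_simps flip: cplx.scale_minus_left)
  qed
  moreover have "cbr (ccnj E) (cbr E G) = csc (2 * of_real a * of_real b) G"
    unfolding EG by (simp add: cbr_csc G_def)
  ultimately have "csc (2 * of_real a * of_real (B - b) - 2 * of_real a * of_real b) G = 0"
    by (simp only: cplx.scale_left_diff_distrib) simp
  then have "2 * of_real a * of_real (B - b) - 2 * of_real a * of_real b = (0 :: complex)"
    using G0 by simp
  then have "of_real (2 * a * (B - b) - 2 * a * b) = (0 :: complex)" by simp
  then have "2 * a * (B - b - b) = 0"
    unfolding of_real_eq_0_iff by (simp add: algebra_simps)
  then have Bb: "B = 2 * b" using a(1) by simp
  \<comment> \<open>In the remaining case B = 2 b, A has weight i b and C has weight 0. Hence C acts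
    as a multiple of ad x, and [F, C] is a multiple of F, so it commutes with F. By Leibniz [F, C]
    is a nonzero multiple of A, whereas [F, A] is a nonzero multiple of E.\<close>
  define A where "A = cbr (ccnj F) E"
  have AV: "A \<in> V \<times> V" unfolding A_def by (rule cbr_mem[OF F'V EV])
  have Aw: "cbr (x, 0) A = csc (\<i> * of_real b) A"
    using weight_add[OF F' E(3)] by (simp add: A_def Bb algebra_simps)
  have FA: "cbr F A = csc (2 * of_real d * of_real B) E"
    unfolding A_def cbr_leibniz[of F] FE d(2)[OF EV] E(3) csc_imaginary by simp
  define C where "C = cbr (ccnj F) A"
  have CV: "C \<in> V \<times> V" unfolding C_def by (rule cbr_mem[OF F'V AV])
  have "cbr (x, 0) C = 0"
    using weight_add[OF F' Aw] by (simp add: C_def)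
  then obtain g where g: "\<And>u. u \<in> V \<times> V \<Longrightarrow> cbr C u = csc g (cbr (x, 0) u)"
    using kernel_acts_as_multiple[OF x CV] by blast
  have FC: "cbr F C = csc (2 * of_real d * of_real b + 2 * of_real d * of_real B) A"
    unfolding C_def cbr_leibniz[of F] FA d(2)[OF AV] Aw csc_imaginary
    by (simp add: cbr_csc cplx.scale_left_distrib flip: A_def)
  have "cbr F C = csc (- g * \<i> * of_real b) F"
    using g[OF FV] cbr_skew[of F C] by (simp add: F(3))
  then have "cbr F (csc (2 * of_real d * of_real b + 2 * of_real d * of_real B) A) =
      cbr F (csc (- g * \<i> * of_real b) F)"
    unfolding FC by (rule arg_cong)
  also have "\<dots> = 0"
    by (simp only: cbr_csc cbr_self cplx.scale_zero_right)
  finally have "csc (2 * of_real d * of_real b + 2 * of_real d * of_real B) (csc (2 * of_real d * of_real B) E) = 0"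
    unfolding cbr_csc FA .
  then have "csc ((2 * of_real d * of_real b + 2 * of_real d * of_real B) * (2 * of_real d * of_real B)) E = 0"
    by (simp only: cplx.scale_scale)
  then have "(2 * of_real d * of_real b + 2 * of_real d * of_real B) * (2 * of_real d * of_real B) = (0::complex)"
    using E(2) by simp
  then have "of_real ((2 * d * b + 2 * d * B) * (2 * d * B)) = (0::complex)" by simp
  then have "(2 * d * b + 2 * d * B) * (2 * d * B) = 0" unfolding of_real_eq_0_iff .
  then show False using d0 b Bb by (simp add: field_simps)
qed

text \<open>A larger image would contain, after complexification, an eigenvector of ad x modulo
  \<open>S\<close>, the complex span of E and its conjugate, lying outside \<open>S\<close>.
  Corrected by elements of \<open>S\<close> and possibly conjugated, it becomes an eigenvector of
  intermediate weight or a Jordan vector over E.\<close>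

lemma image_subset_span: "br x ` V \<subseteq> span {fst E, snd E}"
proof (rule ccontr)
  assume "\<not> br x ` V \<subseteq> span {fst E, snd E}"
  then obtain u where u: "u \<in> br x ` V" "u \<notin> span {fst E, snd E}" by blast
  let ?m = "br x ` V"
  define S where "S = {csc p E + csc q (ccnj E) | p q. True}"
  have SI: "csc p E + csc q (ccnj E) \<in> S" for p q unfolding S_def by blast
  have S_add: "v + csc p E + csc q (ccnj E) \<in> S \<Longrightarrow> v \<in> S" for v p q
  proof -
    assume "v + csc p E + csc q (ccnj E) \<in> S"
    then obtain p' q' where "v + csc p E + csc q (ccnj E) = csc p' E + csc q' (ccnj E)"
      unfolding S_def by blast
    then have "v = csc (p' - p) E + csc (q' - q) (ccnj E)"
      by (simp add: cplx.scale_left_diff_distrib algebra_simps)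
    then show "v \<in> S" using SI by simp
  qed
  have S_cnj: "ccnj v \<in> S \<Longrightarrow> v \<in> S" for v
  proof -
    assume "ccnj v \<in> S"
    then obtain p q where "ccnj v = csc p E + csc q (ccnj E)" unfolding S_def by blast
    then have "ccnj (ccnj v) = csc (cnj q) E + csc (cnj p) (ccnj E)"
      by (simp add: ccnj_add ccnj_csc)
    then show "v \<in> S" using SI by simp
  qed
  have S0: "0 \<in> S" using SI[of 0 0] by simp
  have SE: "csc k E \<in> S" for k using SI[of k 0] by simp
  note E'm = ccnj_mem[OF subspace_image E(1)]
  have mid: False if F: "F \<in> ?m \<times> ?m" "F \<notin> S" "cbr (x, 0) F = csc z F"
    and z: "z \<noteq> \<i> * of_real B" "z \<noteq> - (\<i> * of_real B)" for F z
  proof -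
    have F0: "F \<noteq> 0" using F(2) S0 by blast
    have "Im z \<noteq> 0" by (rule eigenvector_bracket[OF x F(1) F0 F(3)])
    then have z0: "z \<noteq> 0" by auto
    have zi: "Re z = 0" "\<bar>Im z\<bar> \<le> B" using max[OF image_Times[OF F(1)] F0 F(3) z0] by auto
    define c where "c = Im z"
    have zc: "z = \<i> * of_real c" using zi(1) by (simp add: complex_eq_iff c_def)
    have c: "c \<noteq> B" "c \<noteq> - B" "c \<noteq> 0" "\<bar>c\<bar> \<le> B"
      using z \<open>Im z \<noteq> 0\<close> zi(2) by (auto simp: zc)
    show False
    proof (cases "c > 0")
      case True
      have "c < B" using c by linarith
      then show False using no_intermediate_weight[OF F(1) F0 F(3)[unfolded zc] True] by blast
    next
      case False
      have "cbr (x, 0) (ccnj F) = csc (\<i> * of_real (- c)) (ccnj F)"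
        using weight_cnj[OF F(3)[unfolded zc]] by simp
      moreover have "- c > 0" "- c < B" using c False by linarith+
      ultimately show False
        using no_intermediate_weight[OF ccnj_mem[OF subspace_image F(1)]] F0 by fastforce
    qed
  qed
  have main: False if F: "F \<in> ?m \<times> ?m" "F \<notin> S"
    "cbr (x, 0) F = csc z F + csc p E + csc q (ccnj E)" and z: "z \<noteq> - (\<i> * of_real B)" for F z p q
  proof -
    let ?I = "\<i> * of_real B :: complex"
    \<comment> \<open>\<open>y\<close> removes the component along the conjugate of E and
      \<open>w\<close> the one along E. For z = i B the second equation is resonant; w is then 0 and
      F1 is a Jordan vector over E.\<close>
    define y where "y = q / (z + ?I)"
    define w where "w = (if z = ?I then 0 else p / (z - ?I))"
    define F1 where "F1 = F + csc w E + csc y (ccnj E)"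
    have F1S: "F1 \<notin> S" using F(2) S_add unfolding F1_def by blast
    have F1m: "F1 \<in> ?m \<times> ?m"
      unfolding F1_def using F(1) csc_mem[OF subspace_image E(1), of w] csc_mem[OF subspace_image E'm, of y]
        subspace_add[OF subspace_image[of x]] by (auto simp: mem_Times_iff)
    have "z + ?I \<noteq> 0" using z by (simp add: eq_neg_iff_add_eq_0)
    then have y: "q - y * ?I = z * y" by (simp add: y_def field_simps)
    have "cbr (x, 0) F1 = csc z F + csc (p + w * ?I) E + csc (q - y * ?I) (ccnj E)"
      by (simp add: F1_def cbr_add cbr_csc F(3) E(3) weight_cnj_E cplx.scale_left_distrib
          cplx.scale_left_diff_distrib algebra_simps)
    also have "\<dots> = csc z F1 + csc (p + w * ?I - z * w) E"
      unfolding F1_def y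
      by (simp add: cplx.scale_right_distrib cplx.scale_left_distrib cplx.scale_left_diff_distrib algebra_simps)
    finally have F1: "cbr (x, 0) F1 = csc z F1 + csc (p + w * ?I - z * w) E" .
    show False
    proof (cases "z = ?I")
      case True
      then obtain k where "F1 = csc k E" using no_Jordan_vector[OF F1m, of "p + w * ?I - z * w"] F1 by auto
      then show False using F1S SE by simp
    next
      case False
      then have "p + w * ?I - z * w = 0" by (simp add: w_def field_simps)
      then have "cbr (x, 0) F1 = csc z F1" using F1 by simp
      then show False using mid[OF F1m F1S _ False z] by blast
    qed
  qed
  obtain zs where zs: "\<And>v. v \<in> ?m \<times> ?m \<Longrightarrow> foldr (char_op (br x)) zs v = 0"
    using exists_char_ops_eq_0[OF linear_right fin_dim_subset[OF VD(2) image_subset[OF x(1)]]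
        ad_image[OF x(1)]] by blast
  have um: "(u, 0) \<in> ?m \<times> ?m" using u subspace_0[OF subspace_image] by simp
  have uS: "(u, 0) \<notin> S"
  proof
    assume "(u, 0) \<in> S"
    then obtain p q where "(u, 0) = csc p E + csc q (ccnj E)" unfolding S_def by blast
    then have "u = fst (csc p E + csc q (ccnj E))" by (metis fst_conv)
    then have "u = Re p *\<^sub>R fst E - Im p *\<^sub>R snd E + (Re q *\<^sub>R fst E + Im q *\<^sub>R snd E)"
      by (simp add: csc_def ccnj_def)
    also have "\<dots> \<in> span {fst E, snd E}"
      by (intro span_add span_diff span_scale span_base) auto
    finally show False using u by simp
  qed
  have "foldr (char_op (br x)) zs (u, 0) \<in> S" using zs[OF um] S0 by simp
  then have "\<exists>z w. w \<in> ?m \<times> ?m \<and> w \<notin> S \<and> char_op (br x) z w \<in> S"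
    using char_op_mem[OF subspace_image ad_image[OF x(1)]] by (rule exists_eigenvector_mod[OF linear_right um uS])
  then obtain z F where F: "F \<in> ?m \<times> ?m" "F \<notin> S" "char_op (br x) z F \<in> S" by blast
  then obtain p q where "char_op (br x) z F = csc p E + csc q (ccnj E)" unfolding S_def by blast
  then have xF: "cbr (x, 0) F = csc z F + csc p E + csc q (ccnj E)"
    by (simp add: char_op_def cbr_real algebra_simps)
  show False
  proof (cases "z = - (\<i> * of_real B)")
    case False
    then show False using main[OF F(1,2) xF] by blast
  next
    case True
    \<comment> \<open>Conjugation turns the resonance at - i B into the one at i B.\<close>
    have "cbr (x, 0) (ccnj F) = ccnj (cbr (x, 0) F)"
      by (simp add: ccnj_cbr) (simp add: ccnj_def)
    also have "\<dots> = csc (\<i> * of_real B) (ccnj F) + csc (cnj q) E + csc (cnj p) (ccnj E)"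
      unfolding xF True ccnj_add ccnj_csc ccnj_ccnj by (simp add: add_ac)
    finally have "cbr (x, 0) (ccnj F) = csc (\<i> * of_real B) (ccnj F) + csc (cnj q) E + csc (cnj p) (ccnj E)" .
    moreover have "\<i> * of_real B \<noteq> - (\<i> * of_real B)" using B by (simp add: complex_eq_iff)
    moreover have "ccnj F \<notin> S" using F(2) S_cnj by blast
    ultimately show False using main[OF ccnj_mem[OF subspace_image F(1)]] by blast
  qed
qed

end

text \<open>The eigenvalues on the complexified image form a finite nonempty set of nonzero
  imaginary numbers, closed under conjugation. An eigenvector v for z nonzero equals 1/z times
  [x, v], so it lies in the image wherever in \<open>V \<times> V\<close> it was taken; hence the
  bound holds there too.\<close>

lemma exists_top_eigenvector:
  assumes x: "x \<in> V" "x \<notin> centre V"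
  obtains B E where "B > 0" "E \<in> br x ` V \<times> br x ` V" "E \<noteq> 0" "cbr (x, 0) E = csc (\<i> * of_real B) E"
    "\<And>v z. \<lbrakk>v \<in> V \<times> V; v \<noteq> 0; cbr (x, 0) v = csc z v; z \<noteq> 0\<rbrakk> \<Longrightarrow> Re z = 0 \<and> \<bar>Im z\<bar> \<le> B"
proof -
  let ?m = "br x ` V"
  define \<Lambda> where "\<Lambda> = {z. \<exists>v\<in>?m \<times> ?m. v \<noteq> 0 \<and> cbr (x, 0) v = csc z v}"
  obtain zs where zs: "\<And>v. v \<in> ?m \<times> ?m \<Longrightarrow> foldr (char_op (br x)) zs v = 0"
    using exists_char_ops_eq_0[OF linear_right fin_dim_subset[OF VD(2) image_subset[OF x(1)]]
        ad_image[OF x(1)]] by blast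
  have "\<Lambda> \<subseteq> set zs"
  proof
    fix z assume "z \<in> \<Lambda>"
    then obtain v where v: "v \<in> ?m \<times> ?m" "v \<noteq> 0" "cbr (x, 0) v = csc z v" unfolding \<Lambda>_def by blast
    show "z \<in> set zs"
      using eigenvalue_in_roots[OF linear_right v(3)[unfolded cbr_real] v(2) zs[OF v(1)]] .
  qed
  then have fin: "finite (Im ` \<Lambda>)" by (simp add: finite_subset)
  obtain z0 v0 where "v0 \<in> ?m \<times> ?m" "v0 \<noteq> 0" "cbr (x, 0) v0 = csc z0 v0"
    by (rule exists_eigenvector[OF x])
  then have ne: "\<Lambda> \<noteq> {}" unfolding \<Lambda>_def by blast
  have imag: "Re z = 0" "Im z \<noteq> 0" if "z \<in> \<Lambda>" for z
  proof -
    obtain v where v: "v \<in> ?m \<times> ?m" "v \<noteq> 0" "cbr (x, 0) v = csc z v"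
      using \<open>z \<in> \<Lambda>\<close> unfolding \<Lambda>_def by blast
    show "Re z = 0" by (rule eigenvector_bracket[OF x v])
    show "Im z \<noteq> 0" by (rule eigenvector_bracket[OF x v])
  qed
  have cnj: "cnj z \<in> \<Lambda>" if "z \<in> \<Lambda>" for z
  proof -
    obtain v where v: "v \<in> ?m \<times> ?m" "v \<noteq> 0" "cbr (x, 0) v = csc z v"
      using \<open>z \<in> \<Lambda>\<close> unfolding \<Lambda>_def by blast
    show ?thesis
      unfolding \<Lambda>_def using ccnj_mem[OF subspace_image v(1)] v(2) weight_cnj[OF v(3)]
      by (intro CollectI bexI[of _ "ccnj v"] conjI) simp_all
  qed
  define B where "B = Max (Im ` \<Lambda>)"
  have le: "\<bar>Im z\<bar> \<le> B" if "z \<in> \<Lambda>" for z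
  proof -
    have "Im z \<in> Im ` \<Lambda>" "Im (cnj z) \<in> Im ` \<Lambda>" using that cnj by blast+
    then have "Im z \<le> B" "Im (cnj z) \<le> B"
      unfolding B_def by - (rule Max_ge[OF fin], assumption)+
    then show ?thesis by simp
  qed
  have "B \<in> Im ` \<Lambda>" unfolding B_def using fin ne by (intro Max_in) auto
  then obtain z where z: "z \<in> \<Lambda>" "Im z = B" by auto
  then have B: "B > 0" using imag(2)[OF z(1)] le[OF z(1)] by simp
  have zB: "z = \<i> * of_real B" using z imag(1) by (simp add: complex_eq_iff)
  obtain E where E: "E \<in> ?m \<times> ?m" "E \<noteq> 0" "cbr (x, 0) E = csc z E"
    using z(1) unfolding \<Lambda>_def by blast
  have max: "Re z = 0 \<and> \<bar>Im z\<bar> \<le> B" if v: "v \<in> V \<times> V" "v \<noteq> 0" "cbr (x, 0) v = csc z v" "z \<noteq> 0" for v z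
  proof -
    have "cbr (x, 0) v \<in> ?m \<times> ?m" using v(1) unfolding cbr_real by (cases v) auto
    then have "csc (inverse z) (csc z v) \<in> ?m \<times> ?m"
      unfolding v(3) by (rule csc_mem[OF subspace_image])
    then have "v \<in> ?m \<times> ?m" using v(4) by simp
    then have "z \<in> \<Lambda>" unfolding \<Lambda>_def using v(2,3) by blast
    then show ?thesis using imag(1) le by blast
  qed
  show ?thesis
    by (rule that[OF B E[unfolded zB] max])
qed

lemma br_span_closed:
  assumes "\<And>a b. a \<in> G \<Longrightarrow> b \<in> G \<Longrightarrow> br a b \<in> span G" "x \<in> span G" "y \<in> span G"
  shows "br x y \<in> span G"
proof -
  have 1: "br a y \<in> span G" if "a \<in> G" for a
    using assms(3)
  proof (induction rule: span_induct_alt)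
    case (step c b y)
    then show ?case using assms(1)[OF that] by (auto intro!: span_add span_scale)
  qed (simp add: span_zero)
  show ?thesis
    using assms(2)
  proof (induction rule: span_induct_alt)
    case (step c a x)
    then show ?case using 1 by (auto intro!: span_add span_scale)
  qed (simp add: span_zero)
qed

text \<open>With q = [y, w] = a x + c, ad q rotates the plane of y and w with speed s = - a B > 0,
  and a rescaling gives so(3). Since V is the sum of this so(3) and the centre, all brackets lie in
  the so(3), and perfectness leaves no room for the centre.\<close>

lemma exists_so3_triple:
  assumes x: "x \<in> V" "x \<notin> centre V"
  obtains e1 e2 e3 where "so3_triple e1 e2 e3" "span {e1, e2, e3} = V"
proof -
  let ?m = "br x ` V"
  obtain B E where B: "B > 0" and E: "E \<in> ?m \<times> ?m" "E \<noteq> 0" "cbr (x, 0) E = csc (\<i> * of_real B) E"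
    and max: "\<And>v z. \<lbrakk>v \<in> V \<times> V; v \<noteq> 0; cbr (x, 0) v = csc z v; z \<noteq> 0\<rbrakk> \<Longrightarrow> Re z = 0 \<and> \<bar>Im z\<bar> \<le> B"
    using exists_top_eigenvector[OF x] by blast
  have im: "?m \<subseteq> span {fst E, snd E}"
    using image_subset_span[OF x B E] max by blast
  obtain a c where a: "c \<in> centre V" "br (fst E) (snd E) = a *\<^sub>R x + c" "a * Im (\<i> * of_real B) < 0"
    by (rule eigenvector_bracket[OF x E])
  define y w q s where "y = fst E" and "w = snd E" and "q = br y w" and "s = - (a * B)"
  have s: "s > 0" using a(3) by (simp add: s_def)
  then have a0: "a \<noteq> 0" by (auto simp: s_def)
  have yw: "y \<in> ?m" "w \<in> ?m" using E(1) by (auto simp: y_def w_def mem_Times_iff)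
  have ywV: "y \<in> V" "w \<in> V" by (rule subsetD[OF image_subset[OF x(1)]], rule yw)+
  then have V3: "y \<in> V" "w \<in> V" "q \<in> V" using VD(3) by (simp_all add: q_def)
  have xy: "br x y = - (B *\<^sub>R w)" "br x w = B *\<^sub>R y"
    using E(3) unfolding cbr_real by (auto simp: csc_def prod_eq_iff y_def w_def)
  have c: "br c u = 0" if "u \<in> V" for u using a(1) that by (simp add: centre_def)
  have qx: "q = a *\<^sub>R x + c" using a(2) by (simp add: q_def y_def w_def)
  have qy: "br q y = s *\<^sub>R w" and qw: "br q w = - (s *\<^sub>R y)"
    by (simp_all add: qx c V3 xy s_def)
  then have wq: "br w q = s *\<^sub>R y" using br_skew[of w q] by simp
  \<comment> \<open>[q, y] = s w forces the factor 1/s for q; then [y, w] = q requires the factors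
    of y and w to have product 1/s, and positivity of s provides the root.\<close>
  define e1 e2 e3 where "e1 = (1 / s) *\<^sub>R q" and "e2 = (1 / sqrt s) *\<^sub>R y" and "e3 = (1 / sqrt s) *\<^sub>R w"
  have ss: "sqrt s * sqrt s = s" "sqrt s \<noteq> 0" using s by auto
  have br: "br e1 e2 = e3" "br e2 e3 = e1" "br e3 e1 = e2"
    using s ss by (simp_all add: e1_def e2_def e3_def qy wq flip: q_def)
  have e3V: "e1 \<in> V" "e2 \<in> V" "e3 \<in> V"
    using V3 VD(1) by (simp_all add: e1_def e2_def e3_def subspace_scale)
  have "e1 \<noteq> 0"
  proof
    assume "e1 = 0"
    then have "e2 = 0" "e3 = 0" using br(1,3) by auto
    then have "E = 0" using ss(2) by (simp add: e2_def e3_def y_def w_def prod_eq_iff)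
    then show False using E(2) by simp
  qed
  then have triple: "so3_triple e1 e2 e3" using br by (simp add: so3_triple_def)
  let ?G = "{e1, e2, e3}"
  have neg: "br e2 e1 = - e3" "br e3 e2 = - e1" "br e1 e3 = - e2"
    using br_skew[of e2 e1] br_skew[of e3 e2] br_skew[of e1 e3] by (simp_all add: br)
  have sp: "e1 \<in> span ?G" "e2 \<in> span ?G" "e3 \<in> span ?G"
    by (auto intro: span_base)
  have G: "br g h \<in> span ?G" if "g \<in> ?G" "h \<in> ?G" for g h
    using that by (elim insertE emptyE) (simp_all add: br neg sp span_zero span_neg)
  have q: "q = s *\<^sub>R e1" and y: "y = sqrt s *\<^sub>R e2" and w: "w = sqrt s *\<^sub>R e3"
    using s by (simp_all add: e1_def e2_def e3_def)
  have ywG: "span {y, w} \<subseteq> span ?G"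
    unfolding y w by (intro span_minimal) (auto intro: span_scale span_base)
  have decomp: "\<exists>h d. h \<in> span ?G \<and> d \<in> centre V \<and> v = h + d" if v: "v \<in> V" for v
  proof -
    obtain u t where u: "u \<in> centraliser V x" "t \<in> V" "v = u + br x t"
      by (rule centraliser_plus_image[OF V H x(1) v])
    obtain r d where d: "d \<in> centre V" "u = r *\<^sub>R x + d"
      by (rule centraliser_eq[OF x u(1)])
    have "x = (1 / a) *\<^sub>R q + (- 1 / a) *\<^sub>R c"
      using a0 by (simp add: qx scaleR_add_right)
    then have "v = ((r / a * s) *\<^sub>R e1 + br x t) + ((- r / a) *\<^sub>R c + d)"
      unfolding u(3) d(2) using q by (simp add: scaleR_add_right scaleR_diff_right)
    moreover have "(r / a * s) *\<^sub>R e1 + br x t \<in> span ?G"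
      using im ywG u(2) unfolding y_def w_def by (intro span_add span_scale) (auto intro: span_base)
    moreover have "(- r / a) *\<^sub>R c + d \<in> centre V"
      using a(1) d(1) by (intro subspace_add[OF subspace_centre] subspace_scale[OF subspace_centre])
    ultimately show ?thesis by blast
  qed
  have "{br u v | u v. u \<in> V \<and> v \<in> V} \<subseteq> span ?G"
  proof clarify
    fix u v assume uv: "u \<in> V" "v \<in> V"
    obtain h d where h: "h \<in> span ?G" "d \<in> centre V" "u = h + d" using decomp[OF uv(1)] by blast
    obtain k e where k: "k \<in> span ?G" "e \<in> centre V" "v = k + e" using decomp[OF uv(2)] by blast
    have hV: "h \<in> V"
      using h(1) span_minimal[of ?G V] e3V VD(1) by blast
    have "br d v = 0" "br h e = 0"
      using h(2) k(2) uv(2) hV br_skew[of h e] by (auto simp: centre_def)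
    then have "br u v = br h k" unfolding h(3) by (simp add: k(3))
    then show "br u v \<in> span ?G" using br_span_closed[OF G h(1) k(1)] by simp
  qed
  then have "span {br u v | u v. u \<in> V \<and> v \<in> V} \<subseteq> span ?G"
    by (rule span_minimal[OF _ subspace_span])
  moreover have "\<not> abelian V"
    using x unfolding centre_def abelian_def by blast
  ultimately have "V \<subseteq> span ?G"
    using perfect_if_not_abelian[OF V H] by simp
  moreover have "span ?G \<subseteq> V" using e3V VD(1) by (intro span_minimal) auto
  ultimately show ?thesis using that[OF triple] by blast
qed

end

section \<open>Triples spanning so(3) and the induction on the dimension\<close>

lemma so3_triple_bracket:
  assumes "so3_triple e1 e2 e3"
  shows "br e1 e2 = e3" "br e2 e3 = e1" "br e3 e1 = e2" "br e2 e1 = - e3" "br e3 e2 = - e1" "br e1 e3 = - e2"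
  using assms br_skew[of e2 e1] br_skew[of e3 e2] br_skew[of e1 e3] unfolding so3_triple_def by auto

lemma so3_triple_nonzero: "so3_triple e1 e2 e3 \<Longrightarrow> e1 \<noteq> 0 \<and> e2 \<noteq> 0 \<and> e3 \<noteq> 0"
  unfolding so3_triple_def by auto

text \<open>so(3) has trivial centre. When the combination is itself 0, the lemma says that the
  triple is linearly independent.\<close>

lemma so3_triple_centraliser:
  assumes t: "so3_triple e1 e2 e3" and e: "br (a *\<^sub>R e1 + b *\<^sub>R e2 + c *\<^sub>R e3) e1 = 0"
    "br (a *\<^sub>R e1 + b *\<^sub>R e2 + c *\<^sub>R e3) e2 = 0"
  shows "a = 0 \<and> b = 0 \<and> c = 0"
proof -
  note nz = so3_triple_nonzero[OF t] and b = so3_triple_bracket[OF t]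
  have e': "c *\<^sub>R e2 = b *\<^sub>R e3" "a *\<^sub>R e3 = c *\<^sub>R e1"
    using e by (simp_all add: b)
  have "br e2 (c *\<^sub>R e2) = br e2 (b *\<^sub>R e3)" "br e1 (a *\<^sub>R e3) = br e1 (c *\<^sub>R e1)"
    unfolding e' by simp_all
  then have "b = 0" "a = 0" using nz by (simp_all add: b)
  then show ?thesis using e'(1) nz by simp
qed

text \<open>By induction the centraliser of a noncentral x is abelian or so(3). The second is
  impossible, because x is central in its own centraliser.\<close>

theorem stably_contact_cases:
  assumes "subalgebra V" "stably_contact V"
  shows "abelian V \<or> (\<exists>e1 e2 e3. so3_triple e1 e2 e3 \<and> span {e1, e2, e3} = V)"
  using assms
proof (induction "dim V" arbitrary: V rule: less_induct)
  case less
  note VD = subalgebraD[OF less.prems(1)]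
  show ?case
  proof (cases "\<exists>x\<in>V. x \<notin> centre V")
    case False
    then have "abelian V" unfolding abelian_def centre_def by blast
    then show ?thesis ..
  next
    case True
    have ab: "abelian (centraliser V x)" if x: "x \<in> V" "x \<notin> centre V" for x
    proof -
      let ?c = "centraliser V x"
      note c = subalgebra_centraliser[OF less.prems(1) x(1)]
      have xc: "x \<in> ?c" using x(1) by (simp add: centraliser_def)
      have "?c \<noteq> V"
      proof
        assume "?c = V"
        then have "x \<in> centre V" using x(1) unfolding centre_def centraliser_def by blast
        then show False using x(2) by simp
      qed
      then have "dim ?c < dim V"
        using dim_psubspace[OF VD(2,1) subalgebraD(1)[OF c]] unfolding centraliser_def by blast
      then have "abelian ?c \<or> (\<exists>e1 e2 e3. so3_triple e1 e2 e3 \<and> span {e1, e2, e3} = ?c)"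
        using less.hyps c stably_contact_centraliser[OF less.prems x(1)] by blast
      then show ?thesis
      proof
        assume "\<exists>e1 e2 e3. so3_triple e1 e2 e3 \<and> span {e1, e2, e3} = ?c"
        then obtain e1 e2 e3 where t: "so3_triple e1 e2 e3" and sp: "span {e1, e2, e3} = ?c" by blast
        obtain a b d where abd: "x = a *\<^sub>R e1 + b *\<^sub>R e2 + d *\<^sub>R e3"
          using xc unfolding sp[symmetric] by (auto simp: span_insert algebra_simps)
        have "e1 \<in> ?c" "e2 \<in> ?c" unfolding sp[symmetric] by (auto intro: span_base)
        then have "br x e1 = 0" "br x e2 = 0" by (auto simp: centraliser_def)
        then have "x = 0" using so3_triple_centraliser[OF t, of a b d] abd by simp
        then show ?thesis using x(2) VD(1) by (simp add: centre_def subspace_0)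
      qed
    qed
    obtain x where "x \<in> V" "x \<notin> centre V" using True by blast
    then obtain e1 e2 e3 where "so3_triple e1 e2 e3" "span {e1, e2, e3} = V"
      using exists_so3_triple[OF less.prems ab] by blast
    then show ?thesis by blast
  qed
qed

end

section \<open>Height zero and the model algebras\<close>

text \<open>Jacobi survives the projection of the arguments, because brackets lie in the carrier,
  where the projection is the identity.\<close>

lemma (in lie_algebra) exists_global_bracket:
  obtains br where "lie_bracket br" "\<And>x y. \<lbrakk>x \<in> carrier \<gg>; y \<in> carrier \<gg>\<rbrakk> \<Longrightarrow> br x y = bracket \<gg> x y"
proof -
  let ?V = "carrier \<gg>"
  obtain B where B: "B \<subseteq> ?V" "independent B" "?V \<subseteq> span B"
    using maximal_independent_subset by blast
  have sp: "span B = ?V" using B subspace_carrier by (simp add: span_subspace)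
  obtain p where p: "linear p" "\<forall>x\<in>B. p x = x" "range p = span B"
    using linear_independent_extend_subspace[OF B(2), of "\<lambda>x. x"] by auto
  have pV: "p x \<in> ?V" for x using p(3) sp by blast
  have pid: "p x = x" if "x \<in> ?V" for x
    using linear_eq_on_span[OF p(1) linear_ident, of B x] p(2) that sp by simp
  define br where "br x y = bracket \<gg> (p x) (p y)" for x y
  have brV: "br x y \<in> ?V" for x y unfolding br_def by (rule bracket_closed[OF pV pV])
  have "lie_bracket br"
  proof (rule lie_bracket.intro)
    show "linear (\<lambda>x. br x y)" for y
      by (intro linearI) (simp_all add: br_def linear_add[OF p(1)] linear_cmul[OF p(1)] bracket_add_left
          bracket_scale_left pV)
    show "linear (br x)" for x
      by (intro linearI) (simp_all add: br_def linear_add[OF p(1)] linear_cmul[OF p(1)] bracket_add_right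
          bracket_scale_right pV)
    show "br x x = 0" for x
      by (simp add: br_def bracket_self pV)
    show "br x (br y z) + br y (br z x) + br z (br x y) = 0" for x y z
      using jacobi[OF pV pV pV, of x y z] by (simp add: br_def pid bracket_closed pV)
  qed
  moreover have "br x y = bracket \<gg> x y" if "x \<in> ?V" "y \<in> ?V" for x y
    using that by (simp add: br_def pid)
  ultimately show ?thesis using that by blast
qed

text \<open>Used with the map going out of a model algebra, where coordinates make it explicit and
  linear on the whole type.\<close>

lemma lie_isomorphic_sym:
  assumes "lie_algebra \<hh>" "linear \<psi>" "bij_betw \<psi> (carrier \<hh>) (carrier \<gg>)"
    and hom: "\<And>x y. \<lbrakk>x \<in> carrier \<hh>; y \<in> carrier \<hh>\<rbrakk> \<Longrightarrow> \<psi> (bracket \<hh> x y) = bracket \<gg> (\<psi> x) (\<psi> y)"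
  shows "\<gg> \<cong>\<^sub>L \<hh>"
proof -
  interpret h: lie_algebra \<hh> by (rule assms(1))
  let ?H = "carrier \<hh>" and ?G = "carrier \<gg>" and ?f = "inv_into (carrier \<hh>) \<psi>"
  have inj: "inj_on \<psi> ?H" and im: "\<psi> ` ?H = ?G" using assms(3) by (auto simp: bij_betw_def)
  have fH: "?f x \<in> ?H" if "x \<in> ?G" for x using that im inv_into_into by metis
  have \<psi>f: "\<psi> (?f x) = x" if "x \<in> ?G" for x using that im f_inv_into_f by metis
  have f: "?f x = y" if "y \<in> ?H" "\<psi> y = x" for x y using that inj by (simp add: inv_into_f_eq)
  have "lie_isomorphism ?f \<gg> \<hh>"
    unfolding lie_isomorphism_def
  proof (intro conjI ballI allI)
    show "bij_betw ?f ?G ?H" by (rule bij_betw_inv_into[OF assms(3)])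
    fix x assume x: "x \<in> ?G"
    show "?f (c *\<^sub>R x) = c *\<^sub>R ?f x" for c
      using x by (intro f) (simp_all add: subspace_scale[OF h.subspace_carrier] fH linear_cmul[OF assms(2)] \<psi>f)
    fix y assume y: "y \<in> ?G"
    show "?f (x + y) = ?f x + ?f y"
      using x y by (intro f) (simp_all add: subspace_add[OF h.subspace_carrier] fH linear_add[OF assms(2)] \<psi>f)
    show "?f (bracket \<gg> x y) = bracket \<hh> (?f x) (?f y)"
      using x y by (intro f) (simp_all add: h.bracket_closed fH hom \<psi>f)
  qed
  then show ?thesis unfolding lie_isomorphic_def by blast
qed

lemma Rn_parametrisation:
  fixes V :: "'a::real_vector set"
  assumes "fin_dim V" "subspace V"
  obtains n \<psi> where "linear \<psi>" "bij_betw \<psi> (Rn n) V"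
proof -
  obtain B where B: "finite B" "independent B" "span B = V"
    using fin_dim_basis[OF assms independent_empty empty_subsetI] by blast
  obtain b where b: "bij_betw b {0..<card B} B"
    using ex_bij_betw_nat_finite[OF B(1)] by blast
  define n where "n = card B"
  have b: "bij_betw b {..<n} B" using b by (simp add: n_def atLeast0LessThan)
  obtain f where f: "\<And>b::'a. linear (f b)"
    "\<And>b c. \<lbrakk>b \<in> B; c \<in> B\<rbrakk> \<Longrightarrow> f b c = (if b = c then 1 else (0::real))"
    "\<And>x. x \<in> span B \<Longrightarrow> (\<Sum>b\<in>B. f b x *\<^sub>R b) = x"
    using coordinate_functionals[OF B(1,2)] by blast
  define \<psi> where "\<psi> x = (\<Sum>i<n. Poly_Mapping.lookup x i *\<^sub>R b i)" for x
  have lin: "linear \<psi>"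
    by (intro linearI)
      (simp_all add: \<psi>_def lookup_add lookup_scaleR scaleR_add_left sum.distrib scaleR_sum_right)
  have bB: "b i \<in> B" if "i < n" for i using b that by (auto simp: bij_betw_def)
  have fb: "f (b i) (b j) = (if i = j then 1 else 0)" if "i < n" "j < n" for i j
    using f(2)[OF bB[OF that(1)] bB[OF that(2)]] b that by (auto simp: bij_betw_def inj_on_def)
  have coord: "f (b i) (\<psi> x) = Poly_Mapping.lookup x i" if "i < n" for i x
    unfolding \<psi>_def using that by (simp add: linear_sum[OF f(1)] linear_cmul[OF f(1)] fb if_distrib cong: if_cong)
  have "inj_on \<psi> (Rn n)"
  proof (rule inj_onI, rule poly_mapping_eqI)
    fix x y i assume xy: "x \<in> Rn n" "y \<in> Rn n" "\<psi> x = \<psi> y"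
    show "Poly_Mapping.lookup x i = Poly_Mapping.lookup y i"
    proof (cases "i < n")
      case True
      then show ?thesis using coord[of i x] coord[of i y] xy(3) by simp
    next
      case False
      then have "i \<notin> Poly_Mapping.keys x" "i \<notin> Poly_Mapping.keys y" using xy unfolding Rn_def by auto
      then show ?thesis by (simp add: in_keys_iff)
    qed
  qed
  moreover have "\<psi> ` Rn n = V"
  proof
    show "\<psi> ` Rn n \<subseteq> V"
    proof clarify
      fix x
      show "\<psi> x \<in> V"
        unfolding \<psi>_def B(3)[symmetric] by (intro span_sum span_scale span_base bB) simp
    qed
    show "V \<subseteq> \<psi> ` Rn n"
    proof
      fix v assume v: "v \<in> V"
      define x where "x = (\<Sum>i<n. Poly_Mapping.single i (f (b i) v))"
      have lk: "Poly_Mapping.lookup x i = (if i < n then f (b i) v else 0)" for i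
        unfolding x_def by (simp add: lookup_sum lookup_single when_def)
      have xR: "x \<in> Rn n" unfolding Rn_def by (auto simp: in_keys_iff lk split: if_splits)
      have "\<psi> x = (\<Sum>i<n. f (b i) v *\<^sub>R b i)" by (simp add: \<psi>_def lk)
      also have "\<dots> = (\<Sum>c\<in>B. f c v *\<^sub>R c)" by (rule sum.reindex_bij_betw[OF b])
      also have "\<dots> = v" using f(3) v B(3) by simp
      finally show "v \<in> \<psi> ` Rn n" using xR by blast
    qed
  qed
  ultimately show ?thesis using that[OF lin] by (simp add: bij_betw_def)
qed

section \<open>Height zero\<close>

lemma wedge1_pow2_1: "wedge1 \<xi> (pow2 \<omega> (Suc 0)) [u, v, w] = \<xi> u * \<omega> v w - \<xi> v * \<omega> u w + \<xi> w * \<omega> u v"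
  by simp

lemma pow2_2: "pow2 \<omega> (Suc (Suc 0)) [u, v, w, x] = 2 * (\<omega> u v * \<omega> w x - \<omega> u w * \<omega> v x + \<omega> u x * \<omega> v w)"
  by (simp add: algebra_simps)

context lie_bracket
begin

text \<open>Every vector is an eigenvector of ad e modulo e, so ad e is scalar there, and e is
  normalised to make the scalar 1. If u and w are eigenvectors for 1, then [u, w] has eigenvalue 2
  by Leibniz and 1 as an element of their span, so it vanishes.\<close>

lemma height_0_dichotomy:
  assumes V: "subalgebra V"
    and zero: "\<And>\<xi> X. linear \<xi> \<Longrightarrow> set X \<subseteq> V \<Longrightarrow> wedge1 \<xi> (pow2 (dform \<xi>) (Suc 0)) X = 0"
    and na: "\<not> abelian V"
  obtains e where "e \<in> V" "e \<noteq> 0" "\<And>v. v \<in> V \<Longrightarrow> \<exists>b u. u \<in> V \<and> br e u = u \<and> v = b *\<^sub>R e + u"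
    "\<And>u w. \<lbrakk>u \<in> V; w \<in> V; br e u = u; br e w = w\<rbrakk> \<Longrightarrow> br u w = 0"
proof -
  note VD = subalgebraD[OF V]
  have line: "br x y \<in> span {x, y}" if xy: "x \<in> V" "y \<in> V" for x y
  proof (rule ccontr)
    assume "br x y \<notin> span {x, y}"
    then obtain \<xi> :: "'a \<Rightarrow> real" where \<xi>: "linear \<xi>" "\<And>w. w \<in> span {x, y} \<Longrightarrow> \<xi> w = 0" "\<xi> (br x y) = 1"
      using separating_functional[OF subspace_span] by blast
    have "\<xi> x = 0" "\<xi> y = 0" using \<xi>(2) by (auto intro: span_base)
    \<comment> \<open>The value of \<xi> \<and> d\<xi> at ([x, y], x, y) is \<xi>([x, y]) d\<xi>(x,
      y) = -1.\<close>
    then show False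
      using zero[OF \<xi>(1), of "[br x y, x, y]"] xy VD(3) \<xi>(3) unfolding wedge1_pow2_1 by (simp add: dform_def)
  qed
  have line2: "\<exists>a b. br x y = a *\<^sub>R x + b *\<^sub>R y" if xy: "x \<in> V" "y \<in> V" for x y
  proof -
    obtain a where "br x y - a *\<^sub>R x \<in> span {y}" using line[OF xy] by (auto simp: span_insert)
    then obtain b where "br x y - a *\<^sub>R x = b *\<^sub>R y" by (auto simp: span_singleton)
    then have "br x y = a *\<^sub>R x + b *\<^sub>R y" by (simp add: algebra_simps)
    then show ?thesis by blast
  qed
  obtain x0 y0 where xy0: "x0 \<in> V" "y0 \<in> V" "br x0 y0 \<noteq> 0" using na unfolding abelian_def by blast
  define f where "f = br x0 y0"
  have f: "f \<in> V" "f \<noteq> 0" using xy0 VD(3) by (auto simp: f_def)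
  obtain a b where ab: "f = a *\<^sub>R x0 + b *\<^sub>R y0" using line2[OF xy0(1,2)] unfolding f_def by blast
  have "\<exists>e\<in>V. br e f = f"
  proof (cases "b = 0")
    case False
    have "br x0 f = br x0 (a *\<^sub>R x0 + b *\<^sub>R y0)" by (simp only: ab)
    also have "\<dots> = b *\<^sub>R f" by (simp add: f_def)
    finally show ?thesis
      using False xy0 VD(1) by (intro bexI[of _ "(1 / b) *\<^sub>R x0"]) (simp_all add: subspace_scale)
  next
    case True
    then have "a \<noteq> 0" using ab f by auto
    have "br y0 f = br y0 (a *\<^sub>R x0 + b *\<^sub>R y0)" by (simp only: ab)
    also have "\<dots> = - (a *\<^sub>R f)" using br_skew[of y0 x0] by (simp add: f_def)
    finally show ?thesis
      using \<open>a \<noteq> 0\<close> xy0 VD(1) by (intro bexI[of _ "(- 1 / a) *\<^sub>R y0"]) (simp_all add: subspace_scale subspace_neg)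
  qed
  then obtain e where e: "e \<in> V" "br e f = f" by blast
  have e0: "e \<noteq> 0" using e f by auto
  have indep: "c = 0 \<and> d = 0" if "c *\<^sub>R e + d *\<^sub>R f = 0" for c d
  proof -
    have "br e (c *\<^sub>R e + d *\<^sub>R f) = 0" unfolding that by simp
    then have "d = 0" using e f by simp
    then show ?thesis using that e0 by simp
  qed
  have shift: "\<exists>b. br e v = v + b *\<^sub>R e" if v: "v \<in> V" for v
  proof (cases "\<exists>c d. v = c *\<^sub>R e + d *\<^sub>R f")
    case True
    then obtain c d where "v = c *\<^sub>R e + d *\<^sub>R f" by blast
    then have "br e v = v + (- c) *\<^sub>R e" using e by simp
    then show ?thesis by blast
  next
    case False
    \<comment> \<open>The multipliers of v, f and v + f are compared: outside the plane of e and f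
      they must agree, and the one of f is 1.\<close>
    obtain a b where ab: "br e v = a *\<^sub>R e + b *\<^sub>R v" using line2[OF e(1) v] by blast
    have "v + f \<in> V" using v f VD(1) by (simp add: subspace_add)
    then obtain a' b' where ab': "br e (v + f) = a' *\<^sub>R e + b' *\<^sub>R (v + f)" using line2[OF e(1)] by blast
    have eq: "(b - b') *\<^sub>R v = (a' - a) *\<^sub>R e + (b' - 1) *\<^sub>R f"
      using ab ab' e(2) by (simp add: algebra_simps)
    have "b = b'"
    proof (rule ccontr)
      assume "b \<noteq> b'"
      then have "v = (1 / (b - b')) *\<^sub>R ((b - b') *\<^sub>R v)" by simp
      also have "\<dots> = ((a' - a) / (b - b')) *\<^sub>R e + ((b' - 1) / (b - b')) *\<^sub>R f"
        unfolding eq by (simp add: scaleR_add_right)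
      finally show False using False by blast
    qed
    then have "(a' - a) *\<^sub>R e + (b' - 1) *\<^sub>R f = 0" using eq by simp
    then have "b' - 1 = 0" using indep by blast
    then show ?thesis using ab \<open>b = b'\<close> by (auto simp: add.commute)
  qed
  show ?thesis
  proof (rule that[OF e(1) e0])
    fix v assume v: "v \<in> V"
    obtain b where b: "br e v = v + b *\<^sub>R e" using shift[OF v] by blast
    let ?u = "v + b *\<^sub>R e"
    have "?u \<in> V" using v e VD(1) by (simp add: subspace_add subspace_scale)
    moreover have "br e ?u = ?u" using b by simp
    moreover have "v = (- b) *\<^sub>R e + ?u" by simp
    ultimately show "\<exists>b u. u \<in> V \<and> br e u = u \<and> v = b *\<^sub>R e + u" by blast
  next
    fix u w assume uw: "u \<in> V" "w \<in> V" "br e u = u" "br e w = w"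
    obtain a b where ab: "br u w = a *\<^sub>R u + b *\<^sub>R w" using line2[OF uw(1,2)] by blast
    have "br e (br u w) = br u w" unfolding ab using uw by simp
    moreover have "br e (br u w) = br u w + br u w" using br_leibniz[of e u w] uw by simp
    ultimately show "br u w = 0" by simp
  qed
qed

end

lemma linear_mem_lie_dual: "linear \<xi> \<Longrightarrow> \<xi> \<in> lie_dual \<gg>"
  by (simp add: lie_dual_def linear_add linear_cmul)

lemma abelian_isomorphic_Rn:
  fixes \<gg> :: "'a::real_vector lie_alg"
  assumes "lie_algebra \<gg>" "\<And>x y. \<lbrakk>x \<in> carrier \<gg>; y \<in> carrier \<gg>\<rbrakk> \<Longrightarrow> bracket \<gg> x y = 0"
  shows "\<exists>n. \<gg> \<cong>\<^sub>L Rn_lie n"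
proof -
  interpret lie_algebra \<gg> by (rule assms(1))
  have "fin_dim (carrier \<gg>)" using finite_dim unfolding fin_dim_def by blast
  then obtain n and \<psi> :: "_ \<Rightarrow> 'a" where \<psi>: "linear \<psi>" "bij_betw \<psi> (Rn n) (carrier \<gg>)"
    using Rn_parametrisation[OF _ subspace_carrier] by blast
  have "\<gg> \<cong>\<^sub>L Rn_lie n"
  proof (rule lie_isomorphic_sym[OF lie_algebra_Rn \<psi>(1)])
    show b: "bij_betw \<psi> (carrier (Rn_lie n)) (carrier \<gg>)"
      using \<psi>(2) by (simp add: Rn_lie_def abelian_lie_def)
    fix x y assume "x \<in> carrier (Rn_lie n)" "y \<in> carrier (Rn_lie n)"
    then have "\<psi> x \<in> carrier \<gg>" "\<psi> y \<in> carrier \<gg>" using b by (auto simp: bij_betw_def)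
    then show "\<psi> (bracket (Rn_lie n) x y) = bracket \<gg> (\<psi> x) (\<psi> y)"
      using assms(2) linear_0[OF \<psi>(1)] by (simp add: Rn_lie_def abelian_lie_def)
  qed
  then show ?thesis by blast
qed

section \<open>Coordinates in the model algebras and their heights\<close>

lemma R_semidirect_Rn_simps:
  "carrier (R_semidirect_Rn_lie n) = UNIV \<times> Rn n"
  "bracket (R_semidirect_Rn_lie n) v w = (0, fst v *\<^sub>R snd w - fst w *\<^sub>R snd v)"
  by (simp_all add: R_semidirect_Rn_lie_def Rn_lie_def semidirect_lie_def abelian_lie_def case_prod_beta)

text \<open>The matrix of the cross product with (a, b, c), so that commutators become cross
  products of coordinate vectors.\<close>

definition skew3 :: "real \<Rightarrow> real \<Rightarrow> real \<Rightarrow> real^3^3" where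
  "skew3 a b c = vector [vector [0, - c, b], vector [c, 0, - a], vector [- b, a, 0]]"

lemma skew3_components:
  "skew3 a b c $ 1 $ 1 = 0" "skew3 a b c $ 1 $ 2 = - c" "skew3 a b c $ 1 $ 3 = b"
  "skew3 a b c $ 2 $ 1 = c" "skew3 a b c $ 2 $ 2 = 0" "skew3 a b c $ 2 $ 3 = - a"
  "skew3 a b c $ 3 $ 1 = - b" "skew3 a b c $ 3 $ 2 = a" "skew3 a b c $ 3 $ 3 = 0"
  by (simp_all add: skew3_def)

lemma skew3_mem: "skew3 a b c \<in> carrier so3_lie"
  by (simp add: so3_lie_def vec_eq_iff forall_3 transpose_def skew3_components)

lemma so3_eq_skew3:
  assumes "A \<in> carrier so3_lie"
  shows "A = skew3 (A $ 3 $ 2) (A $ 1 $ 3) (A $ 2 $ 1)"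
proof -
  have *: "A $ j $ i = - A $ i $ j" for i j
  proof -
    have "transpose A = - A" using assms by (simp add: so3_lie_def)
    then have "transpose A $ i $ j = (- A) $ i $ j" by (rule arg_cong)
    then show ?thesis by (simp add: transpose_def)
  qed
  have "A $ 1 $ 1 = 0" "A $ 2 $ 2 = 0" "A $ 3 $ 3 = 0"
    using *[of 1 1] *[of 2 2] *[of 3 3] by simp_all
  then show ?thesis
    using *[of 1 2] *[of 1 3] *[of 2 3]
    by (simp add: vec_eq_iff forall_3 skew3_components)
qed

lemma so3_bracket_skew3:
  "bracket so3_lie (skew3 a b c) (skew3 a' b' c') = skew3 (b * c' - c * b') (c * a' - a * c') (a * b' - b * a')"
  by (simp add: so3_lie_def vec_eq_iff forall_3 matrix_matrix_mult_def sum_3 skew3_components algebra_simps)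

lemma skew3_add: "skew3 a b c + skew3 a' b' c' = skew3 (a + a') (b + b') (c + c')"
  by (simp add: vec_eq_iff forall_3 skew3_components)

lemma skew3_scaleR: "r *\<^sub>R skew3 a b c = skew3 (r * a) (r * b) (r * c)"
  by (simp add: vec_eq_iff forall_3 skew3_components)

lemma lie_dual_neg_bracket:
  assumes "lie_algebra \<gg>" "\<xi> \<in> lie_dual \<gg>" "x \<in> carrier \<gg>" "y \<in> carrier \<gg>"
  shows "\<xi> (bracket \<gg> y x) = - \<xi> (bracket \<gg> x y)"
proof -
  interpret lie_algebra \<gg> by (rule assms(1))
  note xy = assms(3,4)
  have "bracket \<gg> x y + bracket \<gg> y x = bracket \<gg> (x + y) (x + y)"
    using xy by (simp add: bracket_add_left bracket_add_right bracket_self[OF xy(1)] bracket_self[OF xy(2)]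
        subspace_add[OF subspace_carrier])
  also have "\<dots> = 0"
    by (rule bracket_self[OF subspace_add[OF subspace_carrier xy]])
  finally have "bracket \<gg> y x + bracket \<gg> x y = 0"
    by (simp add: add.commute)
  then have "bracket \<gg> y x = (- 1) *\<^sub>R bracket \<gg> x y"
    by (simp add: eq_neg_iff_add_eq_0)
  moreover have "\<xi> ((- 1) *\<^sub>R bracket \<gg> x y) = - 1 * \<xi> (bracket \<gg> x y)"
    using assms(2) bracket_closed[OF xy] unfolding lie_dual_def by blast
  ultimately show ?thesis by simp
qed

lemma constant_heightI:
  assumes "lie_algebra \<gg>"
    and "\<And>\<xi>. \<lbrakk>\<xi> \<in> lie_dual \<gg>; \<exists>x\<in>carrier \<gg>. \<xi> x \<noteq> 0\<rbrakk> \<Longrightarrow>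
      \<exists>X. set X \<subseteq> carrier \<gg> \<and> wedge1 \<xi> (pow2 (\<lambda>x y. - \<xi> (bracket \<gg> x y)) k) X \<noteq> 0"
    and "\<And>\<xi> X. \<lbrakk>\<xi> \<in> lie_dual \<gg>; set X \<subseteq> carrier \<gg>; length X = 2 * k + 3\<rbrakk> \<Longrightarrow>
      wedge1 \<xi> (pow2 (\<lambda>x y. - \<xi> (bracket \<gg> x y)) (Suc k)) X = 0"
  shows "constant_height \<gg> k"
  unfolding constant_height_def
proof (intro ballI impI)
  fix \<xi> assume \<xi>: "\<xi> \<in> lie_dual \<gg>" "\<exists>x\<in>carrier \<gg>. \<xi> x \<noteq> 0"
  let ?\<omega> = "\<lambda>x y. - \<xi> (bracket \<gg> x y)"
  have "wedge1 \<xi> (pow2 ?\<omega> (Suc k)) X = 0" if "set X \<subseteq> carrier \<gg>" for X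
  proof (cases "length X = 2 * k + 3")
    case True
    then show ?thesis using assms(3)[OF \<xi>(1) that] by blast
  next
    case False
    then show ?thesis
      by (intro wedge1_length[of "2 * Suc k"] pow2_length) simp_all
  qed
  then show "has_height \<gg> \<xi> k"
    using has_height_iff[of \<gg> \<xi> ?\<omega> k, OF lie_dual_neg_bracket[OF assms(1) \<xi>(1)] refl] assms(2)[OF \<xi>] by blast
qed

lemma constant_height_Rn: "constant_height (Rn_lie n) 0"
proof (rule constant_heightI[OF lie_algebra_Rn])
  let ?V = "carrier (Rn_lie n)"
  fix \<xi> assume \<xi>: "\<xi> \<in> lie_dual (Rn_lie n)"
  let ?\<omega> = "\<lambda>x y. - \<xi> (bracket (Rn_lie n) x y)"
  show "\<exists>X. set X \<subseteq> ?V \<and> wedge1 \<xi> (pow2 ?\<omega> 0) X \<noteq> 0" if nz: "\<exists>x\<in>?V. \<xi> x \<noteq> 0"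
  proof -
    obtain x where "x \<in> ?V" "\<xi> x \<noteq> 0" using nz by blast
    then show ?thesis by (intro exI[of _ "[x]"]) simp
  qed
  have "(0 :: nat \<Rightarrow>\<^sub>0 real) \<in> ?V" using subspace_0[OF subspace_Rn] by (simp add: Rn_lie_def abelian_lie_def)
  then have "\<xi> (0 *\<^sub>R 0) = 0 * \<xi> 0" using \<xi> unfolding lie_dual_def by blast
  then have "?\<omega> x y = 0" for x y by (simp add: Rn_lie_def abelian_lie_def)
  then show "wedge1 \<xi> (pow2 ?\<omega> (Suc 0)) X = 0" if "set X \<subseteq> ?V" for X
    using pow2_Suc_zero_on[of ?V ?\<omega>] that by (intro wedge1_zero_on[of ?V]) blast+
qed

lemma length_3_cases: "length X = 3 \<Longrightarrow> \<exists>u v w. X = [u, v, w]"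
  by (auto simp: numeral_3_eq_3 length_Suc_conv)

text \<open>If \<tau> is the projection to the first factor, then d\<xi> = \<xi> \<and> \<tau> for
  every \<xi>, hence \<xi> \<and> d\<xi> = 0.\<close>

lemma constant_height_R_semidirect_Rn: "constant_height (R_semidirect_Rn_lie n) 0"
proof (rule constant_heightI[OF lie_algebra_R_semidirect_Rn])
  let ?g = "R_semidirect_Rn_lie n"
  interpret lie_algebra ?g by (rule lie_algebra_R_semidirect_Rn)
  let ?V = "carrier ?g"
  fix \<xi> assume \<xi>: "\<xi> \<in> lie_dual ?g"
  let ?\<omega> = "\<lambda>x y. - \<xi> (bracket ?g x y)"
  show "\<exists>X. set X \<subseteq> ?V \<and> wedge1 \<xi> (pow2 ?\<omega> 0) X \<noteq> 0" if nz: "\<exists>x\<in>?V. \<xi> x \<noteq> 0"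
  proof -
    obtain x where "x \<in> ?V" "\<xi> x \<noteq> 0" using nz by blast
    then show ?thesis by (intro exI[of _ "[x]"]) simp
  qed
  have \<omega>: "?\<omega> x y = fst y * \<xi> x - fst x * \<xi> y" if xy: "x \<in> ?V" "y \<in> ?V" for x y
  proof -
    have "bracket ?g x y = fst x *\<^sub>R y + (- fst y) *\<^sub>R x"
      by (simp add: R_semidirect_Rn_simps prod_eq_iff)
    moreover have "fst x *\<^sub>R y \<in> ?V" "(- fst y) *\<^sub>R x \<in> ?V"
      using xy subspace_scale[OF subspace_carrier] by blast+
    then have "\<xi> (fst x *\<^sub>R y + (- fst y) *\<^sub>R x) = \<xi> (fst x *\<^sub>R y) + \<xi> ((- fst y) *\<^sub>R x)"
      using \<xi> unfolding lie_dual_def by blast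
    moreover have "\<xi> (fst x *\<^sub>R y) = fst x * \<xi> y" "\<xi> ((- fst y) *\<^sub>R x) = (- fst y) * \<xi> x"
      using \<xi> xy unfolding lie_dual_def by blast+
    ultimately have "\<xi> (bracket ?g x y) = fst x * \<xi> y + (- fst y) * \<xi> x"
      by (simp only:)
    then show ?thesis by simp
  qed
  fix X assume X: "set X \<subseteq> ?V" "length X = 2 * 0 + 3"
  then obtain u v w where uvw: "X = [u, v, w]" using length_3_cases[of X] by auto
  then have "u \<in> ?V" "v \<in> ?V" "w \<in> ?V" using X by auto
  then show "wedge1 \<xi> (pow2 ?\<omega> (Suc 0)) X = 0"
    unfolding uvw wedge1_pow2_1 by (simp only: \<omega>) (simp add: algebra_simps)
qed

text \<open>In cross-product coordinates \<xi> is the pairing with (p, q, r), and d\<xi> is minus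
  the triple product with this vector. So \<xi> \<and> d\<xi> takes the value -(p^2 + q^2 + r^2) on
  the standard basis, while (d\<xi>)^2 is a 4-form on a three-dimensional space.\<close>

lemma constant_height_so3: "constant_height so3_lie 1"
proof (rule constant_heightI[OF lie_algebra_so3])
  let ?V = "carrier so3_lie"
  fix \<xi> assume \<xi>: "\<xi> \<in> lie_dual so3_lie"
  let ?\<omega> = "\<lambda>x y. - \<xi> (bracket so3_lie x y)"
  define p q r where "p = \<xi> (skew3 1 0 0)" and "q = \<xi> (skew3 0 1 0)" and "r = \<xi> (skew3 0 0 1)"
  have \<xi>s: "\<xi> (skew3 a b c) = a * p + b * q + c * r" for a b c
  proof -
    have add: "\<xi> (skew3 a b c + skew3 a' b' c') = \<xi> (skew3 a b c) + \<xi> (skew3 a' b' c')" for a b c a' b' c'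
      using \<xi> skew3_mem unfolding lie_dual_def by blast
    have scale: "\<xi> (t *\<^sub>R skew3 a b c) = t * \<xi> (skew3 a b c)" for t a b c
      using \<xi> skew3_mem unfolding lie_dual_def by blast
    have "skew3 a b c = a *\<^sub>R skew3 1 0 0 + skew3 0 b c" "skew3 0 b c = b *\<^sub>R skew3 0 1 0 + c *\<^sub>R skew3 0 0 1"
      by (simp_all add: skew3_add skew3_scaleR)
    moreover have "\<xi> (a *\<^sub>R skew3 1 0 0 + skew3 0 b c) = a * p + \<xi> (skew3 0 b c)"
      using add[of "a * 1" "a * 0" "a * 0" 0 b c] scale[of a 1 0 0] unfolding skew3_scaleR p_def by simp
    moreover have "\<xi> (b *\<^sub>R skew3 0 1 0 + c *\<^sub>R skew3 0 0 1) = b * q + c * r"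
      using add[of "b * 0" "b * 1" "b * 0" "c * 0" "c * 0" "c * 1"] scale[of b 0 1 0] scale[of c 0 0 1]
      unfolding skew3_scaleR q_def r_def by simp
    ultimately show ?thesis by simp
  qed
  have \<omega>s: "?\<omega> (skew3 a b c) (skew3 a' b' c') = - ((b * c' - c * b') * p + (c * a' - a * c') * q + (a * b' - b * a') * r)"
    for a b c a' b' c'
    unfolding so3_bracket_skew3 \<xi>s ..
  have ex: "\<exists>a b c. A = skew3 a b c" if "A \<in> ?V" for A
    using so3_eq_skew3[OF that] by blast
  show "\<exists>X. set X \<subseteq> ?V \<and> wedge1 \<xi> (pow2 ?\<omega> 1) X \<noteq> 0" if nz: "\<exists>x\<in>?V. \<xi> x \<noteq> 0"
  proof (intro exI conjI)
    let ?X = "[skew3 1 0 0, skew3 0 1 0, skew3 0 0 1]"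
    show "set ?X \<subseteq> ?V" by (simp add: skew3_mem)
    have "p \<noteq> 0 \<or> q \<noteq> 0 \<or> r \<noteq> 0"
    proof -
      obtain A where A: "A \<in> ?V" "\<xi> A \<noteq> 0" using nz by blast
      obtain a b c where "A = skew3 a b c" using ex[OF A(1)] by blast
      then show ?thesis using A(2) by (auto simp: \<xi>s)
    qed
    then have "p * p + q * q + r * r \<noteq> 0"
      using sum_squares_gt_zero_iff[of p q] not_square_less_zero[of r]
      by (smt (verit) mult_eq_0_iff zero_le_square)
    moreover have "wedge1 \<xi> (pow2 ?\<omega> (Suc 0)) ?X = - (p * p + q * q + r * r)"
      unfolding wedge1_pow2_1 \<omega>s \<xi>s by (simp add: algebra_simps)
    ultimately show "wedge1 \<xi> (pow2 ?\<omega> 1) ?X \<noteq> 0" unfolding One_nat_def by simp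
  qed
  fix X assume X: "set X \<subseteq> ?V" "length X = 2 * 1 + 3"
  have "pow2 ?\<omega> (Suc (Suc 0)) Z = 0" if Z: "set Z \<subseteq> ?V" for Z
  proof (cases "length Z = 4")
    case True
    then obtain A B C D where ABCD: "Z = [A, B, C, D]"
      by (auto simp: eval_nat_numeral length_Suc_conv)
    then have "A \<in> ?V" "B \<in> ?V" "C \<in> ?V" "D \<in> ?V" using Z by auto
    then obtain a1 a2 a3 b1 b2 b3 c1 c2 c3 d1 d2 d3 where
      "A = skew3 a1 a2 a3" "B = skew3 b1 b2 b3" "C = skew3 c1 c2 c3" "D = skew3 d1 d2 d3"
      using ex by metis
    then show ?thesis
      unfolding ABCD pow2_2 by (simp only: \<omega>s) (simp add: algebra_simps)
  next
    case False
    then show ?thesis using pow2_length[of Z 2] by (simp add: numeral_2_eq_2 del: pow2.simps)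
  qed
  then show "wedge1 \<xi> (pow2 ?\<omega> (Suc 1)) X = 0"
    unfolding One_nat_def using X(1) by (rule wedge1_zero_on)
qed

section \<open>Classification\<close>

lemma (in lie_algebra) fin_dim_carrier: "fin_dim (carrier \<gg>)"
proof -
  obtain B where "finite B" "span B = carrier \<gg>" using finite_dim by blast
  then show ?thesis unfolding fin_dim_def by (intro exI[of _ B]) simp
qed

text \<open>The pair (t, x) goes to t e + \<psi> x, where \<psi> parametrises the eigenspace of ad e
  for 1; applying ad e separates the two summands.\<close>

lemma isomorphic_R_semidirect_Rn:
  fixes \<gg> :: "'a::real_vector lie_alg"
  assumes "lie_algebra \<gg>" "lie_bracket br"
    and br: "\<And>x y. \<lbrakk>x \<in> carrier \<gg>; y \<in> carrier \<gg>\<rbrakk> \<Longrightarrow> br x y = bracket \<gg> x y"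
    and e: "e \<in> carrier \<gg>" "e \<noteq> 0"
    and dec: "\<And>v. v \<in> carrier \<gg> \<Longrightarrow> \<exists>b u. u \<in> carrier \<gg> \<and> br e u = u \<and> v = b *\<^sub>R e + u"
    and ab: "\<And>u w. \<lbrakk>u \<in> carrier \<gg>; w \<in> carrier \<gg>; br e u = u; br e w = w\<rbrakk> \<Longrightarrow> br u w = 0"
  shows "\<exists>n. \<gg> \<cong>\<^sub>L R_semidirect_Rn_lie n"
proof -
  interpret lie_algebra \<gg> by (rule assms(1))
  interpret lie_bracket br by (rule assms(2))
  let ?V = "carrier \<gg>"
  define U where "U = {u \<in> ?V. br e u = u}"
  have U: "subspace U"
    using subspace_carrier by (auto simp: U_def subspace_def)
  have "fin_dim U" by (rule fin_dim_subset[OF fin_dim_carrier]) (simp add: U_def)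
  then obtain n and \<psi> :: "_ \<Rightarrow> 'a" where \<psi>: "linear \<psi>" "bij_betw \<psi> (Rn n) U"
    using Rn_parametrisation[OF _ U] by blast
  have \<psi>U: "\<psi> x \<in> ?V" "br e (\<psi> x) = \<psi> x" if "x \<in> Rn n" for x
    using \<psi>(2) that by (auto simp: bij_betw_def U_def)
  define \<phi> where "\<phi> v = fst v *\<^sub>R e + \<psi> (snd v)" for v
  have lin: "linear \<phi>"
    by (intro linearI) (simp_all add: \<phi>_def linear_add[OF \<psi>(1)] linear_cmul[OF \<psi>(1)] algebra_simps)
  have "bij_betw \<phi> (UNIV \<times> Rn n) ?V"
    unfolding bij_betw_def
  proof
    show "inj_on \<phi> (UNIV \<times> Rn n)"
    proof (rule inj_onI)
      fix v w assume vw: "v \<in> UNIV \<times> Rn n" "w \<in> UNIV \<times> Rn n" "\<phi> v = \<phi> w"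
      then have R: "snd v \<in> Rn n" "snd w \<in> Rn n" by auto
      have "br e (\<phi> v) = br e (\<phi> w)" using vw(3) by simp
      then have "\<psi> (snd v) = \<psi> (snd w)" using \<psi>U(2) R by (simp add: \<phi>_def)
      moreover from this have "fst v = fst w" using vw(3) e(2) by (simp add: \<phi>_def)
      moreover have "inj_on \<psi> (Rn n)" using \<psi>(2) by (simp add: bij_betw_def)
      ultimately show "v = w" using R by (simp add: prod_eq_iff inj_on_def)
    qed
    show "\<phi> ` (UNIV \<times> Rn n) = ?V"
    proof
      show "\<phi> ` (UNIV \<times> Rn n) \<subseteq> ?V"
      proof
        fix v assume "v \<in> \<phi> ` (UNIV \<times> Rn n)"
        then obtain z where "z \<in> UNIV \<times> Rn n" "v = \<phi> z" by (rule imageE)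
        then show "v \<in> ?V"
          using e(1) \<psi>U(1) by (auto simp: \<phi>_def subspace_add[OF subspace_carrier] subspace_scale[OF subspace_carrier])
      qed
      show "?V \<subseteq> \<phi> ` (UNIV \<times> Rn n)"
      proof
        fix v assume "v \<in> ?V"
        then obtain b u where u: "u \<in> ?V" "br e u = u" "v = b *\<^sub>R e + u" using dec by blast
        then have "u \<in> \<psi> ` Rn n" using \<psi>(2) by (simp add: bij_betw_def U_def)
        then obtain x where "x \<in> Rn n" "u = \<psi> x" by blast
        then show "v \<in> \<phi> ` (UNIV \<times> Rn n)" by (intro image_eqI[of _ _ "(b, x)"]) (simp_all add: \<phi>_def u(3))
      qed
    qed
  qed
  then have bij: "bij_betw \<phi> (carrier (R_semidirect_Rn_lie n)) ?V" by (simp add: R_semidirect_Rn_simps)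
  have "\<gg> \<cong>\<^sub>L R_semidirect_Rn_lie n"
  proof (rule lie_isomorphic_sym[OF lie_algebra_R_semidirect_Rn lin bij])
    fix v w assume "v \<in> carrier (R_semidirect_Rn_lie n)" "w \<in> carrier (R_semidirect_Rn_lie n)"
    then have vw: "\<phi> v \<in> ?V" "\<phi> w \<in> ?V" "snd v \<in> Rn n" "snd w \<in> Rn n"
      using bij by (auto simp: bij_betw_def R_semidirect_Rn_simps)
    have "br (\<phi> v) (\<phi> w) = fst v *\<^sub>R \<psi> (snd w) - fst w *\<^sub>R \<psi> (snd v)"
      using \<psi>U[OF vw(3)] \<psi>U[OF vw(4)] ab[of "\<psi> (snd v)" "\<psi> (snd w)"] br_skew[of "\<psi> (snd v)" e]
      by (simp add: \<phi>_def)
    then show "\<phi> (bracket (R_semidirect_Rn_lie n) v w) = bracket \<gg> (\<phi> v) (\<phi> w)"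
      using br[OF vw(1,2)]
      by (simp add: R_semidirect_Rn_simps \<phi>_def[of "(0, _)"] linear_diff[OF \<psi>(1)] linear_cmul[OF \<psi>(1)])
  qed
  then show ?thesis by blast
qed

lemma isomorphic_so3:
  fixes \<gg> :: "'a::real_vector lie_alg"
  assumes "lie_algebra \<gg>" "lie_bracket br"
    and br: "\<And>x y. \<lbrakk>x \<in> carrier \<gg>; y \<in> carrier \<gg>\<rbrakk> \<Longrightarrow> br x y = bracket \<gg> x y"
    and t: "lie_bracket.so3_triple br e1 e2 e3" and sp: "span {e1, e2, e3} = carrier \<gg>"
  shows "\<gg> \<cong>\<^sub>L so3_lie"
proof -
  interpret lie_bracket br by (rule assms(2))
  let ?V = "carrier \<gg>"
  define \<phi> where "\<phi> A = (A $ 3 $ 2) *\<^sub>R e1 + (A $ 1 $ 3) *\<^sub>R e2 + (A $ 2 $ 1) *\<^sub>R e3" for A :: "real^3^3"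
  have \<phi>s: "\<phi> (skew3 a b c) = a *\<^sub>R e1 + b *\<^sub>R e2 + c *\<^sub>R e3" for a b c
    by (simp add: \<phi>_def skew3_components)
  have lin: "linear \<phi>"
    by (intro linearI) (simp_all add: \<phi>_def algebra_simps)
  have \<phi>V: "\<phi> A \<in> ?V" for A
    unfolding \<phi>_def sp[symmetric] by (intro span_add span_scale span_base) auto
  have "bij_betw \<phi> (carrier so3_lie) ?V"
    unfolding bij_betw_def
  proof
    show "inj_on \<phi> (carrier so3_lie)"
    proof (rule inj_onI)
      fix A A' assume A: "A \<in> carrier so3_lie" "A' \<in> carrier so3_lie" "\<phi> A = \<phi> A'"
      let ?a = "A $ 3 $ 2 - A' $ 3 $ 2" and ?b = "A $ 1 $ 3 - A' $ 1 $ 3" and ?c = "A $ 2 $ 1 - A' $ 2 $ 1"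
      have "?a *\<^sub>R e1 + ?b *\<^sub>R e2 + ?c *\<^sub>R e3 = 0"
        using A(3) by (simp add: \<phi>_def algebra_simps)
      then have "?a = 0 \<and> ?b = 0 \<and> ?c = 0"
        by (intro so3_triple_centraliser[OF t]) simp_all
      then show "A = A'"
        using so3_eq_skew3[OF A(1)] so3_eq_skew3[OF A(2)] by simp
    qed
    show "\<phi> ` carrier so3_lie = ?V"
    proof
      show "\<phi> ` carrier so3_lie \<subseteq> ?V" using \<phi>V by blast
      show "?V \<subseteq> \<phi> ` carrier so3_lie"
      proof
        fix v assume "v \<in> ?V"
        then obtain a b c where "v = a *\<^sub>R e1 + b *\<^sub>R e2 + c *\<^sub>R e3"
          unfolding sp[symmetric] by (auto simp: span_insert algebra_simps)
        then show "v \<in> \<phi> ` carrier so3_lie"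
          using \<phi>s skew3_mem by (metis image_eqI)
      qed
    qed
  qed
  then show ?thesis
  proof (rule lie_isomorphic_sym[OF lie_algebra_so3 lin])
    fix A A' assume "A \<in> carrier so3_lie" "A' \<in> carrier so3_lie"
    then obtain a b c a' b' c' where A: "A = skew3 a b c" "A' = skew3 a' b' c'"
      using so3_eq_skew3 by blast
    have "br (\<phi> A) (\<phi> A') = \<phi> (bracket so3_lie A A')"
      unfolding A so3_bracket_skew3 \<phi>s by (simp add: so3_triple_bracket[OF t] algebra_simps)
    then show "\<phi> (bracket so3_lie A A') = bracket \<gg> (\<phi> A) (\<phi> A')"
      using br[OF \<phi>V \<phi>V] by simp
  qed
qed

theorem constant_height_classification:
  fixes \<gg> :: "'a::real_vector lie_alg"
  assumes g: "lie_algebra \<gg>" and h: "has_constant_height \<gg>"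
  shows "(\<exists>n. \<gg> \<cong>\<^sub>L Rn_lie n) \<or> (\<exists>n. \<gg> \<cong>\<^sub>L R_semidirect_Rn_lie n) \<or> \<gg> \<cong>\<^sub>L so3_lie"
proof -
  interpret lie_algebra \<gg> by (rule g)
  let ?V = "carrier \<gg>"
  obtain br where "lie_bracket br" and br: "\<And>x y. \<lbrakk>x \<in> ?V; y \<in> ?V\<rbrakk> \<Longrightarrow> br x y = bracket \<gg> x y"
    using exists_global_bracket by blast
  then interpret lie_bracket br by simp
  have V: "subalgebra ?V"
    using subspace_carrier fin_dim_carrier br bracket_closed by (simp add: subalgebra_def)
  obtain k where k: "constant_height \<gg> k" using h unfolding has_constant_height_def by blast
  have height: "has_height \<gg> \<xi> k \<longleftrightarrow> (\<exists>X. set X \<subseteq> ?V \<and> wedge1 \<xi> (pow2 (dform \<xi>) k) X \<noteq> 0) \<and>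
      (\<forall>X. set X \<subseteq> ?V \<longrightarrow> wedge1 \<xi> (pow2 (dform \<xi>) (Suc k)) X = 0)" if "linear \<xi>" for \<xi>
    using lie_dual_neg_bracket[OF g linear_mem_lie_dual[OF that]]
    by (rule has_height_iff) (simp_all add: dform_def br)
  have hh: "has_height \<gg> \<xi> k" if "linear \<xi>" "\<exists>x\<in>?V. \<xi> x \<noteq> 0" for \<xi>
    using k that linear_mem_lie_dual unfolding constant_height_def by blast
  have nz: "\<exists>X. set X \<subseteq> ?V \<and> wedge1 \<xi> (pow2 (dform \<xi>) k) X \<noteq> 0" if "linear \<xi>" "\<exists>x\<in>?V. \<xi> x \<noteq> 0" for \<xi>
    using hh[OF that] height[OF that(1)] by blast
  \<comment> \<open>Functionals vanishing on the carrier have no height but are included here,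
    because the perturbed functionals \<xi> + t \<eta> are not checked to be nonzero.\<close>
  have zero: "wedge1 \<xi> (pow2 (dform \<xi>) (Suc k)) X = 0" if "linear \<xi>" "set X \<subseteq> ?V" for \<xi> X
  proof (cases "\<exists>x\<in>?V. \<xi> x \<noteq> 0")
    case True
    then show ?thesis using hh[OF that(1)] height[OF that(1)] that(2) by blast
  next
    case False
    then show ?thesis using that(2) by (intro wedge1_zero_left_on[of ?V]) blast+
  qed
  show ?thesis
  proof (cases "abelian ?V")
    case True
    then have "bracket \<gg> x y = 0" if "x \<in> ?V" "y \<in> ?V" for x y
      using br[OF that] that unfolding abelian_def by simp
    then show ?thesis by (intro disjI1 abelian_isomorphic_Rn[OF g])
  next
    case na: False
    show ?thesis
    proof (cases "k = 0")
      case True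
      have "\<exists>n. \<gg> \<cong>\<^sub>L R_semidirect_Rn_lie n"
      proof (rule height_0_dichotomy[OF V zero[unfolded True] na])
        fix e assume e: "e \<in> ?V" "e \<noteq> 0" "\<And>v. v \<in> ?V \<Longrightarrow> \<exists>b u. u \<in> ?V \<and> br e u = u \<and> v = b *\<^sub>R e + u"
          "\<And>u w. \<lbrakk>u \<in> ?V; w \<in> ?V; br e u = u; br e w = w\<rbrakk> \<Longrightarrow> br u w = 0"
        show ?thesis
          by (rule isomorphic_R_semidirect_Rn[OF g \<open>lie_bracket br\<close> br e])
      qed
      then show ?thesis by blast
    next
      case False
      have perfect: "span {br x y | x y. x \<in> ?V \<and> y \<in> ?V} = ?V"
        by (rule exists_nonzero_form_imp_perfect[OF V False nz])
      have "stably_contact ?V"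
        by (rule stably_contactI[OF V nz pow2_Suc_eq_0[OF V perfect nz zero]])
      then obtain e1 e2 e3 where t: "so3_triple e1 e2 e3" "span {e1, e2, e3} = ?V"
        using stably_contact_cases[OF V] na by blast
      have "\<gg> \<cong>\<^sub>L so3_lie"
        by (rule isomorphic_so3[OF g \<open>lie_bracket br\<close> br t])
      then show ?thesis by blast
    qed
  qed
qed

theorem theorem8p1:
  shows "(\<forall>\<gg> :: 'a::real_vector lie_alg. lie_algebra \<gg> \<and> has_constant_height \<gg> \<longrightarrow>
            (\<exists>n. \<gg> \<cong>\<^sub>L Rn_lie n) \<or> (\<exists>n. \<gg> \<cong>\<^sub>L R_semidirect_Rn_lie n) \<or> \<gg> \<cong>\<^sub>L so3_lie)
       \<and> (\<forall>n. constant_height (Rn_lie n) 0)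
       \<and> (\<forall>n. constant_height (R_semidirect_Rn_lie n) 0)
       \<and> constant_height so3_lie 1"
  using constant_height_classification constant_height_Rn constant_height_R_semidirect_Rn constant_height_so3
  by blast

end
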